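(* Let $T:I\to I$ and the coupled map lattice $\hat T:I^n\to I^n$ be as in the context, with $\lambda=\sup_i\sup_{x\in T(A_i)}|D(T_{|A_i})^{-1}(x)|<1-\gamma$. Suppose that $\hat T$ satisfies properties P1–P5, P01 and P02 of the context on a Banach space $\mathcal B$, and that either P7 holds, or $\mathcal B=V_1(I^n)$ and P8 holds. Then the extremal index $\theta_n$ along the diagonal is given by $$\theta_n=1-\frac{1}{(1-\gamma)^{n-1}}\,\frac{\displaystyle\int_I \frac{\hat h_n(x,\dots,x)}{|DT(x)|^{n-1}}\,dx}{\displaystyle\int_I \hat h_n(x,\dots,x)\,dx}.$$ Moreover, if $T$ and $\gamma$ are fixed and these hypotheses hold for every $n\ge2$ (on a Banach space that may depend on $n$), then $\theta_n\to 1$ as $n\to\infty$.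
   Context: Setting. $I=[0,1]$; $T$ is a piecewise expanding map of $I$ onto itself with a finite number $q$ of branches, with domains of injectivity the intervals $A_1,\dots,A_q$; $T$ is of class $C^2$ on the interiors of the $A_i$ and extended by continuity to the boundaries; $\lambda:=\sup_i\sup_{x\in T(A_i)}|D(T_{|A_i})^{-1}(x)|$. For $n\ge2$, $\gamma\in[0,1]$, $$\hat T(\overline{x})_i=(1-\gamma)T(x_i)+\frac{\gamma}{n}\sum_{j=1}^nT(x_j),\quad i=1,\dots,n,\ \overline x\in I^n.$$ The domains of local injectivity of $\hat T$ are $U_1,\dots,U_{q^n}$. There are open sets $W_k\supset U_k$ such that $\hat T_{|W_k}$ is a $C^2$ diffeomorphism onto its image, and it is a standing requirement that $$s_n:=\sup_k\sup_{\overline x\in\hat T(W_k)}\|D(\hat T_{|W_k})^{-1}(\overline x)\|<\lambda<1,$$ where $\|\cdot\|$ is the Euclidean norm. $\mathrm{Leb}$ is Lebesgue measure on $I^n$; $L^1,L^\infty$ are with respect to it. The transfer operator $\hat P$ is defined by $\int \hat P(f)\,g\,d\mathrm{Leb}=\int f\,g\circ\hat T\,d\mathrm{Leb}$ for $f\in L^1$, $g\in L^\infty$. Synchronization sets. $\hat\mu$ is the invariant measure of P2, with density $\hat h=\hat h_n$. Let $\psi(\overline x)=-\log\max_{i\ne j}|x_i-x_j|$, fix $\tau>0$, and let $(u_m)$ be such that $m\,\hat\mu(\psi>u_m)\to\tau$. Put $\nu_m=e^{-u_m}$ (so $\nu_m\to0$), $S^{(n)}_m=\{\overline x\in I^n:\max_{i\ne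 j}|x_i-x_j|\le\nu_m\}$ and $\tilde P_m(f)=\hat P(f\,\mathbf 1_{(S_m^{(n)})^c})$. The sets $(S_m^{(n)})^c$ are nested and increasing, with Lebesgue measure tending to $1$. Properties. $\mathcal B$ is a Banach space with norm $\|\cdot\|_{\mathcal B}$, compactly injected in $L^1$, on which $\hat P$ and $\tilde P_m$ act. - P1: there are $\eta<1$, $C>0$ with $\|\hat Pf\|_{\mathcal B}\le\eta\|f\|_{\mathcal B}+C\|f\|_1$ for all $f\in\mathcal B$. - P2: the eigenvalue $1$ of $\hat P$ is simple and there is no other eigenvalue on the unit circle; thus $\hat T$ has a unique absolutely continuous invariant measure $\hat\mu$, which is mixing; its density $\hat h$ is in $L^\infty$. - P3: the operators $\tilde P_m$ satisfy a Lasota–Yorke inequality as in P1 on $\mathcal B$, with the same factors $\eta$ and $C$ for every sufficiently large $m$. - P4: $r_m:=\sup_{\|f\|_{\mathcal B}\le1}\left|\int(\hat Pf-\tilde P_mf)\,d\mathrm{Leb}\right|\to0$ as $m\to\infty$. - P5: there is $C'$ independent of $m$ with $r_m\|(\hat P-\tilde P_m)\hat h\|_{\mathcal B}\le C'\hat\mu(S_m^{(n)})$; moreover $\hat h\ge\hat h^{(\inf)}>0$ on a set of full measure, for a constant $\hat h^{(\inf)}$. - P7: $\hat h$ is continuous on $I^n$. - P8: $\hat h\in V_1(I^n)$ and $\sup_{0<\varepsilon\le\varepsilon_0}\frac1\varepsilon\int_I\mathrm{osc}(\hat h,B_\varepsilon(x,\dots,x))\,dx<\infty$. Here $\varepsilon_0>0$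 is fixed, $B_\varepsilon(\overline x)$ is the ball of radius $\varepsilon$ about $\overline x$, $\mathrm{osc}(f,A)=\operatorname{ess\,sup}_Af-\operatorname{ess\,inf}_Af$, and $V_1(I^n)$ is the space of $f\in L^1(I^n)$ with $|f|_{V_1}:=\sup_{0<\varepsilon\le\varepsilon_0}\frac1\varepsilon\int\mathrm{osc}(f,B_\varepsilon(\overline x))\,d\mathrm{Leb}(\overline x)<\infty$, with norm $|f|_{V_1}+\|f\|_{L^1}$. Under P8, $\hat h(x,\dots,x)$ denotes, for a.e. $x\in I$, the common limit as $\varepsilon\to0$ of the essential supremum and essential infimum of $\hat h$ on $B_\varepsilon(x,\dots,x)\cap I^n$. Let $\Delta=\{\overline x: x_1=\dots=x_n\}$ and let $V_\varepsilon(\Delta)$ be an $\varepsilon$-neighborhood of $\Delta$. - P01: the boundaries of the $U_k$ are a union of finitely many discontinuity surfaces $\mathcal D_1,\dots,\mathcal D_r$, which are co-dimension $1$ embedded submanifolds; let $\mathcal D=\bigcup_j\mathcal D_j$. For $\varepsilon>0$, $k\in\mathbb N$, let $F_{d,\varepsilon,k}$ be the set of $x\in V_\varepsilon(\Delta)$ for which there is a neighborhood $\mathcal O(x)$ such that $\mathcal O(x)\cap\Delta\ne\emptyset$ and $\mathcal O(x)\cap(\mathcal D\cup\hat T^{-1}\mathcal D\cup\dots\cup\hat T^{-k}\mathcal D)=\emptyset$. There is a constant $C_k$ independent of $\varepsilon$ such that $\hat\mu(V_\varepsilon(\Delta)\setminus F_{d,\varepsilon,k})\le C_k\,\sigma(\varepsilon)\,\hat\mu(V_\varepsilon(\Delta))$,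 where $\sigma(\varepsilon)\to0$ as $\varepsilon\to0$. - P02: let $G_{d,\varepsilon}$ be the set of points of $V_\varepsilon(\Delta)$ for which the segment of minimal length connecting the point to $\Delta$ intersects one component of some $\hat T\mathcal D_j$. For $\varepsilon$ small enough there is a constant $C_d$ independent of $\varepsilon$ with $\hat\mu(G_{d,\varepsilon})\le C_d\,\kappa(\varepsilon)\,\hat\mu(V_\varepsilon(\Delta))$, where $\kappa(\varepsilon)\to0$ as $\varepsilon\to0$. Extremal index. $\theta_n:=1-\sum_{k=0}^\infty q_k$, where $$q_k=\lim_{m\to\infty}\frac{\int(\hat P-\tilde P_m)\tilde P_m^k(\hat P-\tilde P_m)(\hat h)\,d\mathrm{Leb}}{\hat\mu(S_m^{(n)})},\qquad k\ge0,$$ and the statement includes the existence of these limits.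
   Formalization: The standing requirement s_n < λ cannot hold: at diagonal points the inverse derivative has norm 1/((1−γ)|DT|), so s_n ≥ λ/(1−γ) ≥ λ. The formal statement requires only s_n < 1, together with λ < 1−γ. *)

theory Defs
  imports "HOL-Probability.Probability"
begin

text \<open>
  The dimension \<open>n\<close> of the lattice has to vary inside the statement, so \<open>\<real>\<close> to the power \<open>n\<close> is
  the topological space \<open>powertop_real {..<n}\<close>, whose points are the functions that are extensional
  on \<open>{..<n}\<close>. Elements of \<open>L\<^sup>1\<close> are represented by Borel functions, equality in \<open>L\<^sup>1\<close> being
  equality almost everywhere.
\<close>

definition unit_cube :: "nat \<Rightarrow> (nat \<Rightarrow> real) set"
  where "unit_cube n = (\<Pi>\<^sub>E i\<in>{..<n}. {0..1})"

definition leb :: "nat \<Rightarrow> (nat \<Rightarrow> real) measure"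
  where "leb n = (\<Pi>\<^sub>M i\<in>{..<n}. restrict_space lborel {0..1})"

definition euclid_dist :: "nat \<Rightarrow> (nat \<Rightarrow> real) \<Rightarrow> (nat \<Rightarrow> real) \<Rightarrow> real"
  where "euclid_dist n x y = L2_set (\<lambda>i. x i - y i) {..<n}"

definition cube_ball :: "nat \<Rightarrow> (nat \<Rightarrow> real) \<Rightarrow> real \<Rightarrow> (nat \<Rightarrow> real) set"
  where "cube_ball n x r = {y \<in> unit_cube n. euclid_dist n x y < r}"

definition diag_point :: "nat \<Rightarrow> real \<Rightarrow> nat \<Rightarrow> real"
  where "diag_point n t = (\<lambda>i\<in>{..<n}. t)"

definition diagonal :: "nat \<Rightarrow> (nat \<Rightarrow> real) set"
  where "diagonal n = {x \<in> unit_cube n. \<forall>i<n. \<forall>j<n. x i = x j}"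

definition diag_nbhd :: "nat \<Rightarrow> real \<Rightarrow> (nat \<Rightarrow> real) set"
  where "diag_nbhd n r = {x \<in> unit_cube n. \<exists>z\<in>diagonal n. euclid_dist n x z < r}"

definition partial_deriv :: "nat \<Rightarrow> ((nat \<Rightarrow> real) \<Rightarrow> real) \<Rightarrow> (nat \<Rightarrow> real) \<Rightarrow> real"
  where "partial_deriv j f x = deriv (\<lambda>t. f (x(j := t))) (x j)"

text \<open>Class \<open>C\<close> to the power \<open>k\<close> on an open set \<open>W\<close>: all iterated partial derivatives up to
  order \<open>k\<close> exist and are continuous on \<open>W\<close>.\<close>

fun Ck_on :: "nat \<Rightarrow> nat \<Rightarrow> (nat \<Rightarrow> real) set \<Rightarrow> ((nat \<Rightarrow> real) \<Rightarrow> real) \<Rightarrow> bool"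
  where
    "Ck_on n 0 W f \<longleftrightarrow>
       continuous_map (subtopology (powertop_real {..<n}) W) euclideanreal f"
  | "Ck_on n (Suc k) W f \<longleftrightarrow>
       continuous_map (subtopology (powertop_real {..<n}) W) euclideanreal f \<and>
       (\<forall>j<n. (\<forall>x\<in>W. (\<lambda>t. f (x(j := t))) differentiable at (x j)) \<and>
              Ck_on n k W (partial_deriv j f))"

definition Ck_diffeo ::
    "nat \<Rightarrow> nat \<Rightarrow> (nat \<Rightarrow> real) set \<Rightarrow> ((nat \<Rightarrow> real) \<Rightarrow> nat \<Rightarrow> real) \<Rightarrow> bool"
  where "Ck_diffeo n k W F \<longleftrightarrow>
    openin (powertop_real {..<n}) W \<and> openin (powertop_real {..<n}) (F ` W) \<and> inj_on F W \<and>
    (\<forall>i<n. Ck_on n k W (\<lambda>x. F x i)) \<and>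
    (\<forall>i<n. Ck_on n k (F ` W) (\<lambda>y. the_inv_into W F y i))"

definition opnorm :: "nat \<Rightarrow> (nat \<Rightarrow> nat \<Rightarrow> real) \<Rightarrow> real"
  where "opnorm n J =
    (SUP v\<in>{v. L2_set v {..<n} \<le> 1}. L2_set (\<lambda>i. \<Sum>j<n. J i j * v j) {..<n})"

text \<open>Codimension-one embedded submanifolds of class \<open>C\<^sup>1\<close>. Boundary and corners are allowed (the
  index set \<open>J\<close>), as they are needed for the faces of a box.\<close>

definition codim1_submanifold :: "nat \<Rightarrow> (nat \<Rightarrow> real) set \<Rightarrow> bool"
  where "codim1_submanifold n S \<longleftrightarrow>
    (\<forall>p\<in>S. \<exists>V \<phi> J. p \<in> V \<and> Ck_diffeo n 1 V \<phi> \<and> J \<subseteq> {1..<n} \<and>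
       \<phi> ` (V \<inter> S) = {y \<in> \<phi> ` V. y 0 = 0 \<and> (\<forall>j\<in>J. 0 \<le> y j)})"

text \<open>The \<open>q\<close> branches are indexed by \<open>{..<q}\<close>. Neighbouring intervals may share an endpoint or
  not, so half-open partitions are covered.\<close>

definition piecewise_expanding :: "nat \<Rightarrow> (nat \<Rightarrow> real set) \<Rightarrow> (real \<Rightarrow> real) \<Rightarrow> bool"
  where "piecewise_expanding q A T \<longleftrightarrow>
    T ` {0..1} = {0..1} \<and>
    (\<Union>i<q. A i) = {0..1} \<and>
    (\<forall>i<q. \<forall>j<q. i \<noteq> j \<longrightarrow> interior (A i) \<inter> interior (A j) = {}) \<and>
    (\<forall>i<q. is_interval (A i) \<and> interior (A i) \<noteq> {} \<and> inj_on T (A i) \<and>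
       (\<exists>g. continuous_on (closure (A i)) g \<and> (\<forall>x\<in>A i. g x = T x)) \<and>
       T differentiable_on interior (A i) \<and>
       deriv T differentiable_on interior (A i) \<and>
       continuous_on (interior (A i)) (deriv (deriv T)) \<and>
       (\<forall>x\<in>interior (A i). 1 < \<bar>deriv T x\<bar>))"

text \<open>The number \<open>\<lambda>\<close>. The supremum runs over the images of the interiors, where the derivative of the
  inverse branch is two-sided; extending it continuously to endpoints does not change the value.\<close>

definition contraction_rate :: "nat \<Rightarrow> (nat \<Rightarrow> real set) \<Rightarrow> (real \<Rightarrow> real) \<Rightarrow> ereal"
  where "contraction_rate q A T =
    (SUP i\<in>{..<q}. SUP y\<in>T ` interior (A i). ereal \<bar>deriv (the_inv_into (A i) T) y\<bar>)"

definition cml :: "nat \<Rightarrow> real \<Rightarrow> (real \<Rightarrow> real) \<Rightarrow> (nat \<Rightarrow> real) \<Rightarrow> nat \<Rightarrow> real"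
  where "cml n \<gamma> T x =
    (\<lambda>i\<in>{..<n}. (1 - \<gamma>) * T (x i) + \<gamma> / real n * (\<Sum>j<n. T (x j)))"

text \<open>The \<open>q ^ n\<close> domains of local injectivity are indexed by the functions \<open>k\<close> from \<open>{..<n}\<close>
  to \<open>{..<q}\<close>.\<close>

definition branch_index :: "nat \<Rightarrow> nat \<Rightarrow> (nat \<Rightarrow> nat) set"
  where "branch_index n q = (\<Pi>\<^sub>E i\<in>{..<n}. {..<q})"

definition branch_dom :: "nat \<Rightarrow> (nat \<Rightarrow> real set) \<Rightarrow> (nat \<Rightarrow> nat) \<Rightarrow> (nat \<Rightarrow> real) set"
  where "branch_dom n A k = (\<Pi>\<^sub>E i\<in>{..<n}. A (k i))"

text \<open>An open set \<open>W k\<close> containing the domain of branch \<open>k\<close> may stick out of this domain and out of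
  the cube; \<open>F k\<close> is a \<open>C\<^sup>2\<close> extension of the branch to \<open>W k\<close>.

  The requirement on the supremum \<open>s\<close> is found in the form \<open>s < \<lambda> < 1\<close>. If \<open>\<lambda>\<close> is
  the \<open>contraction_rate\<close> this cannot hold: at diagonal points the norm of the inverse derivative
  is \<open>1 / ((1 - \<gamma>) * \<bar>DT\<bar>)\<close>, so that \<open>s \<ge> \<lambda> / (1 - \<gamma>) \<ge> \<lambda>\<close>. Only the uniform contraction
  \<open>s < 1\<close> is required, which is weaker than \<open>s < \<lambda> < 1\<close> and consistent.\<close>

definition contracting_inverse_branches ::
    "nat \<Rightarrow> nat \<Rightarrow> (nat \<Rightarrow> real set) \<Rightarrow> ((nat \<Rightarrow> real) \<Rightarrow> nat \<Rightarrow> real) \<Rightarrow> bool"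
  where "contracting_inverse_branches n q A Th \<longleftrightarrow>
    (\<exists>W F.
       (\<forall>k\<in>branch_index n q. branch_dom n A k \<subseteq> W k \<and> Ck_diffeo n 2 (W k) (F k) \<and>
          (\<forall>x\<in>branch_dom n A k. F k x = Th x)) \<and>
       (SUP k\<in>branch_index n q. SUP y\<in>F k ` W k.
          ereal (opnorm n (\<lambda>i j. partial_deriv j (\<lambda>y. the_inv_into (W k) (F k) y i) y))) < 1)"

text \<open>For integrable \<open>f\<close>, the function \<open>transfer_op n Th f\<close> is some representative of the transfer
  operator applied to \<open>f\<close>; it is determined almost everywhere by the duality.\<close>

definition transfer_op ::
    "nat \<Rightarrow> ((nat \<Rightarrow> real) \<Rightarrow> nat \<Rightarrow> real) \<Rightarrow> ((nat \<Rightarrow> real) \<Rightarrow> real) \<Rightarrow> (nat \<Rightarrow> real) \<Rightarrow> real"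
  where "transfer_op n Th f = (SOME p. integrable (leb n) p \<and>
    (\<forall>g \<in> borel_measurable (leb n). (\<exists>c. \<forall>x. \<bar>g x\<bar> \<le> c) \<longrightarrow>
       (\<integral>x. p x * g x \<partial>leb n) = (\<integral>x. f x * g (Th x) \<partial>leb n)))"

definition perturbed_op ::
    "nat \<Rightarrow> ((nat \<Rightarrow> real) \<Rightarrow> nat \<Rightarrow> real) \<Rightarrow> (nat \<Rightarrow> real) set
      \<Rightarrow> ((nat \<Rightarrow> real) \<Rightarrow> real) \<Rightarrow> (nat \<Rightarrow> real) \<Rightarrow> real"
  where "perturbed_op n Th S f = transfer_op n Th (\<lambda>x. f x * indicator (- S) x)"

definition diff_op ::
    "nat \<Rightarrow> ((nat \<Rightarrow> real) \<Rightarrow> nat \<Rightarrow> real) \<Rightarrow> (nat \<Rightarrow> real) set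
      \<Rightarrow> ((nat \<Rightarrow> real) \<Rightarrow> real) \<Rightarrow> (nat \<Rightarrow> real) \<Rightarrow> real"
  where "diff_op n Th S f = (\<lambda>x. transfer_op n Th f x - perturbed_op n Th S f x)"

definition L1_norm :: "nat \<Rightarrow> ((nat \<Rightarrow> real) \<Rightarrow> real) \<Rightarrow> real"
  where "L1_norm n f = (\<integral>x. \<bar>f x\<bar> \<partial>leb n)"

text \<open>\<open>B\<close> with norm \<open>N\<close> is a Banach space (of functions modulo equality almost everywhere) that is
  compactly injected in \<open>L\<^sup>1\<close>.\<close>

definition banach_compact_in_L1 ::
    "nat \<Rightarrow> ((nat \<Rightarrow> real) \<Rightarrow> real) set \<Rightarrow> (((nat \<Rightarrow> real) \<Rightarrow> real) \<Rightarrow> real) \<Rightarrow> bool"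
  where "banach_compact_in_L1 n B N \<longleftrightarrow>
    (\<forall>f\<in>B. integrable (leb n) f) \<and>
    (\<forall>f\<in>B. \<forall>g\<in>borel_measurable (leb n). (AE x in leb n. f x = g x) \<longrightarrow> g \<in> B \<and> N g = N f) \<and>
    (\<lambda>x. 0) \<in> B \<and>
    (\<forall>f\<in>B. \<forall>g\<in>B. (\<lambda>x. f x + g x) \<in> B \<and> N (\<lambda>x. f x + g x) \<le> N f + N g) \<and>
    (\<forall>f\<in>B. \<forall>c. (\<lambda>x. c * f x) \<in> B \<and> N (\<lambda>x. c * f x) = \<bar>c\<bar> * N f) \<and>
    (\<forall>f\<in>B. N f = 0 \<longrightarrow> (AE x in leb n. f x = 0)) \<and>
    (\<forall>F::nat \<Rightarrow> (nat \<Rightarrow> real) \<Rightarrow> real.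
       range F \<subseteq> B \<and> (\<forall>e>0. \<exists>M. \<forall>i\<ge>M. \<forall>j\<ge>M. N (\<lambda>x. F i x - F j x) < e) \<longrightarrow>
       (\<exists>f\<in>B. (\<lambda>i. N (\<lambda>x. F i x - f x)) \<longlonglongrightarrow> 0)) \<and>
    (\<forall>F::nat \<Rightarrow> (nat \<Rightarrow> real) \<Rightarrow> real.
       range F \<subseteq> B \<and> (\<exists>c. \<forall>i. N (F i) \<le> c) \<longrightarrow>
       (\<exists>f r. integrable (leb n) f \<and> strict_mono (r :: nat \<Rightarrow> nat) \<and>
          (\<lambda>i. L1_norm n (\<lambda>x. F (r i) x - f x)) \<longlonglongrightarrow> 0))"

definition lasota_yorke ::
    "nat \<Rightarrow> ((nat \<Rightarrow> real) \<Rightarrow> real) set \<Rightarrow> (((nat \<Rightarrow> real) \<Rightarrow> real) \<Rightarrow> real)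
      \<Rightarrow> real \<Rightarrow> real \<Rightarrow> (((nat \<Rightarrow> real) \<Rightarrow> real) \<Rightarrow> (nat \<Rightarrow> real) \<Rightarrow> real) \<Rightarrow> bool"
  where "lasota_yorke n B N \<eta> C Q \<longleftrightarrow> (\<forall>f\<in>B. N (Q f) \<le> \<eta> * N f + C * L1_norm n f)"

text \<open>Eigenvalues on the complexification of \<open>B\<close>.\<close>

definition transfer_eigenvalue ::
    "nat \<Rightarrow> ((nat \<Rightarrow> real) \<Rightarrow> nat \<Rightarrow> real) \<Rightarrow> ((nat \<Rightarrow> real) \<Rightarrow> real) set \<Rightarrow> complex \<Rightarrow> bool"
  where "transfer_eigenvalue n Th B z \<longleftrightarrow>
    (\<exists>f :: (nat \<Rightarrow> real) \<Rightarrow> complex. (\<lambda>x. Re (f x)) \<in> B \<and> (\<lambda>x. Im (f x)) \<in> B \<and>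
       \<not> (AE x in leb n. f x = 0) \<and>
       (AE x in leb n. Complex (transfer_op n Th (\<lambda>x. Re (f x)) x)
                               (transfer_op n Th (\<lambda>x. Im (f x)) x) = z * f x))"

text \<open>The eigenvalue 1 is simple, i.e. its generalised eigenspace is one-dimensional.\<close>

definition one_simple_eigenvalue ::
    "nat \<Rightarrow> ((nat \<Rightarrow> real) \<Rightarrow> nat \<Rightarrow> real) \<Rightarrow> ((nat \<Rightarrow> real) \<Rightarrow> real) set \<Rightarrow> bool"
  where "one_simple_eigenvalue n Th B \<longleftrightarrow>
    (\<exists>f0\<in>B. \<not> (AE x in leb n. f0 x = 0) \<and> (AE x in leb n. transfer_op n Th f0 x = f0 x) \<and>
       (\<forall>f\<in>B. \<forall>k. (AE x in leb n. ((\<lambda>g x. transfer_op n Th g x - g x) ^^ k) f x = 0) \<longrightarrow>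
          (\<exists>c. AE x in leb n. f x = c * f0 x)))"

definition density_measure :: "nat \<Rightarrow> ((nat \<Rightarrow> real) \<Rightarrow> real) \<Rightarrow> (nat \<Rightarrow> real) measure"
  where "density_measure n h = density (leb n) (\<lambda>x. ennreal (h x))"

definition ac_invariant_prob ::
    "nat \<Rightarrow> ((nat \<Rightarrow> real) \<Rightarrow> nat \<Rightarrow> real) \<Rightarrow> (nat \<Rightarrow> real) measure \<Rightarrow> bool"
  where "ac_invariant_prob n Th \<mu> \<longleftrightarrow>
    sets \<mu> = sets (leb n) \<and> prob_space \<mu> \<and> absolutely_continuous (leb n) \<mu> \<and>
    distr \<mu> (leb n) Th = \<mu>"

definition mixing_measure ::
    "((nat \<Rightarrow> real) \<Rightarrow> nat \<Rightarrow> real) \<Rightarrow> (nat \<Rightarrow> real) measure \<Rightarrow> bool"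
  where "mixing_measure Th \<mu> \<longleftrightarrow>
    (\<forall>X\<in>sets \<mu>. \<forall>Y\<in>sets \<mu>.
       (\<lambda>k. measure \<mu> (X \<inter> (Th ^^ k) -` Y)) \<longlonglongrightarrow> measure \<mu> X * measure \<mu> Y)"

definition sync_dist :: "nat \<Rightarrow> (nat \<Rightarrow> real) \<Rightarrow> real"
  where "sync_dist n x = Max {\<bar>x i - x j\<bar> |i j. i < n \<and> j < n \<and> i \<noteq> j}"

definition sync_obs :: "nat \<Rightarrow> (nat \<Rightarrow> real) \<Rightarrow> ereal"
  where "sync_obs n x = (if sync_dist n x = 0 then \<infinity> else ereal (- ln (sync_dist n x)))"

definition sync_set :: "nat \<Rightarrow> real \<Rightarrow> (nat \<Rightarrow> real) set"
  where "sync_set n \<nu> = {x \<in> unit_cube n. sync_dist n x \<le> \<nu>}"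

abbreviation sync_sets :: "nat \<Rightarrow> (nat \<Rightarrow> real) \<Rightarrow> nat \<Rightarrow> (nat \<Rightarrow> real) set"
  where "sync_sets n u m \<equiv> sync_set n (exp (- u m))"

text \<open>Nestedness does not follow from the scaling and is therefore part of the definition; the
  convergence of the thresholds follows from the scaling if \<open>h\<close> is bounded away from 0.\<close>

definition sync_thresholds ::
    "nat \<Rightarrow> ((nat \<Rightarrow> real) \<Rightarrow> real) \<Rightarrow> real \<Rightarrow> (nat \<Rightarrow> real) \<Rightarrow> bool"
  where "sync_thresholds n h \<tau> u \<longleftrightarrow>
    0 < \<tau> \<and>
    (\<lambda>m. real m * measure (density_measure n h) {x \<in> unit_cube n. ereal (u m) < sync_obs n x})
      \<longlonglongrightarrow> \<tau> \<and>
    incseq (\<lambda>m. unit_cube n - sync_sets n u m)"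

definition return_ratio ::
    "nat \<Rightarrow> ((nat \<Rightarrow> real) \<Rightarrow> nat \<Rightarrow> real) \<Rightarrow> ((nat \<Rightarrow> real) \<Rightarrow> real)
      \<Rightarrow> (nat \<Rightarrow> (nat \<Rightarrow> real) set) \<Rightarrow> nat \<Rightarrow> nat \<Rightarrow> real"
  where "return_ratio n Th h S k m =
    (\<integral>x. diff_op n Th (S m) ((perturbed_op n Th (S m) ^^ k) (diff_op n Th (S m) h)) x \<partial>leb n)
      / measure (density_measure n h) (S m)"

definition return_coeff ::
    "nat \<Rightarrow> ((nat \<Rightarrow> real) \<Rightarrow> nat \<Rightarrow> real) \<Rightarrow> ((nat \<Rightarrow> real) \<Rightarrow> real)
      \<Rightarrow> (nat \<Rightarrow> (nat \<Rightarrow> real) set) \<Rightarrow> nat \<Rightarrow> real"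
  where "return_coeff n Th h S k = lim (return_ratio n Th h S k)"

definition extremal_index ::
    "nat \<Rightarrow> ((nat \<Rightarrow> real) \<Rightarrow> nat \<Rightarrow> real) \<Rightarrow> ((nat \<Rightarrow> real) \<Rightarrow> real)
      \<Rightarrow> (nat \<Rightarrow> (nat \<Rightarrow> real) set) \<Rightarrow> real"
  where "extremal_index n Th h S = 1 - (\<Sum>k. return_coeff n Th h S k)"

definition prop_P1_P3 ::
    "nat \<Rightarrow> ((nat \<Rightarrow> real) \<Rightarrow> nat \<Rightarrow> real) \<Rightarrow> ((nat \<Rightarrow> real) \<Rightarrow> real) set
      \<Rightarrow> (((nat \<Rightarrow> real) \<Rightarrow> real) \<Rightarrow> real) \<Rightarrow> (nat \<Rightarrow> (nat \<Rightarrow> real) set) \<Rightarrow> bool"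
  where "prop_P1_P3 n Th B N S \<longleftrightarrow>
    (\<exists>\<eta><1. \<exists>C>0. lasota_yorke n B N \<eta> C (transfer_op n Th) \<and>
       (\<forall>\<^sub>F m in sequentially. lasota_yorke n B N \<eta> C (perturbed_op n Th (S m))))"

definition prop_P2 ::
    "nat \<Rightarrow> ((nat \<Rightarrow> real) \<Rightarrow> nat \<Rightarrow> real) \<Rightarrow> ((nat \<Rightarrow> real) \<Rightarrow> real) set
      \<Rightarrow> ((nat \<Rightarrow> real) \<Rightarrow> real) \<Rightarrow> bool"
  where "prop_P2 n Th B h \<longleftrightarrow>
    one_simple_eigenvalue n Th B \<and>
    (\<forall>z. cmod z = 1 \<and> transfer_eigenvalue n Th B z \<longrightarrow> z = 1) \<and>
    h \<in> B \<and> (AE x in leb n. 0 \<le> h x) \<and> (AE x in leb n. transfer_op n Th h x = h x) \<and>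
    ac_invariant_prob n Th (density_measure n h) \<and>
    (\<forall>\<mu>. ac_invariant_prob n Th \<mu> \<longrightarrow> \<mu> = density_measure n h) \<and>
    mixing_measure Th (density_measure n h) \<and>
    (\<exists>c. AE x in leb n. \<bar>h x\<bar> \<le> c)"

definition perturbation_size ::
    "nat \<Rightarrow> ((nat \<Rightarrow> real) \<Rightarrow> nat \<Rightarrow> real) \<Rightarrow> ((nat \<Rightarrow> real) \<Rightarrow> real) set
      \<Rightarrow> (((nat \<Rightarrow> real) \<Rightarrow> real) \<Rightarrow> real) \<Rightarrow> (nat \<Rightarrow> real) set \<Rightarrow> real"
  where "perturbation_size n Th B N S =
    (SUP f\<in>{f \<in> B. N f \<le> 1}. \<bar>\<integral>x. diff_op n Th S f x \<partial>leb n\<bar>)"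

definition prop_P4 ::
    "nat \<Rightarrow> ((nat \<Rightarrow> real) \<Rightarrow> nat \<Rightarrow> real) \<Rightarrow> ((nat \<Rightarrow> real) \<Rightarrow> real) set
      \<Rightarrow> (((nat \<Rightarrow> real) \<Rightarrow> real) \<Rightarrow> real) \<Rightarrow> (nat \<Rightarrow> (nat \<Rightarrow> real) set) \<Rightarrow> bool"
  where "prop_P4 n Th B N S \<longleftrightarrow> (\<lambda>m. perturbation_size n Th B N (S m)) \<longlonglongrightarrow> 0"

definition prop_P5 ::
    "nat \<Rightarrow> ((nat \<Rightarrow> real) \<Rightarrow> nat \<Rightarrow> real) \<Rightarrow> ((nat \<Rightarrow> real) \<Rightarrow> real) set
      \<Rightarrow> (((nat \<Rightarrow> real) \<Rightarrow> real) \<Rightarrow> real) \<Rightarrow> (nat \<Rightarrow> (nat \<Rightarrow> real) set)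
      \<Rightarrow> ((nat \<Rightarrow> real) \<Rightarrow> real) \<Rightarrow> bool"
  where "prop_P5 n Th B N S h \<longleftrightarrow>
    (\<exists>C'. \<forall>m. perturbation_size n Th B N (S m) * N (diff_op n Th (S m) h)
        \<le> C' * measure (density_measure n h) (S m)) \<and>
    (\<exists>c>0. AE x in leb n. c \<le> h x)"

definition prop_P7 :: "nat \<Rightarrow> ((nat \<Rightarrow> real) \<Rightarrow> real) \<Rightarrow> bool"
  where "prop_P7 n h \<longleftrightarrow>
    continuous_map (subtopology (powertop_real {..<n}) (unit_cube n)) euclideanreal h"

definition esssup_on :: "nat \<Rightarrow> ((nat \<Rightarrow> real) \<Rightarrow> real) \<Rightarrow> (nat \<Rightarrow> real) set \<Rightarrow> ereal"
  where "esssup_on n f X = esssup (restrict_space (leb n) X) (\<lambda>y. ereal (f y))"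

definition essinf_on :: "nat \<Rightarrow> ((nat \<Rightarrow> real) \<Rightarrow> real) \<Rightarrow> (nat \<Rightarrow> real) set \<Rightarrow> ereal"
  where "essinf_on n f X = - esssup (restrict_space (leb n) X) (\<lambda>y. ereal (- f y))"

definition osc :: "nat \<Rightarrow> ((nat \<Rightarrow> real) \<Rightarrow> real) \<Rightarrow> (nat \<Rightarrow> real) set \<Rightarrow> ennreal"
  where "osc n f X = e2ennreal (esssup_on n f X - essinf_on n f X)"

definition V1_seminorm :: "nat \<Rightarrow> real \<Rightarrow> ((nat \<Rightarrow> real) \<Rightarrow> real) \<Rightarrow> ennreal"
  where "V1_seminorm n \<epsilon>0 f =
    (SUP \<epsilon>\<in>{0<..\<epsilon>0}. ennreal (1 / \<epsilon>) * (\<integral>\<^sup>+x. osc n f (cube_ball n x \<epsilon>) \<partial>leb n))"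

definition V1_space :: "nat \<Rightarrow> real \<Rightarrow> ((nat \<Rightarrow> real) \<Rightarrow> real) set"
  where "V1_space n \<epsilon>0 = {f. integrable (leb n) f \<and> V1_seminorm n \<epsilon>0 f < \<infinity>}"

definition V1_norm :: "nat \<Rightarrow> real \<Rightarrow> ((nat \<Rightarrow> real) \<Rightarrow> real) \<Rightarrow> real"
  where "V1_norm n \<epsilon>0 f = enn2real (V1_seminorm n \<epsilon>0 f) + L1_norm n f"

definition prop_P8 :: "nat \<Rightarrow> real \<Rightarrow> ((nat \<Rightarrow> real) \<Rightarrow> real) \<Rightarrow> bool"
  where "prop_P8 n \<epsilon>0 h \<longleftrightarrow>
    h \<in> V1_space n \<epsilon>0 \<and>
    (SUP \<epsilon>\<in>{0<..\<epsilon>0}. ennreal (1 / \<epsilon>) *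
       (\<integral>\<^sup>+t. osc n h (cube_ball n (diag_point n t) \<epsilon>) \<partial>lebesgue_on {0..1})) < \<infinity>"

definition diag_limit :: "nat \<Rightarrow> ((nat \<Rightarrow> real) \<Rightarrow> real) \<Rightarrow> real \<Rightarrow> real"
  where "diag_limit n h t = (THE l.
    ((\<lambda>\<epsilon>. esssup_on n h (cube_ball n (diag_point n t) \<epsilon>)) \<longlongrightarrow> ereal l) (at_right 0) \<and>
    ((\<lambda>\<epsilon>. essinf_on n h (cube_ball n (diag_point n t) \<epsilon>)) \<longlongrightarrow> ereal l) (at_right 0))"

text \<open>\<open>H t\<close> is the value of the density at the diagonal point \<open>(t, \<dots>, t)\<close>: the value of the continuous
  representative in the first case, the common limit of essential suprema and infima (which exists
  for almost every \<open>t\<close>) in the second.\<close>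

definition diag_regular ::
    "nat \<Rightarrow> real \<Rightarrow> ((nat \<Rightarrow> real) \<Rightarrow> real) set \<Rightarrow> (((nat \<Rightarrow> real) \<Rightarrow> real) \<Rightarrow> real)
      \<Rightarrow> ((nat \<Rightarrow> real) \<Rightarrow> real) \<Rightarrow> (real \<Rightarrow> real) \<Rightarrow> bool"
  where "diag_regular n \<epsilon>0 B N h H \<longleftrightarrow>
    (prop_P7 n h \<and> (\<forall>t\<in>{0..1}. H t = h (diag_point n t))) \<or>
    (0 < \<epsilon>0 \<and> B = V1_space n \<epsilon>0 \<and> (\<forall>f\<in>B. N f = V1_norm n \<epsilon>0 f) \<and> prop_P8 n \<epsilon>0 h \<and>
       (\<forall>t\<in>{0..1}. H t = diag_limit n h t))"

text \<open>The neighbourhood \<open>V\<close> is an arbitrary relatively open one. Requiring connectedness would make the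
  good set smaller and the bound on its complement a stronger assumption.\<close>

definition good_set ::
    "nat \<Rightarrow> ((nat \<Rightarrow> real) \<Rightarrow> nat \<Rightarrow> real) \<Rightarrow> (nat \<Rightarrow> real) set \<Rightarrow> real \<Rightarrow> nat \<Rightarrow> (nat \<Rightarrow> real) set"
  where "good_set n Th D \<epsilon> k = {x \<in> diag_nbhd n \<epsilon>.
    \<exists>V. openin (subtopology (powertop_real {..<n}) (unit_cube n)) V \<and> x \<in> V \<and>
        V \<inter> diagonal n \<noteq> {} \<and> V \<inter> (\<Union>j\<le>k. (Th ^^ j) -` D) = {}}"

definition discontinuity_surfaces ::
    "nat \<Rightarrow> nat \<Rightarrow> (nat \<Rightarrow> real set) \<Rightarrow> nat \<Rightarrow> (nat \<Rightarrow> (nat \<Rightarrow> real) set) \<Rightarrow> bool"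
  where "discontinuity_surfaces n q A r D \<longleftrightarrow>
    (\<Union>k\<in>branch_index n q. powertop_real {..<n} frontier_of branch_dom n A k) = (\<Union>j<r. D j) \<and>
    (\<forall>j<r. codim1_submanifold n (D j))"

definition prop_P01 ::
    "nat \<Rightarrow> nat \<Rightarrow> (nat \<Rightarrow> real set) \<Rightarrow> ((nat \<Rightarrow> real) \<Rightarrow> nat \<Rightarrow> real) \<Rightarrow> (nat \<Rightarrow> real) measure
      \<Rightarrow> nat \<Rightarrow> (nat \<Rightarrow> (nat \<Rightarrow> real) set) \<Rightarrow> bool"
  where "prop_P01 n q A Th \<mu> r D \<longleftrightarrow>
    discontinuity_surfaces n q A r D \<and>
    (\<exists>\<sigma>. (\<sigma> \<longlongrightarrow> (0::real)) (at_right 0) \<and>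
       (\<forall>k. \<exists>C. \<forall>\<epsilon>>0.
          measure \<mu> (diag_nbhd n \<epsilon> - good_set n Th (\<Union>j<r. D j) \<epsilon> k)
            \<le> C * \<sigma> \<epsilon> * measure \<mu> (diag_nbhd n \<epsilon>)))"

definition crossing_set ::
    "nat \<Rightarrow> ((nat \<Rightarrow> real) \<Rightarrow> nat \<Rightarrow> real) \<Rightarrow> nat \<Rightarrow> (nat \<Rightarrow> (nat \<Rightarrow> real) set) \<Rightarrow> real
      \<Rightarrow> (nat \<Rightarrow> real) set"
  where "crossing_set n Th r D \<epsilon> = {x \<in> diag_nbhd n \<epsilon>.
    \<exists>z\<in>diagonal n. (\<forall>w\<in>diagonal n. euclid_dist n x z \<le> euclid_dist n x w) \<and>
      (\<exists>j<r. \<exists>t\<in>{0..1}. (\<lambda>i\<in>{..<n}. (1 - t) * x i + t * z i) \<in> Th ` D j)}"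

definition prop_P02 ::
    "nat \<Rightarrow> ((nat \<Rightarrow> real) \<Rightarrow> nat \<Rightarrow> real) \<Rightarrow> (nat \<Rightarrow> real) measure
      \<Rightarrow> nat \<Rightarrow> (nat \<Rightarrow> (nat \<Rightarrow> real) set) \<Rightarrow> bool"
  where "prop_P02 n Th \<mu> r D \<longleftrightarrow>
    (\<exists>\<kappa> C. (\<kappa> \<longlongrightarrow> (0::real)) (at_right 0) \<and>
       (\<forall>\<^sub>F \<epsilon> in at_right 0.
          measure \<mu> (crossing_set n Th r D \<epsilon>) \<le> C * \<kappa> \<epsilon> * measure \<mu> (diag_nbhd n \<epsilon>)))"

definition cml_assumptions ::
    "nat \<Rightarrow> (nat \<Rightarrow> real set) \<Rightarrow> (real \<Rightarrow> real) \<Rightarrow> real \<Rightarrow> nat \<Rightarrow> real \<Rightarrow> real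
      \<Rightarrow> ((nat \<Rightarrow> real) \<Rightarrow> real) set \<Rightarrow> (((nat \<Rightarrow> real) \<Rightarrow> real) \<Rightarrow> real)
      \<Rightarrow> ((nat \<Rightarrow> real) \<Rightarrow> real) \<Rightarrow> (real \<Rightarrow> real) \<Rightarrow> (nat \<Rightarrow> real) \<Rightarrow> bool"
  where "cml_assumptions q A T \<gamma> n \<tau> \<epsilon>0 B N h H u \<longleftrightarrow>
    contracting_inverse_branches n q A (cml n \<gamma> T) \<and>
    banach_compact_in_L1 n B N \<and>
    (\<forall>f\<in>B. transfer_op n (cml n \<gamma> T) f \<in> B) \<and>
    (\<forall>m. \<forall>f\<in>B. perturbed_op n (cml n \<gamma> T) (sync_sets n u m) f \<in> B) \<and>
    sync_thresholds n h \<tau> u \<and>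
    prop_P1_P3 n (cml n \<gamma> T) B N (sync_sets n u) \<and>
    prop_P2 n (cml n \<gamma> T) B h \<and>
    prop_P4 n (cml n \<gamma> T) B N (sync_sets n u) \<and>
    prop_P5 n (cml n \<gamma> T) B N (sync_sets n u) h \<and>
    (\<exists>r D. prop_P01 n q A (cml n \<gamma> T) (density_measure n h) r D \<and>
           prop_P02 n (cml n \<gamma> T) (density_measure n h) r D) \<and>
    diag_regular n \<epsilon>0 B N h H"

end

theory Submission
  imports Defs
begin

text \<open>
  Let \<open>S\<close> be the set of points of the cube whose coordinates differ pairwise by at most \<open>\<nu>\<close>. By the
  duality that defines the transfer operator, the \<open>k\<close>-th return ratio is the conditional probability,
  under the invariant measure, that a point of \<open>S\<close> visits \<open>S\<close> again for the first time after
  \<open>k + 1\<close> steps (\<open>integral_return\<close>). The limits for \<open>\<nu> \<longlonglongrightarrow> 0\<close> are found by looking at a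
  neighbourhood of the diagonal through a magnifying glass.

  Two coordinates in the same branch are driven apart: the mean field term cancels in the difference,
  so that the difference of their images is \<open>1 - \<gamma>\<close> times the difference of the images under \<open>T\<close>,
  and \<open>(1 - \<gamma>) * \<bar>T'\<bar>\<close> exceeds 1 uniformly. All but countably many \<open>t\<close> have an orbit under \<open>T\<close>
  that never meets an end point of a branch; for such a \<open>t\<close> and a fixed number of steps, the
  coordinates of a point sufficiently close to \<open>(t, \<dots>, t)\<close> stay together in one branch at each
  step. So a point that has left \<open>S\<close> does not come back within these steps, and the ratios with
  \<open>k > 0\<close> vanish in the limit (\<open>late_return_limit\<close>).

  For \<open>k = 0\<close>, write \<open>x = (t, t + \<nu> y\<^sub>1, \<dots>, t + \<nu> y\<^sub>n\<^sub>-\<^sub>1)\<close>. In the coordinates \<open>(t, y)\<close> the set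
  \<open>S\<close> is the set where the spread of \<open>(0, y)\<close> is at most 1, and the part of \<open>S\<close> that is mapped to
  \<open>S\<close> converges to the set where the spread is at most \<open>1 / ((1 - \<gamma>) * \<bar>T' t\<bar>)\<close>. The set of \<open>y\<close>
  with spread at most \<open>r\<close> has the volume \<open>K * r ^ (n - 1)\<close> with a constant \<open>K\<close> that cancels in the
  quotient (\<open>mass_limit\<close> and \<open>early_return_limit\<close>).

  In these integrals the density may be replaced by its values on the diagonal with an error
  \<open>o(\<nu> ^ (n - 1))\<close>. If it is continuous, this is dominated convergence. In the case of bounded
  oscillation the error at \<open>x\<close> is at most the oscillation over a ball of radius \<open>4 n \<nu>\<close> about
  \<open>(x\<^sub>0, \<dots>, x\<^sub>0)\<close>, and the integral of these oscillations along the diagonal is \<open>O(\<nu>)\<close>.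

  Finally, if \<open>l < 1 - \<gamma>\<close> bounds \<open>1 / \<bar>T'\<bar>\<close>, the formula gives
  \<open>\<bar>\<theta>\<^sub>n - 1\<bar> \<le> (l / (1 - \<gamma>)) ^ (n - 1)\<close>, whence the limit for growing dimension.
\<close>

section \<open>Expansion by the one-dimensional map\<close>

lemma finite_interval_minus_interior:
  fixes S :: "real set"
  assumes "is_interval S" and "bounded S"
  shows "finite (S - interior S)"
proof -
  have bdd: "bdd_above S" "bdd_below S"
    using assms(2) bounded_imp_bdd_above bounded_imp_bdd_below by auto
  have "S - interior S \<subseteq> {Inf S, Sup S}"
  proof
    fix a assume a: "a \<in> S - interior S"
    show "a \<in> {Inf S, Sup S}"
    proof (rule ccontr)
      assume "a \<notin> {Inf S, Sup S}"
      then have "Inf S < a" "a < Sup S"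
        using a bdd cInf_lower[of a S] cSup_upper[of a S] by auto
      then obtain b c where bc: "b \<in> S" "b < a" "c \<in> S" "a < c"
        using a bdd cInf_less_iff[of S a] less_cSup_iff[of S a] by auto
      then have "{b<..<c} \<subseteq> S"
        using assms(1) unfolding is_interval_1 by (meson greaterThanLessThan_iff less_imp_le subsetI)
      then have "a \<in> interior S"
        using bc by (meson greaterThanLessThan_iff interiorI open_greaterThanLessThan)
      then show False using a by simp
    qed
  qed
  then show ?thesis by (rule finite_subset) simp
qed

locale expanding_map =
  fixes q :: nat and A :: "nat \<Rightarrow> real set" and T :: "real \<Rightarrow> real"
  assumes expanding: "piecewise_expanding q A T"
begin

definition smooth_points :: "real set"
  where "smooth_points = (\<Union>i<q. interior (A i))"

text \<open>
  Diagonal points whose orbit stays away from the ends of the branches; along such an orbit every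
  iterate of \<open>T\<close> is differentiable.
\<close>

definition regular_points :: "real set"
  where "regular_points = {t \<in> {0..1}. \<forall>j. (T ^^ j) t \<in> smooth_points}"

lemma T_unit: "t \<in> {0..1} \<Longrightarrow> T t \<in> {0..1}"
  using expanding unfolding piecewise_expanding_def by blast

lemma branch_cover: "(\<Union>i<q. A i) = {0..1}"
  using expanding unfolding piecewise_expanding_def by blast

lemma branch_subset: "i < q \<Longrightarrow> A i \<subseteq> {0..1}"
  using branch_cover by blast

lemma branch:
  assumes "i < q"
  shows "is_interval (A i)" "interior (A i) \<noteq> {}" "inj_on T (A i)"
    "\<exists>g. continuous_on (closure (A i)) g \<and> (\<forall>x\<in>A i. g x = T x)"
    "T differentiable_on interior (A i)" "deriv T differentiable_on interior (A i)"
    "\<And>x. x \<in> interior (A i) \<Longrightarrow> 1 < \<bar>deriv T x\<bar>"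
  using expanding assms unfolding piecewise_expanding_def by blast+

lemma open_smooth_points: "open smooth_points"
  unfolding smooth_points_def by auto

lemma finite_unsmooth: "finite ({0..1} - smooth_points)"
proof -
  have "{0..1} - smooth_points \<subseteq> (\<Union>i<q. A i - interior (A i))"
    unfolding smooth_points_def using branch_cover by auto
  moreover have "finite (\<Union>i<q. A i - interior (A i))"
    using finite_interval_minus_interior branch(1) branch_subset
    by (metis (no_types, lifting) bounded_closed_interval bounded_subset finite_UN_I finite_lessThan lessThan_iff)
  ultimately show ?thesis by (rule finite_subset)
qed

text \<open>
  A point has at most one preimage in each of the finitely many branches. This makes the set of points
  that ever reach an end of a branch countable, hence negligible.
\<close>

lemma countable_preimage:
  assumes "countable F" shows "countable {t \<in> {0..1}. T t \<in> F}"
proof -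
  have "countable (A i \<inter> T -` F)" if "i < q" for i
    using branch(3)[OF that] assms
    by (metis countable_image_inj_Int_vimage)
  moreover have "{t \<in> {0..1}. T t \<in> F} = (\<Union>i<q. A i \<inter> T -` F)"
    using branch_cover by auto
  moreover have "countable (\<Union>i\<in>{..<q}. A i \<inter> T -` F)"
    using calculation(1) by (intro countable_UN) auto
  ultimately show ?thesis by simp
qed

lemma countable_irregular: "countable ({0..1} - regular_points)"
proof -
  have "countable {t \<in> {0..1}. (T ^^ j) t \<notin> smooth_points}" for j
  proof (induction j)
    case 0
    have "{t \<in> {0..1}. (T ^^ 0) t \<notin> smooth_points} = {0..1} - smooth_points" by auto
    then show ?case using finite_unsmooth by (simp add: countable_finite)
  next
    case (Suc j)
    have "{t \<in> {0..1}. (T ^^ Suc j) t \<notin> smooth_points} =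
        {t \<in> {0..1}. T t \<in> {t \<in> {0..1}. (T ^^ j) t \<notin> smooth_points}}"
      using T_unit by (auto simp: funpow_swap1)
    then show ?case using countable_preimage[OF Suc] by simp
  qed
  moreover have "{0..1} - regular_points = (\<Union>j. {t \<in> {0..1}. (T ^^ j) t \<notin> smooth_points})"
    unfolding regular_points_def by auto
  ultimately show ?thesis by auto
qed

lemma regular_points_smooth: "t \<in> regular_points \<Longrightarrow> (T ^^ j) t \<in> smooth_points"
  unfolding regular_points_def by blast

lemma AE_regular: "AE t in restrict_space lborel {0..1}. t \<in> regular_points"
proof -
  have "{0..1} - regular_points \<in> null_sets lborel"
    using countable_irregular countable_imp_null_set_lborel by blast
  then have "AE t in lborel. t \<notin> {0..1} - regular_points" by (rule AE_not_in)
  then show ?thesis by (subst AE_restrict_space_iff) auto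
qed

lemma T_has_derivative:
  assumes "x \<in> smooth_points" shows "(T has_real_derivative deriv T x) (at x)"
proof -
  obtain i where "i < q" "x \<in> interior (A i)" using assms unfolding smooth_points_def by auto
  then have "T differentiable at x"
    using branch(5)[OF \<open>i < q\<close>] by (metis at_within_open differentiable_on_def open_interior)
  then show ?thesis
    by (simp add: DERIV_deriv_iff_real_differentiable)
qed

lemma isCont_T: "x \<in> smooth_points \<Longrightarrow> isCont T x"
  using T_has_derivative DERIV_isCont by blast

lemma measurable_T: "T \<in> restrict_space lborel {0..1} \<rightarrow>\<^sub>M restrict_space lborel {0..1}"
proof -
  have "T \<in> borel_measurable (restrict_space lborel {0..1})"
  proof (rule measurable_piecewise_restrict[where C="A ` {..<q}"])
    show "countable (A ` {..<q})" by simp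
    show "space (restrict_space lborel {0..1}) \<subseteq> \<Union> (A ` {..<q})"
      using branch_cover by (simp add: space_restrict_space)
    fix \<Omega> assume \<Omega>: "\<Omega> \<in> A ` {..<q}"
    then obtain i where i: "i < q" "\<Omega> = A i" by auto
    obtain g where g: "continuous_on (closure (A i)) g" "\<forall>x\<in>A i. g x = T x"
      using branch(4)[OF i(1)] by blast
    have "continuous_on (A i) T"
      using g continuous_on_subset[OF g(1) closure_subset] by (metis continuous_on_cong)
    then have "T \<in> borel_measurable (restrict_space borel (A i))"
      by (rule borel_measurable_continuous_on_restrict)
    moreover have "sets (restrict_space (restrict_space lborel {0..1}) \<Omega>) = sets (restrict_space borel (A i))"
      using i branch_subset[OF i(1)] sets_restrict_restrict_space[of borel "{0..1}" "A i"]
      by (metis Int_absorb1 sets_restrict_space_cong sets_lborel)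
    ultimately show "T \<in> borel_measurable (restrict_space (restrict_space lborel {0..1}) \<Omega>)"
      using measurable_cong_sets[OF _ refl] by blast
    have "\<Omega> \<in> sets borel"
      using i branch(1) real_interval_borel_measurable by auto
    then show "\<Omega> \<inter> space (restrict_space lborel {0..1}) \<in> sets (restrict_space lborel {0..1})"
      by (auto simp: sets_restrict_space)
  qed
  then show ?thesis
    using T_unit by (intro measurable_restrict_space2) (auto simp: space_restrict_space)
qed

text \<open>
  The modulus of the derivative of the inverse branch at the image of \<open>t\<close>. The value 0 at the ends of
  the branches respects every upper bound on the other values.
\<close>

definition inverse_slope :: "real \<Rightarrow> real"
  where "inverse_slope t = (if t \<in> smooth_points then 1 / \<bar>deriv T t\<bar> else 0)"

lemma measurable_inverse_slope: "inverse_slope \<in> borel_measurable borel"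
proof -
  have "continuous_on smooth_points (deriv T)"
    unfolding smooth_points_def
    by (rule continuous_on_open_Union) (auto dest!: branch(6) intro: differentiable_imp_continuous_on)
  then have "continuous_on smooth_points (\<lambda>t. 1 / \<bar>deriv T t\<bar>)"
    using branch(7) unfolding smooth_points_def by (force intro!: continuous_intros)
  then have "(\<lambda>t. 1 / \<bar>deriv T t\<bar>) \<in> borel_measurable (restrict_space borel smooth_points)"
    by (rule borel_measurable_continuous_on_restrict)
  then have "(\<lambda>t. indicator smooth_points t *\<^sub>R (1 / \<bar>deriv T t\<bar>)) \<in> borel_measurable borel"
    using open_smooth_points by (subst (asm) borel_measurable_restrict_space_iff) auto
  moreover have "inverse_slope = (\<lambda>t. indicator smooth_points t *\<^sub>R (1 / \<bar>deriv T t\<bar>))"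
    unfolding inverse_slope_def by (auto simp: indicator_def)
  ultimately show ?thesis by simp
qed

lemma deriv_inverse_branch:
  assumes "i < q" and x: "x \<in> interior (A i)"
  shows "deriv (the_inv_into (A i) T) (T x) = 1 / deriv T x"
proof -
  have xs: "y \<in> smooth_points" if "y \<in> interior (A i)" for y
    using assms(1) that unfolding smooth_points_def by auto
  have nz: "deriv T x \<noteq> 0" using branch(7)[OF assms] by auto
  have "(the_inv_into (A i) T has_derivative ((*) (1 / deriv T x))) (at (T x))"
  proof (rule has_derivative_inverse_strong[where f = T and x = x and S = "interior (A i)"])
    show "continuous_on (interior (A i)) T"
      using isCont_T xs by (simp add: continuous_at_imp_continuous_on)
    show "the_inv_into (A i) T (T y) = y" if "y \<in> interior (A i)" for y
      using that branch(3)[OF assms(1)] interior_subset by (metis subsetD the_inv_into_f_f)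
    show "(*) (deriv T x) \<circ> (*) (1 / deriv T x) = id" using nz by auto
    show "(T has_derivative ((*) (deriv T x))) (at x)"
      using T_has_derivative[OF xs[OF x]] by (simp add: has_field_derivative_def)
  qed (use x nz in auto)
  then have "(the_inv_into (A i) T has_field_derivative (1 / deriv T x)) (at (T x))"
    by (simp add: has_field_derivative_def)
  then show ?thesis by (rule DERIV_imp_deriv)
qed

text \<open>
  A real number strictly between the contraction rate and \<open>c\<close>. It is positive since it bounds the
  inverse slope at some interior point of a branch.
\<close>

lemma inverse_slope_bound:
  assumes "contraction_rate q A T < ereal c"
  obtains l where "0 < l" "l < c" "\<And>x. inverse_slope x \<le> l"
    "\<And>x. x \<in> smooth_points \<Longrightarrow> 1 \<le> l * \<bar>deriv T x\<bar>"
proof -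
  have le: "ereal (inverse_slope x) \<le> contraction_rate q A T" if x: "x \<in> smooth_points" for x
  proof -
    obtain i where i: "i < q" "x \<in> interior (A i)"
      using x unfolding smooth_points_def by auto
    have "ereal \<bar>deriv (the_inv_into (A i) T) (T x)\<bar> \<le> contraction_rate q A T"
      unfolding contraction_rate_def using i by (intro SUP_upper2[of i] SUP_upper) auto
    then show ?thesis using x deriv_inverse_branch[OF i] by (simp add: inverse_slope_def)
  qed
  obtain r where r: "contraction_rate q A T < ereal r" "ereal r < ereal c"
    using assms ereal_dense2 by blast
  have "q \<noteq> 0"
    using branch_cover by (metis SUP_empty atLeastatMost_empty_iff lessThan_0 zero_neq_one zero_le_one)
  then obtain x where x: "x \<in> interior (A 0)" using branch(2)[of 0] by auto
  then have "x \<in> smooth_points" "0 < inverse_slope x"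
    using \<open>q \<noteq> 0\<close> branch(7)[of 0 x] unfolding smooth_points_def inverse_slope_def by auto
  then have "0 < r" using le[of x] r by (metis ereal_less_eq(3) le_less_trans less_ereal.simps(1) less_imp_le order_less_le_trans)
  moreover have *: "inverse_slope x \<le> r" for x
    using le[of x] r \<open>0 < r\<close>
    by (cases "x \<in> smooth_points") (auto simp: inverse_slope_def dest!: order_le_less_trans)
  moreover have "1 \<le> r * \<bar>deriv T x\<bar>" if "x \<in> smooth_points" for x
  proof -
    have "0 < \<bar>deriv T x\<bar>" using that branch(7) unfolding smooth_points_def by force
    then show ?thesis using *[of x] that by (simp add: inverse_slope_def field_simps)
  qed
  ultimately show ?thesis using r that by auto
qed

text \<open>
  The mean value theorem. It needs the whole segment between the two points inside the branch, and the
  interior of an interval is again an interval.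
\<close>

lemma expansion_on_branch:
  assumes "i < q" and x: "x \<in> interior (A i)" and y: "y \<in> interior (A i)"
    and l: "\<And>z. z \<in> smooth_points \<Longrightarrow> 1 \<le> l * \<bar>deriv T z\<bar>" and "0 < l"
  shows "\<bar>x - y\<bar> \<le> l * \<bar>T x - T y\<bar>"
proof -
  have *: "\<bar>a - b\<bar> \<le> l * \<bar>T a - T b\<bar>" if "a < b" "a \<in> interior (A i)" "b \<in> interior (A i)" for a b
  proof -
    have "is_interval (interior (A i))"
      using branch(1)[OF assms(1)] by (simp add: convex_interior is_interval_convex_1)
    then have sub: "z \<in> interior (A i)" if "a \<le> z" "z \<le> b" for z
      using that \<open>a \<in> _\<close> \<open>b \<in> _\<close> unfolding is_interval_1 by blast
    then have sm: "z \<in> smooth_points" if "a \<le> z" "z \<le> b" for z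
      using that assms(1) unfolding smooth_points_def by auto
    obtain z where z: "a < z" "z < b" "T b - T a = (b - a) * deriv T z"
      using MVT2[OF \<open>a < b\<close>, of T "deriv T"] T_has_derivative sm by blast
    have "\<bar>a - b\<bar> * 1 \<le> \<bar>a - b\<bar> * (l * \<bar>deriv T z\<bar>)"
      using l[OF sm] z by (intro mult_left_mono) auto
    also have "\<dots> = l * \<bar>T b - T a\<bar>" using z by (simp add: abs_mult)
    finally show ?thesis by (simp add: abs_minus_commute)
  qed
  show ?thesis
    using *[of x y] *[of y x] x y assms(5)
    by (cases x y rule: linorder_cases) (auto simp: abs_minus_commute)
qed

end


section \<open>The coupled map near the diagonal\<close>

lemma space_leb: "space (leb n) = unit_cube n"
  unfolding leb_def unit_cube_def by (simp add: space_PiM space_restrict_space)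

lemma leb_coordinate: "i < n \<Longrightarrow> (\<lambda>x. x i) \<in> leb n \<rightarrow>\<^sub>M restrict_space lborel {0..1}"
  unfolding leb_def by (rule measurable_component_singleton) simp

lemma leb_coordinate_real [measurable]: "i < n \<Longrightarrow> (\<lambda>x. x i) \<in> borel_measurable (leb n)"
  using measurable_compose[OF leb_coordinate, of i n "\<lambda>s. s" borel]
  by (simp add: measurable_restrict_space1)

lemma unit_cube_coordinate: "x \<in> unit_cube n \<Longrightarrow> i < n \<Longrightarrow> x i \<in> {0..1}"
  unfolding unit_cube_def by (auto simp: PiE_iff)

lemma finite_pair_gaps: "finite {\<bar>x i - x j\<bar> |i j. i < n \<and> j < n \<and> i \<noteq> j}"
  for x :: "nat \<Rightarrow> real"
proof -
  have "{\<bar>x i - x j\<bar> |i j. i < n \<and> j < n \<and> i \<noteq> j} \<subseteq> (\<lambda>(i, j). \<bar>x i - x j\<bar>) ` ({..<n} \<times> {..<n})"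
    by auto
  then show ?thesis by (rule finite_subset) auto
qed

lemma pair_gaps_nonempty: "2 \<le> n \<Longrightarrow> {\<bar>x i - x j\<bar> |i j. i < n \<and> j < n \<and> i \<noteq> j} \<noteq> {}"
  for x :: "nat \<Rightarrow> real"
proof -
  assume "2 \<le> n"
  then have "\<bar>x 0 - x 1\<bar> \<in> {\<bar>x i - x j\<bar> |i j. i < n \<and> j < n \<and> i \<noteq> j}" by force
  then show ?thesis by blast
qed

lemma sync_dist_le_iff:
  "2 \<le> n \<Longrightarrow> sync_dist n x \<le> r \<longleftrightarrow> (\<forall>i<n. \<forall>j<n. i \<noteq> j \<longrightarrow> \<bar>x i - x j\<bar> \<le> r)"
  unfolding sync_dist_def by (subst Max_le_iff[OF finite_pair_gaps pair_gaps_nonempty]) auto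

lemma sync_dist_less_iff:
  "2 \<le> n \<Longrightarrow> sync_dist n x < r \<longleftrightarrow> (\<forall>i<n. \<forall>j<n. i \<noteq> j \<longrightarrow> \<bar>x i - x j\<bar> < r)"
  unfolding sync_dist_def by (subst Max_less_iff[OF finite_pair_gaps pair_gaps_nonempty]) auto

lemma gap_le_sync_dist: "2 \<le> n \<Longrightarrow> i < n \<Longrightarrow> j < n \<Longrightarrow> i \<noteq> j \<Longrightarrow> \<bar>x i - x j\<bar> \<le> sync_dist n x"
  using sync_dist_le_iff[of n x "sync_dist n x"] by blast

lemma sync_dist_nonneg: "2 \<le> n \<Longrightarrow> 0 \<le> sync_dist n x"
  using gap_le_sync_dist[of n 0 1 x] abs_ge_zero[of "x 0 - x 1"] by (meson order_trans le_trans less_le_trans one_less_numeral_iff pos2 semiring_norm(76) zero_neq_one)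

lemma sync_set_measurable: "2 \<le> n \<Longrightarrow> sync_set n r \<in> sets (leb n)"
proof -
  assume n: "2 \<le> n"
  have "sync_set n r = {x \<in> space (leb n). \<forall>i\<in>{..<n}. \<forall>j\<in>{..<n}. i \<noteq> j \<longrightarrow> \<bar>x i - x j\<bar> \<le> r}"
    unfolding sync_set_def space_leb sync_dist_le_iff[OF n] by auto
  also have "\<dots> \<in> sets (leb n)" by measurable
  finally show ?thesis .
qed

lemma cml_apply: "i < n \<Longrightarrow> cml n \<gamma> T x i = (1 - \<gamma>) * T (x i) + \<gamma> / real n * (\<Sum>j<n. T (x j))"
  unfolding cml_def by simp

lemma cml_gap: "i < n \<Longrightarrow> j < n \<Longrightarrow> cml n \<gamma> T x i - cml n \<gamma> T x j = (1 - \<gamma>) * (T (x i) - T (x j))"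
  by (simp add: cml_apply algebra_simps)

locale coupled_map = expanding_map +
  fixes n :: nat and \<gamma> :: real
  assumes two_le_n: "2 \<le> n" and \<gamma>: "\<gamma> \<in> {0..1}"
    and contraction: "contraction_rate q A T < ereal (1 - \<gamma>)"
begin

abbreviation "Th \<equiv> cml n \<gamma> T"

lemma cml_unit_cube:
  assumes "x \<in> unit_cube n" shows "Th x \<in> unit_cube n"
proof -
  have T: "T (x i) \<in> {0..1}" if "i < n" for i
    using T_unit unit_cube_coordinate[OF assms] that by blast
  have "(\<Sum>j<n. T (x j)) \<le> (\<Sum>j<n. 1)" "0 \<le> (\<Sum>j<n. T (x j))"
    using T by (auto intro!: sum_mono sum_nonneg simp del: sum_constant)
  then have avg: "(\<Sum>j<n. T (x j)) / n \<in> {0..1}"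
    using two_le_n by (auto simp: field_simps)
  have "Th x i \<in> {0..1}" if "i < n" for i
  proof -
    have "(1 - \<gamma>) *\<^sub>R T (x i) + \<gamma> *\<^sub>R ((\<Sum>j<n. T (x j)) / n) \<in> {0..1}"
      using convex_real_interval(5)[of 0 1] T[OF that] avg \<gamma> by (intro convexD) auto
    then show ?thesis using that by (simp add: cml_apply)
  qed
  then show ?thesis unfolding unit_cube_def by (auto simp: PiE_iff cml_def extensional_def)
qed

lemma measurable_cml: "Th \<in> leb n \<rightarrow>\<^sub>M leb n"
proof -
  have T [measurable]: "(\<lambda>x. T (x i)) \<in> borel_measurable (leb n)" if "i < n" for i
    using measurable_compose[OF measurable_compose[OF leb_coordinate[OF that] measurable_T], of "\<lambda>s. s" borel]
    by (simp add: measurable_restrict_space1)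
  have "(\<lambda>x. \<lambda>i\<in>{..<n}. (1 - \<gamma>) * T (x i) + \<gamma> / real n * (\<Sum>j<n. T (x j)))
      \<in> leb n \<rightarrow>\<^sub>M (\<Pi>\<^sub>M i\<in>{..<n}. restrict_space lborel {0..1})"
  proof (rule measurable_restrict)
    fix i assume "i \<in> {..<n}"
    then have i: "i < n" by simp
    have "(\<lambda>x. (1 - \<gamma>) * T (x i) + \<gamma> / real n * (\<Sum>j<n. T (x j))) \<in> borel_measurable (leb n)"
      using i by measurable
    moreover have "(1 - \<gamma>) * T (x i) + \<gamma> / real n * (\<Sum>j<n. T (x j)) \<in> {0..1}" if "x \<in> space (leb n)" for x
      using unit_cube_coordinate[OF cml_unit_cube i] that by (simp only: cml_apply[OF i] space_leb)
    ultimately show "(\<lambda>x. (1 - \<gamma>) * T (x i) + \<gamma> / real n * (\<Sum>j<n. T (x j)))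
        \<in> leb n \<rightarrow>\<^sub>M restrict_space lborel {0..1}"
      by (intro measurable_restrict_space2) (auto simp: measurable_lborel2)
  qed
  then show ?thesis unfolding leb_def cml_def .
qed

text \<open>
  As long as all coordinates are in one branch, synchronisation gets worse: the factor \<open>1 - \<gamma>\<close> of
  the coupling loses against the expansion by \<open>T\<close>.
\<close>

lemma sync_dist_expands:
  assumes "b < q" and x: "\<And>i. i < n \<Longrightarrow> x i \<in> interior (A b)"
  shows "sync_dist n x \<le> sync_dist n (Th x)"
proof -
  obtain l where l: "0 < l" "l < 1 - \<gamma>" "\<And>z. z \<in> smooth_points \<Longrightarrow> 1 \<le> l * \<bar>deriv T z\<bar>"
    using inverse_slope_bound[OF contraction] by metis
  have "\<bar>x i - x j\<bar> \<le> sync_dist n (Th x)" if "i < n" "j < n" "i \<noteq> j" for i j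
  proof -
    have "\<bar>x i - x j\<bar> \<le> l * \<bar>T (x i) - T (x j)\<bar>"
      using expansion_on_branch[OF assms(1) x[OF that(1)] x[OF that(2)] l(3) l(1)] by blast
    also have "\<dots> \<le> (1 - \<gamma>) * \<bar>T (x i) - T (x j)\<bar>"
      using l by (intro mult_right_mono) auto
    also have "\<dots> = \<bar>Th x i - Th x j\<bar>"
      using l that by (simp add: cml_gap abs_mult)
    also have "\<dots> \<le> sync_dist n (Th x)"
      using gap_le_sync_dist two_le_n that by blast
    finally show ?thesis .
  qed
  then show ?thesis using sync_dist_le_iff two_le_n by blast
qed

text \<open>
  The diagonal is invariant and the coupled map restricted to it is \<open>T\<close>; continuity of \<open>T\<close> along
  the orbit of \<open>t\<close> carries convergence to the diagonal point from each step to the next.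
\<close>

lemma iterate_cml_tendsto_diagonal:
  assumes X: "\<And>i. i < n \<Longrightarrow> (\<lambda>m. X m i) \<longlonglongrightarrow> t" and t: "t \<in> regular_points" and "i < n"
  shows "(\<lambda>m. (Th ^^ j) (X m) i) \<longlonglongrightarrow> (T ^^ j) t"
  using \<open>i < n\<close>
proof (induction j arbitrary: i)
  case 0
  then show ?case using X by simp
next
  case (Suc j)
  let ?s = "(T ^^ j) t"
  have T: "(\<lambda>m. T ((Th ^^ j) (X m) i)) \<longlonglongrightarrow> T ?s" if "i < n" for i
    using isCont_tendsto_compose[OF isCont_T[OF regular_points_smooth[OF t]] Suc.IH[OF that]] .
  have "(\<lambda>m. (1 - \<gamma>) * T ((Th ^^ j) (X m) i) + \<gamma> / real n * (\<Sum>i<n. T ((Th ^^ j) (X m) i)))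
      \<longlonglongrightarrow> (1 - \<gamma>) * T ?s + \<gamma> / real n * (\<Sum>i<n. T ?s)"
    using Suc.prems T by (intro tendsto_intros) auto
  moreover have "(1 - \<gamma>) * T ?s + \<gamma> / real n * (\<Sum>i<n. T ?s) = T ?s"
    using two_le_n by (simp add: field_simps)
  ultimately show ?case using Suc.prems by (simp add: cml_apply)
qed

text \<open>
  At each of the \<open>k\<close> further steps the coordinates are eventually all in the branch that contains the
  corresponding point of the orbit of \<open>t\<close>, and then the distance to synchrony cannot decrease.
\<close>

lemma eventually_never_resynchronises:
  assumes X: "\<And>i. i < n \<Longrightarrow> (\<lambda>m. X m i) \<longlonglongrightarrow> t" and t: "t \<in> regular_points"
  shows "\<forall>\<^sub>F m in sequentially. sync_dist n (Th (X m)) \<le> sync_dist n ((Th ^^ Suc k) (X m))"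
proof (induction k)
  case (Suc k)
  obtain b where b: "b < q" "(T ^^ Suc k) t \<in> interior (A b)"
    using regular_points_smooth[OF t, of "Suc k"] unfolding smooth_points_def by blast
  have "\<forall>\<^sub>F m in sequentially. (Th ^^ Suc k) (X m) i \<in> interior (A b)" if "i < n" for i
    using topological_tendstoD[OF iterate_cml_tendsto_diagonal[where X = X and j = "Suc k", OF X t that] open_interior b(2)] by blast
  then have "\<forall>\<^sub>F m in sequentially. \<forall>i\<in>{..<n}. (Th ^^ Suc k) (X m) i \<in> interior (A b)"
    by (subst eventually_ball_finite_distrib) auto
  then have "\<forall>\<^sub>F m in sequentially.
      sync_dist n ((Th ^^ Suc k) (X m)) \<le> sync_dist n ((Th ^^ Suc (Suc k)) (X m))"
    by eventually_elim (use sync_dist_expands[OF b(1)] in auto)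
  with Suc show ?case by eventually_elim (rule order_trans)
qed simp

end

section \<open>Duality for the transfer operator and its perturbation\<close>

interpretation unit_product: product_sigma_finite "\<lambda>_::nat. restrict_space lborel {0..1::real}"
  by (rule product_sigma_finite.intro, rule sigma_finite_measure_restrict_space[OF sigma_finite_lborel]) simp

interpretation leb: sigma_finite_measure "leb n" for n
  unfolding leb_def by (rule unit_product.sigma_finite) simp

text \<open>
  The indicator function of the event that \<open>k\<close> is the first time, counted from 0, at which the orbit
  is in \<open>S\<close>.
\<close>

primrec first_hit :: "('a \<Rightarrow> 'a) \<Rightarrow> 'a set \<Rightarrow> nat \<Rightarrow> 'a \<Rightarrow> real"
  where
    "first_hit Th S 0 = indicator S"
  | "first_hit Th S (Suc k) = (\<lambda>x. indicator (- S) x * first_hit Th S k (Th x))"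

lemma first_hit_bound: "\<bar>first_hit Th S k x\<bar> \<le> 1"
  by (induction k arbitrary: x) (auto simp: indicator_def)

lemma first_hit_nonzero: "first_hit Th S k x \<noteq> 0 \<Longrightarrow> (Th ^^ k) x \<in> S"
  by (induction k arbitrary: x) (auto simp: indicator_def funpow_swap1 split: if_splits)

lemma measurable_complement_indicator:
  assumes [measurable]: "S \<in> sets M" shows "(indicator (- S) :: _ \<Rightarrow> real) \<in> borel_measurable M"
proof -
  have "(\<lambda>x. 1 - indicator S x :: real) \<in> borel_measurable M" by measurable
  moreover have "(\<lambda>x. 1 - indicator S x :: real) = indicator (- S)" by (auto simp: indicator_def)
  ultimately show ?thesis by (rule back_subst[where P = "\<lambda>f. f \<in> borel_measurable M"])
qed

lemma measurable_first_hit: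
  assumes Th: "Th \<in> M \<rightarrow>\<^sub>M M" and S: "S \<in> sets M" shows "first_hit Th S k \<in> borel_measurable M"
proof (induction k)
  case 0
  show ?case using S by simp
next
  case (Suc k)
  then show ?case
    unfolding first_hit.simps
    by (intro borel_measurable_times measurable_complement_indicator S measurable_compose[OF Th])
qed

locale invariant_density =
  fixes n :: nat and Th :: "(nat \<Rightarrow> real) \<Rightarrow> nat \<Rightarrow> real" and h :: "(nat \<Rightarrow> real) \<Rightarrow> real"
  assumes measurable_Th [measurable]: "Th \<in> leb n \<rightarrow>\<^sub>M leb n"
    and invariant: "ac_invariant_prob n Th (density_measure n h)"
    and integrable_h [simp]: "integrable (leb n) h"
    and h_nonneg: "AE x in leb n. 0 \<le> h x"
    and h_lower: "\<exists>c>0. AE x in leb n. c \<le> h x"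
begin

lemma measurable_h [measurable]: "h \<in> borel_measurable (leb n)"
  using integrable_h by blast

text \<open>
  Null sets are the same for Lebesgue measure and for the invariant measure, whose density is bounded
  below, and invariance forbids that the preimage of a null set gains mass.
\<close>

lemma nonsingular:
  assumes N: "N \<in> null_sets (leb n)" shows "Th -` N \<inter> space (leb n) \<in> null_sets (leb n)"
proof -
  let ?\<mu> = "density_measure n h"
  have sets: "N \<in> sets (leb n)" and [measurable]: "Th -` N \<inter> space (leb n) \<in> sets (leb n)"
    using N measurable_sets[OF measurable_Th] by auto
  have "distr ?\<mu> (leb n) Th = ?\<mu>" "absolutely_continuous (leb n) ?\<mu>"
    using invariant unfolding ac_invariant_prob_def by auto
  then have "emeasure (distr ?\<mu> (leb n) Th) N = 0"
    using N unfolding absolutely_continuous_def by auto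
  then have "emeasure ?\<mu> (Th -` N \<inter> space (leb n)) = 0"
    using sets by (subst (asm) emeasure_distr) (auto simp: density_measure_def)
  then have "Th -` N \<inter> space (leb n) \<in> null_sets ?\<mu>"
    by (auto simp: null_sets_def density_measure_def)
  then have "AE x in leb n. x \<in> Th -` N \<inter> space (leb n) \<longrightarrow> ennreal (h x) = 0"
    unfolding density_measure_def by (subst (asm) null_sets_density_iff) auto
  moreover obtain c where "c > 0" "AE x in leb n. c \<le> h x" using h_lower by blast
  ultimately have "AE x in leb n. x \<notin> Th -` N \<inter> space (leb n)"
    by (auto elim!: eventually_elim2 simp: ennreal_eq_0_iff)
  then show ?thesis by (subst AE_iff_null_sets) auto
qed

text \<open>
  The defining property of the transfer operator: \<open>p\<close> represents the image of \<open>f\<close>.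
\<close>

definition transfers :: "((nat \<Rightarrow> real) \<Rightarrow> real) \<Rightarrow> ((nat \<Rightarrow> real) \<Rightarrow> real) \<Rightarrow> bool"
  where "transfers f p \<longleftrightarrow> integrable (leb n) p \<and>
    (\<forall>g \<in> borel_measurable (leb n). (\<exists>c. \<forall>x. \<bar>g x\<bar> \<le> c) \<longrightarrow>
       (\<integral>x. p x * g x \<partial>leb n) = (\<integral>x. f x * g (Th x) \<partial>leb n))"

lemma integrable_mult_bounded:
  fixes f g :: "(nat \<Rightarrow> real) \<Rightarrow> real"
  assumes "integrable (leb n) f" "g \<in> borel_measurable (leb n)" "\<And>x. \<bar>g x\<bar> \<le> c"
  shows "integrable (leb n) (\<lambda>x. f x * g x)"
proof (rule Bochner_Integration.integrable_bound[of _ "\<lambda>x. c * f x"])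
  show "AE x in leb n. norm (f x * g x) \<le> norm (c * f x)"
  proof (rule AE_I2)
    fix x
    have "\<bar>f x\<bar> * \<bar>g x\<bar> \<le> \<bar>f x\<bar> * \<bar>c\<bar>"
      using assms(3)[of x] by (intro mult_left_mono) auto
    then show "norm (f x * g x) \<le> norm (c * f x)" by (simp add: abs_mult mult.commute)
  qed
qed (use assms in auto)

text \<open>
  The image under the map of the measure with density \<open>f\<close> is absolutely continuous by
  nonsingularity, so that it has a Radon--Nikodym density.
\<close>

lemma transfers_exists_nonneg:
  assumes f: "integrable (leb n) f" and nonneg: "\<And>x. 0 \<le> f x"
  shows "\<exists>p. transfers f p"
proof -
  have [measurable]: "f \<in> borel_measurable (leb n)" using f by blast
  define \<nu> where "\<nu> = distr (density (leb n) (\<lambda>x. ennreal (f x))) (leb n) Th"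
  have sets: "sets \<nu> = sets (leb n)" unfolding \<nu>_def by simp
  have "emeasure \<nu> (space \<nu>) = (\<integral>\<^sup>+x. ennreal (f x) \<partial>leb n)"
    unfolding \<nu>_def using measurable_space[OF measurable_Th]
    by (auto simp: emeasure_distr emeasure_density indicator_def intro!: nn_integral_cong)
  also have "\<dots> < \<infinity>"
    using f nonneg by (simp add: nn_integral_eq_integral)
  finally have fin: "finite_measure \<nu>" by (intro finite_measureI) auto
  have ac: "absolutely_continuous (leb n) \<nu>"
    unfolding absolutely_continuous_def
  proof
    fix N assume N: "N \<in> null_sets (leb n)"
    then have "Th -` N \<inter> space (leb n) \<in> null_sets (density (leb n) (\<lambda>x. ennreal (f x)))"
      using absolutely_continuousI_density[of "\<lambda>x. ennreal (f x)" "leb n"] nonsingular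
      unfolding absolutely_continuous_def by auto
    then show "N \<in> null_sets \<nu>"
      using N unfolding \<nu>_def by (auto simp: null_sets_def emeasure_distr)
  qed
  obtain D where D: "D \<in> borel_measurable (leb n)" "AE x in leb n. RN_deriv (leb n) \<nu> x = ennreal (D x)"
      "\<And>x. 0 \<le> D x"
    using leb.real_RN_deriv[OF fin ac sets] by metis
  note D(1) [measurable]
  have "AE x in leb n. ennreal (D x) = RN_deriv (leb n) \<nu> x"
    using D(2) by eventually_elim simp
  then have "density (leb n) (\<lambda>x. ennreal (D x)) = density (leb n) (RN_deriv (leb n) \<nu>)"
    by (intro density_cong) auto
  then have dens: "density (leb n) (\<lambda>x. ennreal (D x)) = \<nu>"
    using leb.density_RN_deriv[OF ac sets] by simp
  have "transfers f D"
    unfolding transfers_def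
  proof (intro conjI ballI impI)
    have "(\<integral>\<^sup>+x. ennreal (D x) \<partial>leb n) = emeasure (density (leb n) (\<lambda>x. ennreal (D x))) (space (leb n))"
      by (auto simp: emeasure_density intro!: nn_integral_cong)
    also have "\<dots> < \<infinity>"
      using finite_measure.emeasure_finite[OF fin] unfolding dens by (simp add: top.not_eq_extremum)
    finally show "integrable (leb n) D"
      using D(3) by (intro integrableI_bounded) auto
    fix g :: "(nat \<Rightarrow> real) \<Rightarrow> real" assume [measurable]: "g \<in> borel_measurable (leb n)"
    have "(\<integral>x. D x * g x \<partial>leb n) = integral\<^sup>L \<nu> g"
      unfolding dens[symmetric] using D(3) by (simp add: integral_density)
    also have "\<dots> = integral\<^sup>L (density (leb n) (\<lambda>x. ennreal (f x))) (\<lambda>x. g (Th x))"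
      unfolding \<nu>_def by (simp add: integral_distr)
    also have "\<dots> = (\<integral>x. f x * g (Th x) \<partial>leb n)"
      using nonneg by (simp add: integral_density)
    finally show "(\<integral>x. D x * g x \<partial>leb n) = (\<integral>x. f x * g (Th x) \<partial>leb n)" .
  qed
  then show ?thesis by blast
qed

lemma transfers_exists:
  assumes f: "integrable (leb n) f" shows "\<exists>p. transfers f p"
proof -
  obtain p p' where p: "transfers (\<lambda>x. max 0 (f x)) p" "transfers (\<lambda>x. max 0 (- f x)) p'"
    using transfers_exists_nonneg[of "\<lambda>x. max 0 (f x)"] transfers_exists_nonneg[of "\<lambda>x. max 0 (- f x)"] f
    by auto
  have "transfers f (\<lambda>x. p x - p' x)"
    unfolding transfers_def
  proof (intro conjI ballI impI)
    show "integrable (leb n) (\<lambda>x. p x - p' x)" using p unfolding transfers_def by auto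
    fix g :: "(nat \<Rightarrow> real) \<Rightarrow> real" assume g [measurable]: "g \<in> borel_measurable (leb n)"
      and "\<exists>c. \<forall>x. \<bar>g x\<bar> \<le> c"
    then obtain c where c: "\<And>x. \<bar>g x\<bar> \<le> c" by blast
    have int: "integrable (leb n) (\<lambda>x. p x * g x)" "integrable (leb n) (\<lambda>x. p' x * g x)"
      "integrable (leb n) (\<lambda>x. max 0 (f x) * g (Th x))" "integrable (leb n) (\<lambda>x. max 0 (- f x) * g (Th x))"
      using p f c unfolding transfers_def by (auto intro!: integrable_mult_bounded[where c = c])
    have "(\<integral>x. (p x - p' x) * g x \<partial>leb n) = (\<integral>x. p x * g x \<partial>leb n) - (\<integral>x. p' x * g x \<partial>leb n)"
      using int by (simp add: left_diff_distrib)
    also have "\<dots> = (\<integral>x. max 0 (f x) * g (Th x) \<partial>leb n) - (\<integral>x. max 0 (- f x) * g (Th x) \<partial>leb n)"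
    proof -
      have "\<exists>c. \<forall>x. \<bar>g x\<bar> \<le> c" using c by blast
      then show ?thesis
        using p(1)[unfolded transfers_def, THEN conjunct2, THEN bspec, OF g]
          p(2)[unfolded transfers_def, THEN conjunct2, THEN bspec, OF g] by simp
    qed
    also have "\<dots> = (\<integral>x. max 0 (f x) * g (Th x) - max 0 (- f x) * g (Th x) \<partial>leb n)"
      by (rule Bochner_Integration.integral_diff[OF int(3,4), symmetric])
    also have "\<dots> = (\<integral>x. f x * g (Th x) \<partial>leb n)"
      by (intro Bochner_Integration.integral_cong) (auto simp: max_def)
    finally show "(\<integral>x. (p x - p' x) * g x \<partial>leb n) = (\<integral>x. f x * g (Th x) \<partial>leb n)" .
  qed
  then show ?thesis by blast
qed

lemma transfers_transfer_op: "integrable (leb n) f \<Longrightarrow> transfers f (transfer_op n Th f)"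
proof -
  assume "integrable (leb n) f"
  then have "transfers f (SOME p. transfers f p)"
    by (rule transfers_exists[THEN someI_ex])
  then show ?thesis unfolding transfer_op_def transfers_def .
qed

lemma integrable_transfer_op: "integrable (leb n) f \<Longrightarrow> integrable (leb n) (transfer_op n Th f)"
  using transfers_transfer_op unfolding transfers_def by blast

lemma integral_transfer_op:
  assumes "integrable (leb n) f" "g \<in> borel_measurable (leb n)" "\<And>x. \<bar>g x\<bar> \<le> c"
  shows "(\<integral>x. transfer_op n Th f x * g x \<partial>leb n) = (\<integral>x. f x * g (Th x) \<partial>leb n)"
  using transfers_transfer_op[OF assms(1)] assms(2,3) unfolding transfers_def by blast

context
  fixes S :: "(nat \<Rightarrow> real) set"
  assumes S [measurable]: "S \<in> sets (leb n)"
begin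

lemmas measurable_complement [measurable] = measurable_complement_indicator[OF S]

lemma integrable_cut: "integrable (leb n) f \<Longrightarrow> integrable (leb n) (\<lambda>x. f x * indicator (- S) x)"
  for f :: "(nat \<Rightarrow> real) \<Rightarrow> real"
  by (rule integrable_mult_bounded[where c = 1]) (auto simp: indicator_def)

lemma integrable_perturbed_op: "integrable (leb n) f \<Longrightarrow> integrable (leb n) (perturbed_op n Th S f)"
  unfolding perturbed_op_def by (intro integrable_transfer_op integrable_cut)

lemma integral_perturbed_op:
  assumes "integrable (leb n) f" "g \<in> borel_measurable (leb n)" "\<And>x. \<bar>g x\<bar> \<le> c"
  shows "(\<integral>x. perturbed_op n Th S f x * g x \<partial>leb n) = (\<integral>x. f x * (indicator (- S) x * g (Th x)) \<partial>leb n)"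
  unfolding perturbed_op_def using integral_transfer_op[OF integrable_cut[OF assms(1)] assms(2,3)]
  by (simp add: mult.assoc)

lemma integrable_diff_op: "integrable (leb n) f \<Longrightarrow> integrable (leb n) (diff_op n Th S f)"
  unfolding diff_op_def using integrable_transfer_op integrable_perturbed_op by auto

text \<open>
  The difference of the two operators is the transfer operator applied after cutting off everything
  outside \<open>S\<close>.
\<close>

lemma integral_diff_op:
  assumes f: "integrable (leb n) f" and g [measurable]: "g \<in> borel_measurable (leb n)" and c: "\<And>x. \<bar>g x\<bar> \<le> c"
  shows "(\<integral>x. diff_op n Th S f x * g x \<partial>leb n) = (\<integral>x. f x * (indicator S x * g (Th x)) \<partial>leb n)"
proof -
  have gT: "(\<lambda>x. g (Th x)) \<in> borel_measurable (leb n)" by measurable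
  have int: "integrable (leb n) (\<lambda>x. transfer_op n Th f x * g x)"
      "integrable (leb n) (\<lambda>x. perturbed_op n Th S f x * g x)"
      "integrable (leb n) (\<lambda>x. f x * g (Th x))"
    using f c by (auto intro!: integrable_mult_bounded[where c = c] integrable_transfer_op integrable_perturbed_op)
  have int2: "integrable (leb n) (\<lambda>x. f x * (indicator (- S) x * g (Th x)))"
    using integrable_mult_bounded[OF integrable_cut[OF f] gT c] by (simp add: mult.assoc)
  have "(\<integral>x. diff_op n Th S f x * g x \<partial>leb n)
      = (\<integral>x. transfer_op n Th f x * g x \<partial>leb n) - (\<integral>x. perturbed_op n Th S f x * g x \<partial>leb n)"
    using int unfolding diff_op_def by (simp add: left_diff_distrib)
  also have "\<dots> = (\<integral>x. f x * g (Th x) \<partial>leb n) - (\<integral>x. f x * (indicator (- S) x * g (Th x)) \<partial>leb n)"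
    using integral_transfer_op[OF f g c] integral_perturbed_op[OF f g c] by simp
  also have "\<dots> = (\<integral>x. f x * g (Th x) - f x * (indicator (- S) x * g (Th x)) \<partial>leb n)"
    using int int2 by simp
  also have "\<dots> = (\<integral>x. f x * (indicator S x * g (Th x)) \<partial>leb n)"
    by (intro Bochner_Integration.integral_cong) (auto simp: indicator_def)
  finally show ?thesis .
qed

lemma first_hit_measurable [measurable]: "first_hit Th S k \<in> borel_measurable (leb n)"
  by (rule measurable_first_hit[OF measurable_Th S])

lemma integral_iterate_perturbed_op:
  assumes "integrable (leb n) f"
  shows "(\<integral>x. (perturbed_op n Th S ^^ k) f x * first_hit Th S j x \<partial>leb n) = (\<integral>x. f x * first_hit Th S (k + j) x \<partial>leb n)"
  using assms
proof (induction k arbitrary: f)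
  case (Suc k)
  have "(\<integral>x. (perturbed_op n Th S ^^ Suc k) f x * first_hit Th S j x \<partial>leb n)
      = (\<integral>x. perturbed_op n Th S f x * first_hit Th S (k + j) x \<partial>leb n)"
    using Suc.IH[OF integrable_perturbed_op[OF Suc.prems]] by (simp add: funpow_swap1)
  also have "\<dots> = (\<integral>x. f x * first_hit Th S (Suc k + j) x \<partial>leb n)"
    using first_hit_bound by (subst integral_perturbed_op[OF Suc.prems, where c = 1]) auto
  finally show ?case .
qed simp

lemma integrable_iterate_perturbed_op:
  "integrable (leb n) f \<Longrightarrow> integrable (leb n) ((perturbed_op n Th S ^^ k) f)"
  by (induction k) (auto intro: integrable_perturbed_op)

text \<open>
  Moving the operators one after another to the test function 1 turns each perturbed operator into the
  condition to avoid \<open>S\<close> at one time, and each difference operator into the condition to be in \<open>S\<close>.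
\<close>

lemma integral_return:
  "(\<integral>x. diff_op n Th S ((perturbed_op n Th S ^^ k) (diff_op n Th S h)) x \<partial>leb n)
    = (\<integral>x. h x * (indicator S x * first_hit Th S k (Th x)) \<partial>leb n)"
proof -
  note int = integrable_diff_op[OF integrable_h]
  have "(\<integral>x. diff_op n Th S ((perturbed_op n Th S ^^ k) (diff_op n Th S h)) x * 1 \<partial>leb n)
      = (\<integral>x. (perturbed_op n Th S ^^ k) (diff_op n Th S h) x * (indicator S x * 1) \<partial>leb n)"
    by (rule integral_diff_op[OF integrable_iterate_perturbed_op[OF int], where c = 1]) auto
  also have "\<dots> = (\<integral>x. (perturbed_op n Th S ^^ k) (diff_op n Th S h) x * first_hit Th S 0 x \<partial>leb n)"
    by simp
  also have "\<dots> = (\<integral>x. diff_op n Th S h x * first_hit Th S k x \<partial>leb n)"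
    using integral_iterate_perturbed_op[OF int, of k 0] by simp
  also have "\<dots> = (\<integral>x. h x * (indicator S x * first_hit Th S k (Th x)) \<partial>leb n)"
    using first_hit_bound by (intro integral_diff_op[where c = 1]) auto
  finally show ?thesis by simp
qed

lemma measure_density_measure:
  "measure (density_measure n h) S = (\<integral>x. h x * indicator S x \<partial>leb n)"
proof -
  have "emeasure (density_measure n h) S = (\<integral>\<^sup>+x. ennreal (h x * indicator S x) \<partial>leb n)"
    unfolding density_measure_def
    by (subst emeasure_density) (auto intro!: nn_integral_cong simp: indicator_def)
  moreover have "AE x in leb n. 0 \<le> h x * indicator S x"
    using h_nonneg by eventually_elim simp
  ultimately show ?thesis
    unfolding measure_def by (subst integral_eq_nn_integral) auto
qed

end

end

section \<open>Magnification transversal to the diagonal\<close>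

interpretation line_product: product_sigma_finite "\<lambda>_::nat. lborel :: real measure"
  by (rule product_sigma_finite.intro) (rule sigma_finite_lborel)

abbreviation unit_interval :: "real measure"
  where "unit_interval \<equiv> restrict_space lborel {0..1}"

text \<open>
  Lebesgue measure in the transversal directions: the coordinates \<open>1, \<dots>, n - 1\<close> record the
  differences to coordinate 0.
\<close>

definition fiber :: "nat \<Rightarrow> (nat \<Rightarrow> real) measure"
  where "fiber n = (\<Pi>\<^sub>M i\<in>{1..<n}. lborel)"

interpretation fiber: sigma_finite_measure "fiber n" for n
  unfolding fiber_def by (rule line_product.sigma_finite) simp

interpretation unit_interval: sigma_finite_measure unit_interval
  by (rule sigma_finite_measure_restrict_space[OF sigma_finite_lborel]) simp

interpretation unit_fiber: pair_sigma_finite unit_interval "fiber n" for n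
  by unfold_locales

lemma prob_space_unit_interval: "prob_space unit_interval"
  by (rule prob_spaceI) (simp add: emeasure_restrict_space space_restrict_space)

text \<open>
  Points of \<open>fan\<close> are clipped to the cube, which makes it a total map into the space of \<open>leb n\<close>.
  The weight \<open>fits\<close> discards the parameters for which this has changed something.
\<close>

definition clip :: "real \<Rightarrow> real"
  where "clip s = max 0 (min 1 s)"

definition fan :: "nat \<Rightarrow> real \<Rightarrow> real \<times> (nat \<Rightarrow> real) \<Rightarrow> nat \<Rightarrow> real"
  where "fan n \<nu> = (\<lambda>(t, y). \<lambda>i\<in>{..<n}. if i = 0 then t else clip (t + \<nu> * y i))"

definition fits :: "nat \<Rightarrow> real \<Rightarrow> real \<times> (nat \<Rightarrow> real) \<Rightarrow> real"
  where "fits n \<nu> = (\<lambda>(t, y). \<Prod>i\<in>{1..<n}. indicator {0..1} (t + \<nu> * y i))"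

lemma fiber_coordinate [measurable]: "i \<in> {1..<n} \<Longrightarrow> (\<lambda>y. y i) \<in> borel_measurable (fiber n)"
  unfolding fiber_def using measurable_component_singleton[of i "{1..<n}" "\<lambda>_. lborel"] by simp

lemma measurable_unit_interval_fst [measurable]:
  "fst \<in> borel_measurable (unit_interval \<Otimes>\<^sub>M M)"
  using measurable_compose[OF measurable_fst, of "\<lambda>s. s" unit_interval borel M]
  by (simp add: measurable_restrict_space1)

lemma measurable_fan_coordinate [measurable]:
  assumes "i \<in> {1..<n}" shows "(\<lambda>p. fst p + \<nu> * snd p i) \<in> borel_measurable (unit_interval \<Otimes>\<^sub>M fiber n)"
  using measurable_compose[OF measurable_snd fiber_coordinate[OF assms], of unit_interval] by measurable

lemma measurable_fits [measurable]: "fits n \<nu> \<in> borel_measurable (unit_interval \<Otimes>\<^sub>M fiber n)"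
proof -
  have "(\<lambda>p. \<Prod>i\<in>{1..<n}. indicator {0..1} (fst p + \<nu> * snd p i) :: real)
      \<in> borel_measurable (unit_interval \<Otimes>\<^sub>M fiber n)"
    by (intro borel_measurable_prod) measurable
  then show ?thesis unfolding fits_def by (simp add: case_prod_beta')
qed

lemma measurable_fan [measurable]: "fan n \<nu> \<in> unit_interval \<Otimes>\<^sub>M fiber n \<rightarrow>\<^sub>M leb n"
proof -
  have "(\<lambda>p. \<lambda>i\<in>{..<n}. if i = 0 then fst p else clip (fst p + \<nu> * snd p i))
      \<in> unit_interval \<Otimes>\<^sub>M fiber n \<rightarrow>\<^sub>M (\<Pi>\<^sub>M i\<in>{..<n}. unit_interval)"
  proof (rule measurable_restrict)
    fix i assume "i \<in> {..<n}"
    then show "(\<lambda>p. if i = 0 then fst p else clip (fst p + \<nu> * snd p i))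
        \<in> unit_interval \<Otimes>\<^sub>M fiber n \<rightarrow>\<^sub>M unit_interval"
    proof (cases "i = 0")
      case False
      have "clip \<in> borel_measurable borel" unfolding clip_def by measurable
      then have "(\<lambda>p. clip (fst p + \<nu> * snd p i)) \<in> borel_measurable (unit_interval \<Otimes>\<^sub>M fiber n)"
        using False \<open>i \<in> {..<n}\<close> by (intro measurable_compose[OF measurable_fan_coordinate]) auto
      then show ?thesis
        using False by (intro measurable_restrict_space2) (auto simp: clip_def measurable_lborel2)
    qed simp
  qed
  then show ?thesis unfolding leb_def fan_def by (simp add: case_prod_beta')
qed

lemma prod_indicator:
  "finite I \<Longrightarrow> (\<Prod>i\<in>I. indicator (A i) (x i) :: real) = (if \<forall>i\<in>I. x i \<in> A i then 1 else 0)"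
  by (induction I rule: finite_induct) (simp_all add: indicator_def)

lemma fan_in_box_iff:
  assumes A: "\<And>i. i < n \<Longrightarrow> A i \<subseteq> {0..1}" and "0 < n"
  shows "fits n \<nu> (t, y) * indicator (Pi\<^sub>E {..<n} A) (fan n \<nu> (t, y))
    = indicator (A 0) t * (\<Prod>i\<in>{1..<n}. indicator (A i) (t + \<nu> * y i))"
proof -
  have split: "{..<n} = insert 0 {1..<n}" using \<open>0 < n\<close> by auto
  have "fan n \<nu> (t, y) \<in> Pi\<^sub>E {..<n} A \<longleftrightarrow> (\<forall>i\<in>{..<n}. fan n \<nu> (t, y) i \<in> A i)"
    unfolding fan_def by (auto simp: PiE_iff)
  then have "indicator (Pi\<^sub>E {..<n} A) (fan n \<nu> (t, y)) = (\<Prod>i\<in>{..<n}. indicator (A i) (fan n \<nu> (t, y) i) :: real)"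
    by (subst prod_indicator) (auto simp only: indicator_def finite_lessThan of_bool_def)
  also have "\<dots> = indicator (A 0) t * (\<Prod>i\<in>{1..<n}. indicator (A i) (clip (t + \<nu> * y i)))"
    unfolding split fan_def using \<open>0 < n\<close>
    by (subst prod.insert) (auto intro!: prod.cong arg_cong2[where f = "(*)"])
  finally have "fits n \<nu> (t, y) * indicator (Pi\<^sub>E {..<n} A) (fan n \<nu> (t, y))
      = indicator (A 0) t * (\<Prod>i\<in>{1..<n}. indicator {0..1} (t + \<nu> * y i) * indicator (A i) (clip (t + \<nu> * y i)))"
    by (simp add: fits_def prod.distrib)
  also have "(\<Prod>i\<in>{1..<n}. indicator {0..1} (t + \<nu> * y i) * indicator (A i) (clip (t + \<nu> * y i)) :: real)
      = (\<Prod>i\<in>{1..<n}. indicator (A i) (t + \<nu> * y i))"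
  proof (rule prod.cong)
    fix i assume "i \<in> {1..<n}"
    then have "A i \<subseteq> {0..1}" using A by auto
    then show "indicator {0..1} (t + \<nu> * y i) * indicator (A i) (clip (t + \<nu> * y i)) = (indicator (A i) (t + \<nu> * y i) :: real)"
      by (auto simp: indicator_def clip_def)
  qed simp
  finally show ?thesis .
qed

lemma nn_integral_fiber_box:
  assumes "0 < \<nu>" and "\<And>i. i \<in> {1..<n} \<Longrightarrow> A i \<in> sets borel"
  shows "(\<integral>\<^sup>+y. ennreal (\<nu> ^ (n - 1) * (\<Prod>i\<in>{1..<n}. indicator (A i) (t + \<nu> * y i))) \<partial>fiber n)
    = (\<Prod>i\<in>{1..<n}. emeasure lborel (A i))"
proof -
  have "(\<integral>\<^sup>+y. ennreal (\<nu> ^ (n - 1) * (\<Prod>i\<in>{1..<n}. indicator (A i) (t + \<nu> * y i))) \<partial>fiber n)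
      = (\<integral>\<^sup>+y. (\<Prod>i\<in>{1..<n}. ennreal (\<nu> * indicator (A i) (t + \<nu> * y i))) \<partial>fiber n)"
  proof (intro nn_integral_cong)
    fix y :: "nat \<Rightarrow> real"
    have "(\<Prod>i\<in>{1..<n}. ennreal (\<nu> * indicator (A i) (t + \<nu> * y i)))
        = ennreal (\<Prod>i\<in>{1..<n}. \<nu> * indicator (A i) (t + \<nu> * y i))"
      using \<open>0 < \<nu>\<close> by (intro prod_ennreal) simp
    also have "(\<Prod>i\<in>{1..<n}. \<nu> * indicator (A i) (t + \<nu> * y i)) = \<nu> ^ (n - 1) * (\<Prod>i\<in>{1..<n}. indicator (A i) (t + \<nu> * y i))"
      by (simp only: prod.distrib prod_constant card_atLeastLessThan)
    finally show "ennreal (\<nu> ^ (n - 1) * (\<Prod>i\<in>{1..<n}. indicator (A i) (t + \<nu> * y i)))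
        = (\<Prod>i\<in>{1..<n}. ennreal (\<nu> * indicator (A i) (t + \<nu> * y i)))" by (rule sym)
  qed
  also have "\<dots> = (\<Prod>i\<in>{1..<n}. \<integral>\<^sup>+s. ennreal (\<nu> * indicator (A i) (t + \<nu> * s)) \<partial>lborel)"
    unfolding fiber_def
    by (rule line_product.product_nn_integral_prod) (use assms(2) in \<open>auto\<close>)
  also have "\<dots> = (\<Prod>i\<in>{1..<n}. emeasure lborel (A i))"
  proof (rule prod.cong)
    fix i assume "i \<in> {1..<n}"
    then have [measurable]: "A i \<in> sets borel" using assms(2) by blast
    have "emeasure lborel (A i) = (\<integral>\<^sup>+s. indicator (A i) s \<partial>lborel)" by simp
    also have "\<dots> = ennreal \<bar>\<nu>\<bar> * (\<integral>\<^sup>+s. indicator (A i) (t + \<nu> * s) \<partial>lborel)"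
      using \<open>0 < \<nu>\<close> by (intro nn_integral_real_affine) auto
    also have "\<dots> = (\<integral>\<^sup>+s. ennreal \<bar>\<nu>\<bar> * indicator (A i) (t + \<nu> * s) \<partial>lborel)"
      by (subst nn_integral_cmult) auto
    also have "\<dots> = (\<integral>\<^sup>+s. ennreal (\<nu> * indicator (A i) (t + \<nu> * s)) \<partial>lborel)"
      using \<open>0 < \<nu>\<close> by (intro nn_integral_cong) (auto simp: indicator_def)
    finally show "(\<integral>\<^sup>+s. ennreal (\<nu> * indicator (A i) (t + \<nu> * s)) \<partial>lborel) = emeasure lborel (A i)" by simp
  qed simp
  finally show ?thesis .
qed

text \<open>
  Change of variables for \<open>x\<^sub>i = t + \<nu> y\<^sub>i\<close>. It is enough to compare the two measures on boxes,
  where the transversal integral factors into one-dimensional affine substitutions.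
\<close>

lemma leb_eq_distr_fan:
  assumes "0 < n" and "0 < \<nu>"
  shows "leb n = distr (density (unit_interval \<Otimes>\<^sub>M fiber n) (\<lambda>p. ennreal (\<nu> ^ (n - 1) * fits n \<nu> p))) (leb n) (fan n \<nu>)"
    (is "_ = ?D")
proof -
  have "?D = (\<Pi>\<^sub>M i\<in>{..<n}. unit_interval)"
  proof (rule unit_product.PiM_eqI)
    show "sets ?D = sets (\<Pi>\<^sub>M i\<in>{..<n}. unit_interval)" by (simp add: leb_def)
    fix A :: "nat \<Rightarrow> real set" assume A: "\<And>i. i \<in> {..<n} \<Longrightarrow> A i \<in> sets unit_interval"
    then have A': "A i \<in> sets borel" "A i \<subseteq> {0..1}" if "i < n" for i
      using A[of i] that by (auto simp: sets_restrict_space_iff)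
    then have eA: "emeasure unit_interval (A i) = emeasure lborel (A i)" if "i < n" for i
      using that by (simp add: emeasure_restrict_space)
    have box [measurable]: "Pi\<^sub>E {..<n} A \<in> sets (leb n)"
      unfolding leb_def using A by (intro sets_PiM_I_finite) auto
    have [measurable]: "A 0 \<in> sets unit_interval" using A \<open>0 < n\<close> by auto
    have "emeasure ?D (Pi\<^sub>E {..<n} A)
        = (\<integral>\<^sup>+p. ennreal (\<nu> ^ (n - 1) * fits n \<nu> p) * indicator (fan n \<nu> -` Pi\<^sub>E {..<n} A \<inter> space (unit_interval \<Otimes>\<^sub>M fiber n)) p
            \<partial>(unit_interval \<Otimes>\<^sub>M fiber n))"
      by (subst emeasure_distr, simp, simp, subst emeasure_density) auto
    also have "\<dots> = (\<integral>\<^sup>+p. ennreal (\<nu> ^ (n - 1) * (fits n \<nu> p * indicator (Pi\<^sub>E {..<n} A) (fan n \<nu> p)))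
            \<partial>(unit_interval \<Otimes>\<^sub>M fiber n))"
      by (intro nn_integral_cong) (auto simp: indicator_def)
    also have "\<dots> = (\<integral>\<^sup>+t. \<integral>\<^sup>+y. ennreal (\<nu> ^ (n - 1) * (fits n \<nu> (t, y) * indicator (Pi\<^sub>E {..<n} A) (fan n \<nu> (t, y))))
            \<partial>fiber n \<partial>unit_interval)"
      by (subst fiber.nn_integral_fst[symmetric]) measurable
    also have "\<dots> = (\<integral>\<^sup>+t. \<integral>\<^sup>+y. indicator (A 0) t * ennreal (\<nu> ^ (n - 1) * (\<Prod>i\<in>{1..<n}. indicator (A i) (t + \<nu> * y i)))
            \<partial>fiber n \<partial>unit_interval)"
      using A'(2) \<open>0 < n\<close>
      by (intro nn_integral_cong, subst fan_in_box_iff) (auto simp: indicator_def)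
    also have "\<dots> = (\<integral>\<^sup>+t. indicator (A 0) t * (\<Prod>i\<in>{1..<n}. emeasure lborel (A i)) \<partial>unit_interval)"
    proof (intro nn_integral_cong)
      fix t
      have [measurable]: "A i \<in> sets borel" if "i \<in> {1..<n}" for i using that A' by auto
      have "(\<lambda>y. ennreal (\<nu> ^ (n - 1) * (\<Prod>i\<in>{1..<n}. indicator (A i) (t + \<nu> * y i)))) \<in> borel_measurable (fiber n)"
        by measurable
      then show "(\<integral>\<^sup>+y. indicator (A 0) t * ennreal (\<nu> ^ (n - 1) * (\<Prod>i\<in>{1..<n}. indicator (A i) (t + \<nu> * y i))) \<partial>fiber n)
          = indicator (A 0) t * (\<Prod>i\<in>{1..<n}. emeasure lborel (A i))"
        by (subst nn_integral_cmult, assumption, subst nn_integral_fiber_box[OF \<open>0 < \<nu>\<close>]) (use A' in auto)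
    qed
    also have "\<dots> = emeasure lborel (A 0) * (\<Prod>i\<in>{1..<n}. emeasure lborel (A i))"
      using eA[of 0] \<open>0 < n\<close> by (subst nn_integral_multc) auto
    also have "\<dots> = (\<Prod>i\<in>insert 0 {1..<n}. emeasure lborel (A i))"
      by (subst prod.insert) auto
    also have "insert 0 {1..<n} = {..<n}" using \<open>0 < n\<close> by auto
    finally show "emeasure ?D (Pi\<^sub>E {..<n} A) = (\<Prod>i\<in>{..<n}. emeasure unit_interval (A i))"
      using eA by simp
  qed simp
  then show ?thesis by (simp add: leb_def)
qed

lemma fits_nonneg: "0 \<le> fits n \<nu> p"
  unfolding fits_def by (auto simp: case_prod_beta' intro!: prod_nonneg)

lemma fits_cases: "fits n \<nu> (t, y) = (if \<forall>i\<in>{1..<n}. t + \<nu> * y i \<in> {0..1} then 1 else 0)"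
  unfolding fits_def case_prod_conv by (rule prod_indicator) simp

lemma integral_leb_fan:
  fixes f :: "(nat \<Rightarrow> real) \<Rightarrow> real"
  assumes "0 < n" and "0 < \<nu>" and f [measurable]: "f \<in> borel_measurable (leb n)"
  shows "(\<integral>x. f x \<partial>leb n) = (\<integral>p. \<nu> ^ (n - 1) * fits n \<nu> p * f (fan n \<nu> p) \<partial>(unit_interval \<Otimes>\<^sub>M fiber n))"
proof -
  let ?M = "density (unit_interval \<Otimes>\<^sub>M fiber n) (\<lambda>p. ennreal (\<nu> ^ (n - 1) * fits n \<nu> p))"
  have "(\<integral>x. f x \<partial>leb n) = (\<integral>x. f x \<partial>distr ?M (leb n) (fan n \<nu>))"
    by (rule arg_cong[where f = "\<lambda>M. integral\<^sup>L M f", OF leb_eq_distr_fan[OF assms(1,2)]])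
  also have "\<dots> = (\<integral>p. f (fan n \<nu> p) \<partial>?M)"
    by (rule integral_distr) auto
  also have "\<dots> = (\<integral>p. (\<nu> ^ (n - 1) * fits n \<nu> p) *\<^sub>R f (fan n \<nu> p) \<partial>(unit_interval \<Otimes>\<^sub>M fiber n))"
    using assms(2) fits_nonneg by (intro integral_density) auto
  finally show ?thesis by simp
qed

lemma nn_integral_leb_fan:
  fixes f :: "(nat \<Rightarrow> real) \<Rightarrow> ennreal"
  assumes "0 < n" and "0 < \<nu>" and f [measurable]: "f \<in> borel_measurable (leb n)"
  shows "(\<integral>\<^sup>+x. f x \<partial>leb n) = (\<integral>\<^sup>+p. ennreal (\<nu> ^ (n - 1) * fits n \<nu> p) * f (fan n \<nu> p) \<partial>(unit_interval \<Otimes>\<^sub>M fiber n))"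
proof -
  let ?M = "density (unit_interval \<Otimes>\<^sub>M fiber n) (\<lambda>p. ennreal (\<nu> ^ (n - 1) * fits n \<nu> p))"
  have "(\<integral>\<^sup>+x. f x \<partial>leb n) = (\<integral>\<^sup>+x. f x \<partial>distr ?M (leb n) (fan n \<nu>))"
    by (rule arg_cong[where f = "\<lambda>M. integral\<^sup>N M f", OF leb_eq_distr_fan[OF assms(1,2)]])
  also have "\<dots> = (\<integral>\<^sup>+p. f (fan n \<nu> p) \<partial>?M)"
    by (rule nn_integral_distr) auto
  also have "\<dots> = (\<integral>\<^sup>+p. ennreal (\<nu> ^ (n - 1) * fits n \<nu> p) * f (fan n \<nu> p) \<partial>(unit_interval \<Otimes>\<^sub>M fiber n))"
    by (rule nn_integral_density) auto
  finally show ?thesis .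
qed

text \<open>The index sets \<open>{1..<n}\<close> shall keep their form under simplification.\<close>

declare One_nat_def [simp del]

text \<open>
  The largest difference between two entries of \<open>(0, y\<^sub>1, \<dots>, y\<^sub>n\<^sub>-\<^sub>1)\<close>.
\<close>

definition rel_spread :: "nat \<Rightarrow> (nat \<Rightarrow> real) \<Rightarrow> real"
  where "rel_spread n y = sync_dist n (y(0 := 0))"

lemma rel_spread_le_iff:
  "2 \<le> n \<Longrightarrow> rel_spread n y \<le> r \<longleftrightarrow> (\<forall>i<n. \<forall>j<n. i \<noteq> j \<longrightarrow> \<bar>(y(0 := 0)) i - (y(0 := 0)) j\<bar> \<le> r)"
  unfolding rel_spread_def by (rule sync_dist_le_iff)

lemma coordinate_le_rel_spread: "2 \<le> n \<Longrightarrow> i \<in> {1..<n} \<Longrightarrow> \<bar>y i\<bar> \<le> rel_spread n y"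
  using gap_le_sync_dist[of n i 0 "y(0 := 0)"] unfolding rel_spread_def by auto

lemma measurable_rel_spread [measurable]:
  assumes "2 \<le> n" shows "rel_spread n \<in> borel_measurable (fiber n)"
proof (subst borel_measurable_iff_le, rule allI)
  fix r
  have c [measurable]: "(\<lambda>y. (y(0 := 0)) i) \<in> borel_measurable (fiber n)" if "i \<in> {..<n}" for i
    using that fiber_coordinate[of i n] by (cases "i = 0") auto
  have "{y \<in> space (fiber n). rel_spread n y \<le> r}
      = {y \<in> space (fiber n). \<forall>i\<in>{..<n}. \<forall>j\<in>{..<n}. i \<noteq> j \<longrightarrow> \<bar>(y(0 := 0)) i - (y(0 := 0)) j\<bar> \<le> r}"
    using rel_spread_le_iff[OF assms] by auto
  also have "\<dots> \<in> sets (fiber n)" using c by measurable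
  finally show "{y \<in> space (fiber n). rel_spread n y \<le> r} \<in> sets (fiber n)" .
qed

text \<open>
  Stated for two arbitrary vectors with proportional gaps, because it serves both the magnification
  \<open>fan\<close> and the scaling of a transversal vector.
\<close>

lemma rel_spread_scale:
  assumes "2 \<le> n" and "0 < r" and z: "\<And>i j. i < n \<Longrightarrow> j < n \<Longrightarrow> \<bar>z i - z j\<bar> = r * \<bar>(y(0 := 0)) i - (y(0 := 0)) j\<bar>"
  shows "sync_dist n z = r * rel_spread n y"
proof -
  have "sync_dist n z \<le> s \<longleftrightarrow> r * rel_spread n y \<le> s" for s
  proof -
    have "r * rel_spread n y \<le> s \<longleftrightarrow> rel_spread n y \<le> s / r"
      using \<open>0 < r\<close> by (simp add: field_simps)
    also have "\<dots> \<longleftrightarrow> (\<forall>i<n. \<forall>j<n. i \<noteq> j \<longrightarrow> r * \<bar>(y(0 := 0)) i - (y(0 := 0)) j\<bar> \<le> s)"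
      using \<open>0 < r\<close> unfolding rel_spread_le_iff[OF assms(1)] by (simp add: field_simps)
    also have "\<dots> \<longleftrightarrow> sync_dist n z \<le> s"
      unfolding sync_dist_le_iff[OF assms(1)] using z by auto
    finally show ?thesis by simp
  qed
  then show ?thesis by (meson order_antisym order_refl)
qed

lemma fan_apply:
  assumes "fits n \<nu> (t, y) \<noteq> 0" and "i < n"
  shows "fan n \<nu> (t, y) i = t + \<nu> * (y(0 := 0)) i"
  using assms unfolding fits_cases fan_def by (auto simp: clip_def split: if_splits)

lemma sync_dist_fan:
  assumes "2 \<le> n" and "0 < \<nu>" and "fits n \<nu> (t, y) \<noteq> 0"
  shows "sync_dist n (fan n \<nu> (t, y)) = \<nu> * rel_spread n y"
proof (rule rel_spread_scale[OF assms(1,2)])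
  fix i j assume "i < n" "j < n"
  then have "fan n \<nu> (t, y) i - fan n \<nu> (t, y) j = \<nu> * ((y(0 := 0)) i - (y(0 := 0)) j)"
    using fan_apply[OF assms(3)] by (simp add: right_diff_distrib)
  then show "\<bar>fan n \<nu> (t, y) i - fan n \<nu> (t, y) j\<bar> = \<nu> * \<bar>(y(0 := 0)) i - (y(0 := 0)) j\<bar>"
    using \<open>0 < \<nu>\<close> by (simp add: abs_mult)
qed

lemma fan_in_unit_cube:
  assumes "t \<in> {0..1}" shows "fan n \<nu> (t, y) \<in> unit_cube n"
  using assms unfolding fan_def unit_cube_def by (auto simp: clip_def)

lemma fiber_box:
  assumes "0 \<le> c"
  shows "{y \<in> space (fiber n). \<forall>i\<in>{1..<n}. \<bar>y i\<bar> \<le> c} \<in> sets (fiber n)"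
    and "emeasure (fiber n) {y \<in> space (fiber n). \<forall>i\<in>{1..<n}. \<bar>y i\<bar> \<le> c} = ennreal ((2 * c) ^ (n - 1))"
proof -
  have eq: "{y \<in> space (fiber n). \<forall>i\<in>{1..<n}. \<bar>y i\<bar> \<le> c} = (\<Pi>\<^sub>E i\<in>{1..<n}. {- c..c})"
  proof -
    have *: "\<bar>s\<bar> \<le> c \<longleftrightarrow> s \<in> {- c..c}" for s :: real by auto
    show ?thesis unfolding fiber_def
      by (rule set_eqI) (simp only: mem_Collect_eq * space_PiM space_lborel space_borel PiE_iff, blast)
  qed
  show "{y \<in> space (fiber n). \<forall>i\<in>{1..<n}. \<bar>y i\<bar> \<le> c} \<in> sets (fiber n)"
    unfolding eq unfolding fiber_def by (intro sets_PiM_I_finite) auto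
  show "emeasure (fiber n) {y \<in> space (fiber n). \<forall>i\<in>{1..<n}. \<bar>y i\<bar> \<le> c} = ennreal ((2 * c) ^ (n - 1))"
    unfolding eq unfolding fiber_def using assms
    by (subst line_product.emeasure_PiM) (auto simp: ennreal_power)
qed

definition cell :: "nat \<Rightarrow> real \<Rightarrow> (nat \<Rightarrow> real) set"
  where "cell n r = {y \<in> space (fiber n). rel_spread n y \<le> r}"

lemma cell_measurable [measurable]: "2 \<le> n \<Longrightarrow> cell n r \<in> sets (fiber n)"
  unfolding cell_def by measurable

lemma emeasure_cell_finite:
  assumes "2 \<le> n" shows "emeasure (fiber n) (cell n r) < \<infinity>"
proof -
  have "cell n r \<subseteq> {y \<in> space (fiber n). \<forall>i\<in>{1..<n}. \<bar>y i\<bar> \<le> \<bar>r\<bar>}"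
  proof
    fix y assume y: "y \<in> cell n r"
    have "\<bar>y i\<bar> \<le> \<bar>r\<bar>" if "i \<in> {1..<n}" for i
      using coordinate_le_rel_spread[OF assms that, of y] y unfolding cell_def by auto
    then show "y \<in> {y \<in> space (fiber n). \<forall>i\<in>{1..<n}. \<bar>y i\<bar> \<le> \<bar>r\<bar>}"
      using y unfolding cell_def by blast
  qed
  then have "emeasure (fiber n) (cell n r) \<le> emeasure (fiber n) {y \<in> space (fiber n). \<forall>i\<in>{1..<n}. \<bar>y i\<bar> \<le> \<bar>r\<bar>}"
    by (rule emeasure_mono) (rule fiber_box(1), simp)
  also have "\<dots> = ennreal ((2 * \<bar>r\<bar>) ^ (n - 1))" by (rule fiber_box(2)) simp
  also have "\<dots> < \<infinity>" by simp
  finally show ?thesis .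
qed

lemma measurable_fiber_scaling [measurable]:
  "(\<lambda>y. \<lambda>i\<in>{1..<n}. r * y i) \<in> fiber n \<rightarrow>\<^sub>M fiber n" for r :: real
proof -
  have "(\<lambda>y. \<lambda>i\<in>{1..<n}. r * y i) \<in> fiber n \<rightarrow>\<^sub>M (\<Pi>\<^sub>M i\<in>{1..<n}. lborel)"
    by (rule measurable_restrict) (simp add: measurable_lborel2)
  then show ?thesis by (simp add: fiber_def)
qed

lemma fiber_scaling:
  assumes "0 < r"
  shows "fiber n = distr (density (fiber n) (\<lambda>_. ennreal (r ^ (n - 1)))) (fiber n) (\<lambda>y. \<lambda>i\<in>{1..<n}. r * y i)"
    (is "_ = ?D")
proof -
  have "?D = (\<Pi>\<^sub>M i\<in>{1..<n}. lborel)"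
  proof (rule line_product.PiM_eqI)
    show "sets ?D = sets (\<Pi>\<^sub>M i\<in>{1..<n}. lborel)" by (simp add: fiber_def)
    fix A :: "nat \<Rightarrow> real set" assume A: "\<And>i. i \<in> {1..<n} \<Longrightarrow> A i \<in> sets lborel"
    have box [measurable]: "Pi\<^sub>E {1..<n} A \<in> sets (fiber n)"
      unfolding fiber_def using A by (intro sets_PiM_I_finite) auto
    let ?g = "\<lambda>y. \<lambda>i\<in>{1..<n}. r * y i"
    have "emeasure ?D (Pi\<^sub>E {1..<n} A)
        = (\<integral>\<^sup>+y. ennreal (r ^ (n - 1)) * indicator (?g -` Pi\<^sub>E {1..<n} A \<inter> space (fiber n)) y \<partial>fiber n)"
      by (subst emeasure_distr, simp, simp, subst emeasure_density) auto
    also have "\<dots> = (\<integral>\<^sup>+y. ennreal (r ^ (n - 1) * (\<Prod>i\<in>{1..<n}. indicator (A i) (0 + r * y i))) \<partial>fiber n)"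
    proof (intro nn_integral_cong)
      fix y assume "y \<in> space (fiber n)"
      moreover have "?g y \<in> Pi\<^sub>E {1..<n} A \<longleftrightarrow> (\<forall>i\<in>{1..<n}. 0 + r * y i \<in> A i)"
        by (auto simp: PiE_iff)
      ultimately have ind: "indicator (?g -` Pi\<^sub>E {1..<n} A \<inter> space (fiber n)) y
          = (if \<forall>i\<in>{1..<n}. 0 + r * y i \<in> A i then 1 else 0 :: ennreal)"
        by (simp only: indicator_def of_bool_def vimage_eq Int_iff simp_thms)
      show "ennreal (r ^ (n - 1)) * indicator (?g -` Pi\<^sub>E {1..<n} A \<inter> space (fiber n)) y
          = ennreal (r ^ (n - 1) * (\<Prod>i\<in>{1..<n}. indicator (A i) (0 + r * y i)))"
        unfolding ind prod_indicator[OF finite_atLeastLessThan] by simp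
    qed
    also have "\<dots> = (\<Prod>i\<in>{1..<n}. emeasure lborel (A i))"
      using A by (intro nn_integral_fiber_box[OF assms]) auto
    finally show "emeasure ?D (Pi\<^sub>E {1..<n} A) = (\<Prod>i\<in>{1..<n}. emeasure lborel (A i))" .
  qed simp
  then show ?thesis by (simp add: fiber_def)
qed

definition cell_volume :: "nat \<Rightarrow> real"
  where "cell_volume n = measure (fiber n) (cell n 1)"

text \<open>
  Cells are dilations of the cell of radius 1 in dimension \<open>n - 1\<close>.
\<close>

lemma measure_cell:
  assumes n: "2 \<le> n" and "0 < r" shows "measure (fiber n) (cell n r) = r ^ (n - 1) * cell_volume n"
proof -
  let ?g = "\<lambda>y. \<lambda>i\<in>{1..<n}. r * y i :: real"
  have "rel_spread n (?g y) = r * rel_spread n y" for y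
  proof -
    have "\<bar>((?g y)(0 := 0)) i - ((?g y)(0 := 0)) j\<bar> = r * \<bar>(y(0 := 0)) i - (y(0 := 0)) j\<bar>"
      if "i < n" "j < n" for i j
      using \<open>0 < r\<close> that by (auto simp: abs_mult right_diff_distrib[symmetric])
    then show ?thesis
      using rel_spread_scale[OF assms, of "(?g y)(0 := 0)" y] by (simp only: rel_spread_def)
  qed
  then have pre: "?g -` cell n r \<inter> space (fiber n) = cell n 1"
    using \<open>0 < r\<close> measurable_space[OF measurable_fiber_scaling[of r n]] unfolding cell_def by auto
  have "emeasure (fiber n) (cell n r)
      = emeasure (distr (density (fiber n) (\<lambda>_. ennreal (r ^ (n - 1)))) (fiber n) ?g) (cell n r)"
    by (rule arg_cong[where f = "\<lambda>M. emeasure M (cell n r)", OF fiber_scaling[OF \<open>0 < r\<close>]])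
  also have "\<dots> = emeasure (density (fiber n) (\<lambda>_. ennreal (r ^ (n - 1)))) (cell n 1)"
    using n by (subst emeasure_distr) (auto simp: pre)
  also have "\<dots> = ennreal (r ^ (n - 1)) * emeasure (fiber n) (cell n 1)"
    using n by (subst emeasure_density_const) auto
  finally show ?thesis
    using \<open>0 < r\<close> unfolding cell_volume_def measure_def by (simp add: enn2real_mult)
qed

lemma cell_volume_pos:
  assumes n: "2 \<le> n" shows "0 < cell_volume n"
proof -
  have "{y \<in> space (fiber n). \<forall>i\<in>{1..<n}. \<bar>y i\<bar> \<le> 1 / 2} \<subseteq> cell n 1"
  proof
    fix y :: "nat \<Rightarrow> real" assume y: "y \<in> {y \<in> space (fiber n). \<forall>i\<in>{1..<n}. \<bar>y i\<bar> \<le> 1 / 2}"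
    have "\<bar>(y(0 := 0)) i\<bar> \<le> 1 / 2" if "i < n" for i
      using y that by (cases "i = 0") auto
    then have "\<bar>(y(0 := 0)) i - (y(0 := 0)) j\<bar> \<le> 1" if "i < n" "j < n" for i j
      using that by (smt (verit) field_sum_of_halves)
    then show "y \<in> cell n 1" using y unfolding cell_def rel_spread_le_iff[OF n] by auto
  qed
  then have "emeasure (fiber n) {y \<in> space (fiber n). \<forall>i\<in>{1..<n}. \<bar>y i\<bar> \<le> 1 / 2} \<le> emeasure (fiber n) (cell n 1)"
    using n by (intro emeasure_mono) auto
  then have "1 \<le> emeasure (fiber n) (cell n 1)"
    using fiber_box(2)[of "1 / 2" n] by simp
  then show ?thesis
    using emeasure_cell_finite[OF n, of 1] unfolding cell_volume_def measure_def
    by (metis enn2real_positive_iff ennreal_zero_less_one infinity_ennreal_def less_le_trans)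
qed

text \<open>
  The sphere of radius \<open>r\<close> lies in the difference of the cells of radius \<open>r\<close> and \<open>s\<close> for every
  \<open>s < r\<close>, whose volume tends to 0 for \<open>s \<longlongrightarrow> r\<close> by the scaling law. On the complement of the sphere the
  indicator function of the cell is continuous.
\<close>

lemma AE_rel_spread_neq:
  assumes n: "2 \<le> n" and "0 < r" shows "AE y in fiber n. rel_spread n y \<noteq> r"
proof -
  let ?Z = "{y \<in> space (fiber n). rel_spread n y = r}"
  have [measurable]: "?Z \<in> sets (fiber n)" using n by measurable
  have fin: "emeasure (fiber n) (cell n s) \<noteq> \<infinity>" for s
    using emeasure_cell_finite[OF n, of s] by simp
  have "?Z \<subseteq> cell n r" unfolding cell_def by auto
  then have finZ: "emeasure (fiber n) ?Z \<noteq> \<infinity>"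
    using fin[of r] n 
    by (metis (no_types, lifting) cell_measurable emeasure_mono infinity_ennreal_def top.extremum_uniqueI)
  have bound: "measure (fiber n) ?Z \<le> cell_volume n * (r ^ (n - 1) - s ^ (n - 1))" if "0 < s" "s < r" for s
  proof -
    have "measure (fiber n) (cell n s \<union> ?Z) \<le> measure (fiber n) (cell n r)"
    proof (rule measure_mono_fmeasurable)
      show "cell n s \<union> ?Z \<subseteq> cell n r" using \<open>s < r\<close> unfolding cell_def by auto
      show "cell n s \<union> ?Z \<in> sets (fiber n)" using n by measurable
      show "cell n r \<in> fmeasurable (fiber n)" using n fin[of r] by (intro fmeasurableI) (auto simp: less_top)
    qed
    moreover have "measure (fiber n) (cell n s \<union> ?Z) = measure (fiber n) (cell n s) + measure (fiber n) ?Z"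
    proof (rule measure_Union[OF fin finZ])
      show "cell n s \<inter> ?Z = {}" using \<open>s < r\<close> unfolding cell_def by auto
    qed (use n in measurable)
    ultimately show ?thesis
      using measure_cell[OF n \<open>0 < r\<close>] measure_cell[OF n \<open>0 < s\<close>] by (simp add: algebra_simps)
  qed
  have "((\<lambda>s. cell_volume n * (r ^ (n - 1) - s ^ (n - 1))) \<longlongrightarrow> cell_volume n * (r ^ (n - 1) - r ^ (n - 1))) (at_left r)"
    by (intro tendsto_intros)
  moreover have "\<forall>\<^sub>F s in at_left r. measure (fiber n) ?Z \<le> cell_volume n * (r ^ (n - 1) - s ^ (n - 1))"
    using eventually_at_left_real[OF \<open>0 < r\<close>] by eventually_elim (use bound in auto)
  ultimately have "measure (fiber n) ?Z \<le> cell_volume n * (r ^ (n - 1) - r ^ (n - 1))"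
    by (intro tendsto_lowerbound) auto
  then have "measure (fiber n) ?Z = 0" using measure_nonneg[of "fiber n" ?Z] by simp
  then have "emeasure (fiber n) ?Z = 0"
    using finZ by (simp add: emeasure_eq_ennreal_measure)
  then show ?thesis
    by (intro AE_I[of _ _ ?Z]) auto
qed

section \<open>Integrals over shrinking neighbourhoods of the diagonal\<close>

lemma integrable_first_coordinate:
  assumes "0 < n" and "integrable unit_interval H" shows "integrable (leb n) (\<lambda>x. H (x 0) :: real)"
proof -
  have "distr (leb n) unit_interval (\<lambda>x. x 0) = unit_interval"
    unfolding leb_def using prob_space_unit_interval \<open>0 < n\<close>
    by (intro distr_PiM_component) auto
  then have "integrable (distr (leb n) unit_interval (\<lambda>x. x 0)) H" using assms(2) by simp
  then show ?thesis using leb_coordinate[OF \<open>0 < n\<close>] by (rule integrable_distr[rotated])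
qed

lemma AE_unit_fiber_fst:
  assumes "AE t in unit_interval. P t" shows "AE p in unit_interval \<Otimes>\<^sub>M fiber n. P (fst p)"
proof -
  obtain N where N: "{t \<in> space unit_interval. \<not> P t} \<subseteq> N" "N \<in> null_sets unit_interval"
    using assms by (auto elim!: AE_E simp: null_sets_def)
  have [measurable]: "N \<in> sets unit_interval" using N(2) by auto
  have "AE p in unit_interval \<Otimes>\<^sub>M fiber n. fst p \<notin> N"
  proof (rule unit_fiber.AE_pair_measure)
    show "AE t in unit_interval. AE y in fiber n. fst (t, y) \<notin> N"
      using AE_not_in[OF N(2)] by eventually_elim simp
  qed measurable
  moreover have "AE p in unit_interval \<Otimes>\<^sub>M fiber n. fst p \<in> space unit_interval"
    by (rule AE_I2) (simp add: space_pair_measure mem_Times_iff)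
  ultimately show ?thesis by eventually_elim (use N(1) in auto)
qed

lemma AE_unit_interior: "AE t in unit_interval. 0 < t \<and> t < 1"
proof -
  have "AE t in lborel. t \<notin> {0, 1::real}"
    by (rule AE_not_in) (simp add: countable_imp_null_set_lborel)
  then show ?thesis by (subst AE_restrict_space_iff, simp, elim eventually_mono) auto
qed

lemma eventually_fits:
  assumes "0 < t" "t < 1" and "\<nu> \<longlonglongrightarrow> 0"
  shows "\<forall>\<^sub>F m in sequentially. fits n (\<nu> m) (t, y) = 1"
proof -
  have "\<forall>\<^sub>F m in sequentially. t + \<nu> m * y i \<in> {0<..<1}" for i
  proof -
    have "(\<lambda>m. t + \<nu> m * y i) \<longlonglongrightarrow> t + 0 * y i" using assms(3) by (intro tendsto_intros)
    then show ?thesis using assms(1,2) by (intro topological_tendstoD) auto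
  qed
  then have "\<forall>\<^sub>F m in sequentially. \<forall>i\<in>{1..<n}. t + \<nu> m * y i \<in> {0<..<1}"
    by (intro eventually_ball_finite) auto
  then show ?thesis by eventually_elim (auto simp: fits_cases)
qed

lemma fan_tendsto:
  assumes "0 < t" "t < 1" and "\<nu> \<longlonglongrightarrow> 0" and "i < n"
  shows "(\<lambda>m. fan n (\<nu> m) (t, y) i) \<longlonglongrightarrow> t"
proof -
  have "(\<lambda>m. t + \<nu> m * (y(0 := 0)) i) \<longlonglongrightarrow> t + 0 * (y(0 := 0)) i"
    using assms(3) by (intro tendsto_intros)
  moreover have "\<forall>\<^sub>F m in sequentially. t + \<nu> m * (y(0 := 0)) i = fan n (\<nu> m) (t, y) i"
    using eventually_fits[OF assms(1-3), of n y] by eventually_elim (rule fan_apply[OF _ \<open>i < n\<close>, symmetric], simp)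
  ultimately have "(\<lambda>m. fan n (\<nu> m) (t, y) i) \<longlonglongrightarrow> t + 0 * (y(0 := 0)) i"
    by (rule Lim_transform_eventually)
  then show ?thesis by (simp only: mult_zero_left add_0_right)
qed

text \<open>
  A set of finite measure that contains all transversal vectors of synchronised points; its indicator
  function dominates in the limit theorems.
\<close>

definition unit_box :: "nat \<Rightarrow> (nat \<Rightarrow> real) set"
  where "unit_box n = {y \<in> space (fiber n). \<forall>i\<in>{1..<n}. \<bar>y i\<bar> \<le> 1}"

lemma unit_box_measurable [measurable]: "unit_box n \<in> sets (fiber n)"
  unfolding unit_box_def by (rule fiber_box(1)) simp

lemma emeasure_unit_box: "emeasure (fiber n) (unit_box n) = ennreal (2 ^ (n - 1))"
  unfolding unit_box_def using fiber_box(2)[of 1 n] by simp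

lemma spread_le_1_in_box: "2 \<le> n \<Longrightarrow> y \<in> space (fiber n) \<Longrightarrow> rel_spread n y \<le> 1 \<Longrightarrow> y \<in> unit_box n"
  using order_trans[OF coordinate_le_rel_spread] unfolding unit_box_def by blast

lemma synchronised_in_box:
  assumes "2 \<le> n" "0 < \<nu>" "y \<in> space (fiber n)" "fits n \<nu> (t, y) \<noteq> 0" "fan n \<nu> (t, y) \<in> sync_set n \<nu>"
  shows "y \<in> unit_box n"
proof -
  have "\<nu> * rel_spread n y \<le> \<nu>"
    using assms(5) sync_dist_fan[OF assms(1,2,4)] unfolding sync_set_def by simp
  then have "rel_spread n y \<le> 1" using assms(2) by simp
  then show ?thesis by (rule spread_le_1_in_box[OF assms(1,3)])
qed

lemma sync_indicator_limit:
  assumes n: "2 \<le> n" and \<nu>_pos: "\<And>m. 0 < \<nu> m" and \<nu>: "\<nu> \<longlonglongrightarrow> 0"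
  shows "AE p in unit_interval \<Otimes>\<^sub>M fiber n. (\<lambda>m. indicator (sync_set n (\<nu> m)) (fan n (\<nu> m) p))
    \<longlonglongrightarrow> (indicator {p \<in> space (unit_interval \<Otimes>\<^sub>M fiber n). rel_spread n (snd p) \<le> 1} p :: real)"
  using AE_unit_fiber_fst[OF AE_unit_interior] AE_space
proof eventually_elim
  case (elim p)
  let ?C = "{p \<in> space (unit_interval \<Otimes>\<^sub>M fiber n). rel_spread n (snd p) \<le> 1}"
  obtain t y where ty: "p = (t, y)" by (cases p)
  have t: "0 < t" "t < 1" using elim(1) ty by auto
  have "\<forall>\<^sub>F m in sequentially. indicator (sync_set n (\<nu> m)) (fan n (\<nu> m) p) = (indicator ?C p :: real)"
    using eventually_fits[OF t \<nu>, of n y]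
  proof eventually_elim
    fix m assume "fits n (\<nu> m) (t, y) = 1"
    then have "sync_dist n (fan n (\<nu> m) p) = \<nu> m * rel_spread n y"
      unfolding ty by (intro sync_dist_fan[OF n \<nu>_pos]) simp
    then have "fan n (\<nu> m) p \<in> sync_set n (\<nu> m) \<longleftrightarrow> rel_spread n y \<le> 1"
      using fan_in_unit_cube[of t n "\<nu> m" y] t \<nu>_pos[of m] unfolding ty sync_set_def by auto
    then show "indicator (sync_set n (\<nu> m)) (fan n (\<nu> m) p) = (indicator ?C p :: real)"
      using elim(2) ty by (simp add: indicator_def)
  qed
  then show ?case by (rule tendsto_eventually)
qed

locale diagonal_profile =
  fixes n :: nat and H :: "real \<Rightarrow> real"
  assumes n: "2 \<le> n" and int_H: "integrable unit_interval H"
begin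

lemma n_pos: "0 < n" using n by simp

lemma measurable_H [measurable]: "H \<in> borel_measurable unit_interval"
  using int_H by blast

lemma measurable_H_fst [measurable]: "(\<lambda>p. H (fst p)) \<in> borel_measurable (unit_interval \<Otimes>\<^sub>M fiber n)"
  by (rule measurable_compose[OF measurable_fst measurable_H])

lemma integrable_dominating:
  "integrable (unit_interval \<Otimes>\<^sub>M fiber n) (\<lambda>p. \<bar>H (fst p)\<bar> * indicator (unit_box n) (snd p))"
proof (rule integrableI_bounded)
  show "(\<lambda>p. \<bar>H (fst p)\<bar> * indicator (unit_box n) (snd p)) \<in> borel_measurable (unit_interval \<Otimes>\<^sub>M fiber n)" by measurable
  have "(\<integral>\<^sup>+p. ennreal (norm (\<bar>H (fst p)\<bar> * indicator (unit_box n) (snd p))) \<partial>(unit_interval \<Otimes>\<^sub>M fiber n))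
      = (\<integral>\<^sup>+t. \<integral>\<^sup>+y. ennreal \<bar>H t\<bar> * indicator (unit_box n) y \<partial>fiber n \<partial>unit_interval)"
    by (subst fiber.nn_integral_fst[symmetric], measurable)
      (auto intro!: nn_integral_cong simp: indicator_def)
  also have "\<dots> = (\<integral>\<^sup>+t. ennreal \<bar>H t\<bar> * emeasure (fiber n) (unit_box n) \<partial>unit_interval)"
    by (intro nn_integral_cong) (simp add: nn_integral_cmult_indicator)
  also have "\<dots> = (\<integral>\<^sup>+t. ennreal \<bar>H t\<bar> \<partial>unit_interval) * emeasure (fiber n) (unit_box n)"
    by (rule nn_integral_multc) measurable
  also have "\<dots> < \<infinity>"
    using int_H emeasure_unit_box[of n] unfolding integrable_iff_bounded
    by (simp add: ennreal_mult_less_top)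
  finally show "(\<integral>\<^sup>+p. ennreal (norm (\<bar>H (fst p)\<bar> * indicator (unit_box n) (snd p))) \<partial>(unit_interval \<Otimes>\<^sub>M fiber n)) < \<infinity>" .
qed

text \<open>
  Integrating out the transversal directions replaces a cell of radius \<open>\<rho> t\<close> by its volume.
\<close>

lemma integral_cells:
  assumes \<rho> [measurable]: "\<rho> \<in> borel_measurable unit_interval" and le: "\<And>t. \<rho> t \<le> 1"
    and pos: "AE t in unit_interval. 0 < \<rho> t"
  shows "(\<integral>p. H (fst p) * indicator {p \<in> space (unit_interval \<Otimes>\<^sub>M fiber n). rel_spread n (snd p) \<le> \<rho> (fst p)} p
      \<partial>(unit_interval \<Otimes>\<^sub>M fiber n)) = cell_volume n * (\<integral>t. H t * \<rho> t ^ (n - 1) \<partial>unit_interval)"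
proof -
  let ?M = "unit_interval \<Otimes>\<^sub>M fiber n"
  let ?C = "{p \<in> space ?M. rel_spread n (snd p) \<le> \<rho> (fst p)}"
  note measurable_rel_spread[OF n, measurable]
  have [measurable]: "?C \<in> sets ?M" by measurable
  have "integrable ?M (\<lambda>p. H (fst p) * indicator ?C p)"
  proof (rule Bochner_Integration.integrable_bound[OF integrable_dominating])
    show "AE p in ?M. norm (H (fst p) * indicator ?C p) \<le> norm (\<bar>H (fst p)\<bar> * indicator (unit_box n) (snd p))"
    proof (rule AE_I2)
      fix p assume p: "p \<in> space ?M"
      have "snd p \<in> unit_box n" if "p \<in> ?C"
      proof -
        have "rel_spread n (snd p) \<le> 1" using that le[of "fst p"] by auto
        then show ?thesis using p by (intro spread_le_1_in_box n) (auto simp: space_pair_measure)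
      qed
      then show "norm (H (fst p) * indicator ?C p) \<le> norm (\<bar>H (fst p)\<bar> * indicator (unit_box n) (snd p))"
        by (auto simp: indicator_def)
    qed
  qed measurable
  then have "(\<integral>p. H (fst p) * indicator ?C p \<partial>?M) = (\<integral>t. (\<integral>y. H t * indicator ?C (t, y) \<partial>fiber n) \<partial>unit_interval)"
    by (subst unit_fiber.integral_fst'[symmetric]) auto
  also have "\<dots> = (\<integral>t. cell_volume n * (H t * \<rho> t ^ (n - 1)) \<partial>unit_interval)"
  proof (rule integral_cong_AE)
    show "(\<lambda>t. \<integral>y. H t * indicator ?C (t, y) \<partial>fiber n) \<in> borel_measurable unit_interval"
      by (rule fiber.borel_measurable_lebesgue_integral) measurable
    show "AE t in unit_interval. (\<integral>y. H t * indicator ?C (t, y) \<partial>fiber n) = cell_volume n * (H t * \<rho> t ^ (n - 1))"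
      using pos AE_space
    proof eventually_elim
      case (elim t)
      have "(\<integral>y. H t * indicator ?C (t, y) \<partial>fiber n) = (\<integral>y. H t * indicator (cell n (\<rho> t)) y \<partial>fiber n)"
        using elim(2) by (intro Bochner_Integration.integral_cong) (auto simp: indicator_def cell_def space_pair_measure)
      also have "\<dots> = H t * measure (fiber n) (cell n (\<rho> t))"
        using cell_measurable[OF n, of "\<rho> t"] sets.sets_into_space by (auto simp: Int_absorb2)
      finally show ?case using measure_cell[OF n elim(1)] by (simp only: mult_ac)
    qed
  qed measurable
  finally show ?thesis by simp
qed

end

text \<open>
  The function \<open>H\<close> is the trace of the density \<open>h\<close> on the diagonal, in the averaged sense in which it
  enters the limits: over the synchronisation set, \<open>h\<close> may be replaced by \<open>H\<close> with an error that is
  small compared to the volume of the set.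
\<close>

locale diagonal_density = diagonal_profile n H
  for n :: nat and H :: "real \<Rightarrow> real" +
  fixes h :: "(nat \<Rightarrow> real) \<Rightarrow> real" and \<nu> :: "nat \<Rightarrow> real"
  assumes \<nu>_pos: "\<And>m. 0 < \<nu> m" and \<nu>_tendsto: "\<nu> \<longlonglongrightarrow> 0"
    and int_h: "integrable (leb n) h"
    and approx: "(\<lambda>m. (\<integral>x. indicator (sync_set n (\<nu> m)) x * \<bar>h x - H (x 0)\<bar> \<partial>leb n) / \<nu> m ^ (n - 1)) \<longlonglongrightarrow> 0"
begin

abbreviation "S m \<equiv> sync_set n (\<nu> m)"

lemma S_measurable [measurable]: "S m \<in> sets (leb n)"
  by (rule sync_set_measurable[OF n])

text \<open>
  First replace \<open>h\<close> by the function \<open>H\<close> of coordinate 0, then change variables; the powers of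
  \<open>\<nu>\<close> cancel, and what is left is dominated by \<open>\<bar>H\<bar>\<close> times the indicator function of a bounded
  set of transversal vectors.
\<close>

lemma diagonal_limit:
  assumes w [measurable]: "\<And>m. w m \<in> borel_measurable (leb n)" and bound: "\<And>m x. \<bar>w m x\<bar> \<le> (1::real)"
    and \<phi> [measurable]: "\<phi> \<in> borel_measurable (unit_interval \<Otimes>\<^sub>M fiber n)"
    and lim: "AE p in unit_interval \<Otimes>\<^sub>M fiber n.
      (\<lambda>m. indicator (S m) (fan n (\<nu> m) p) * w m (fan n (\<nu> m) p)) \<longlonglongrightarrow> \<phi> p"
  shows "(\<lambda>m. (\<integral>x. h x * (indicator (S m) x * w m x) \<partial>leb n) / \<nu> m ^ (n - 1))
    \<longlonglongrightarrow> (\<integral>p. H (fst p) * \<phi> p \<partial>(unit_interval \<Otimes>\<^sub>M fiber n))"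
proof -
  let ?M = "unit_interval \<Otimes>\<^sub>M fiber n"
  let ?v = "\<lambda>m x. indicator (S m) x * w m x"
  have v [measurable]: "?v m \<in> borel_measurable (leb n)" for m by measurable
  have v_bound: "\<bar>?v m x\<bar> \<le> 1" for m x using bound[of m x] by (simp add: indicator_def)
  have Hx: "integrable (leb n) (\<lambda>x. H (x 0))" by (rule integrable_first_coordinate[OF n_pos int_H])
  then have [measurable]: "(\<lambda>x. H (x 0)) \<in> borel_measurable (leb n)" by blast
  have [measurable]: "h \<in> borel_measurable (leb n)" using int_h by blast
  have int_mult: "integrable (leb n) (\<lambda>x. f x * ?v m x)" if "integrable (leb n) f" for f :: "_ \<Rightarrow> real" and m
  proof (rule Bochner_Integration.integrable_bound[OF that])
    show "(\<lambda>x. f x * ?v m x) \<in> borel_measurable (leb n)" using that by (intro borel_measurable_times v) auto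
    show "AE x in leb n. norm (f x * ?v m x) \<le> norm (f x)"
      by (rule AE_I2, simp only: real_norm_def abs_mult[of "f _"], rule mult_left_le) (use v_bound in auto)
  qed
  \<comment> \<open>Change of variables; coordinate 0 of \<open>fan n \<nu> (t, y)\<close> is \<open>t\<close>.\<close>
  have straight: "(\<integral>x. H (x 0) * ?v m x \<partial>leb n) / \<nu> m ^ (n - 1)
      = (\<integral>p. fits n (\<nu> m) p * (H (fst p) * ?v m (fan n (\<nu> m) p)) \<partial>?M)" for m
  proof -
    have "fan n (\<nu> m) p 0 = fst p" for p using n_pos by (simp add: fan_def case_prod_beta')
    then have "(\<integral>x. H (x 0) * ?v m x \<partial>leb n)
        = (\<integral>p. \<nu> m ^ (n - 1) * fits n (\<nu> m) p * (H (fst p) * ?v m (fan n (\<nu> m) p)) \<partial>?M)"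
      by (subst integral_leb_fan[OF n_pos \<nu>_pos[of m]]) auto
    also have "\<dots> = \<nu> m ^ (n - 1) * (\<integral>p. fits n (\<nu> m) p * (H (fst p) * ?v m (fan n (\<nu> m) p)) \<partial>?M)"
      by (simp only: mult.assoc Bochner_Integration.integral_mult_right_zero)
    finally show ?thesis using \<nu>_pos[of m] by simp
  qed
  have "(\<lambda>m. \<integral>p. fits n (\<nu> m) p * (H (fst p) * ?v m (fan n (\<nu> m) p)) \<partial>?M) \<longlonglongrightarrow> (\<integral>p. H (fst p) * \<phi> p \<partial>?M)"
  proof (rule integral_dominated_convergence[OF _ _ integrable_dominating])
    show "(\<lambda>p. H (fst p) * \<phi> p) \<in> borel_measurable ?M" by measurable
    show "(\<lambda>p. fits n (\<nu> m) p * (H (fst p) * ?v m (fan n (\<nu> m) p))) \<in> borel_measurable ?M" for m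
      using measurable_compose[OF measurable_fan v] by measurable
    show "AE p in ?M. (\<lambda>m. fits n (\<nu> m) p * (H (fst p) * ?v m (fan n (\<nu> m) p))) \<longlonglongrightarrow> H (fst p) * \<phi> p"
      using lim AE_unit_fiber_fst[OF AE_unit_interior]
    proof eventually_elim
      case (elim p)
      have "\<forall>\<^sub>F m in sequentially. fits n (\<nu> m) (fst p, snd p) = 1"
        using elim(2) by (intro eventually_fits \<nu>_tendsto) auto
      then have "(\<lambda>m. fits n (\<nu> m) p) \<longlonglongrightarrow> 1"
        by (intro tendsto_eventually) simp
      then have "(\<lambda>m. fits n (\<nu> m) p * (H (fst p) * ?v m (fan n (\<nu> m) p))) \<longlonglongrightarrow> 1 * (H (fst p) * \<phi> p)"
        using elim(1) by (intro tendsto_mult tendsto_const)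
      then show ?case by simp
    qed
    show "AE p in ?M. norm (fits n (\<nu> m) p * (H (fst p) * ?v m (fan n (\<nu> m) p))) \<le> \<bar>H (fst p)\<bar> * indicator (unit_box n) (snd p)" for m
    proof (rule AE_I2)
      fix p assume p: "p \<in> space ?M"
      obtain t y where ty: "p = (t, y)" by (cases p)
      show "norm (fits n (\<nu> m) p * (H (fst p) * ?v m (fan n (\<nu> m) p))) \<le> \<bar>H (fst p)\<bar> * indicator (unit_box n) (snd p)"
      proof (cases "fits n (\<nu> m) p \<noteq> 0 \<and> fan n (\<nu> m) p \<in> S m")
        case True
        then have "y \<in> unit_box n"
          using p synchronised_in_box[OF n \<nu>_pos[of m]] unfolding ty by (auto simp: space_pair_measure)
        moreover have "fits n (\<nu> m) p = 1" using True unfolding ty fits_cases by (auto split: if_splits)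
        moreover have "\<bar>H (fst p)\<bar> * \<bar>?v m (fan n (\<nu> m) p)\<bar> \<le> \<bar>H (fst p)\<bar> * 1"
          by (rule mult_left_mono[OF v_bound abs_ge_zero])
        ultimately show ?thesis unfolding ty by (simp add: abs_mult)
      qed (auto simp: indicator_def)
    qed
  qed
  then have main: "(\<lambda>m. (\<integral>x. H (x 0) * ?v m x \<partial>leb n) / \<nu> m ^ (n - 1)) \<longlonglongrightarrow> (\<integral>p. H (fst p) * \<phi> p \<partial>?M)"
    unfolding straight .
  \<comment> \<open>The error of replacing \<open>h\<close> by \<open>H\<close>.\<close>
  have "(\<lambda>m. (\<integral>x. h x * ?v m x \<partial>leb n) / \<nu> m ^ (n - 1) - (\<integral>x. H (x 0) * ?v m x \<partial>leb n) / \<nu> m ^ (n - 1)) \<longlonglongrightarrow> 0"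
  proof (rule Lim_null_comparison[OF _ approx], rule always_eventually, rule allI)
    fix m
    have "norm ((\<integral>x. h x * ?v m x \<partial>leb n) - (\<integral>x. H (x 0) * ?v m x \<partial>leb n))
        = norm (\<integral>x. h x * ?v m x - H (x 0) * ?v m x \<partial>leb n)"
      by (rule arg_cong[OF Bochner_Integration.integral_diff[OF int_mult[OF int_h] int_mult[OF Hx], symmetric]])
    also have "\<dots> \<le> (\<integral>x. norm (h x * ?v m x - H (x 0) * ?v m x) \<partial>leb n)"
      by (rule integral_norm_bound)
    also have "\<dots> \<le> (\<integral>x. indicator (S m) x * \<bar>h x - H (x 0)\<bar> \<partial>leb n)"
    proof (rule integral_mono)
      show "integrable (leb n) (\<lambda>x. norm (h x * ?v m x - H (x 0) * ?v m x))"
        by (rule integrable_norm, rule Bochner_Integration.integrable_diff[OF int_mult[OF int_h] int_mult[OF Hx]])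
      show "integrable (leb n) (\<lambda>x. indicator (S m) x * \<bar>h x - H (x 0)\<bar>)"
      proof (subst mult.commute, rule integrable_real_mult_indicator)
        show "integrable (leb n) (\<lambda>x. \<bar>h x - H (x 0)\<bar>)"
          by (rule integrable_abs, rule Bochner_Integration.integrable_diff[OF int_h Hx])
      qed (rule S_measurable)
      fix x
      have "norm (h x * ?v m x - H (x 0) * ?v m x) = indicator (S m) x * (\<bar>h x - H (x 0)\<bar> * \<bar>w m x\<bar>)"
        by (simp add: abs_mult[symmetric] left_diff_distrib indicator_def)
      also have "\<dots> \<le> indicator (S m) x * (\<bar>h x - H (x 0)\<bar> * 1)"
        by (intro mult_left_mono bound) auto
      finally show "norm (h x * ?v m x - H (x 0) * ?v m x) \<le> indicator (S m) x * \<bar>h x - H (x 0)\<bar>" by simp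
    qed
    finally show "norm ((\<integral>x. h x * ?v m x \<partial>leb n) / \<nu> m ^ (n - 1) - (\<integral>x. H (x 0) * ?v m x \<partial>leb n) / \<nu> m ^ (n - 1))
        \<le> (\<integral>x. indicator (S m) x * \<bar>h x - H (x 0)\<bar> \<partial>leb n) / \<nu> m ^ (n - 1)"
      using \<nu>_pos[of m] by (simp add: diff_divide_distrib[symmetric] divide_right_mono abs_divide)
  qed
  from tendsto_add[OF this main] show ?thesis by simp
qed

lemma mass_limit:
  "(\<lambda>m. (\<integral>x. h x * indicator (S m) x \<partial>leb n) / \<nu> m ^ (n - 1)) \<longlonglongrightarrow> cell_volume n * (\<integral>t. H t \<partial>unit_interval)"
proof -
  let ?M = "unit_interval \<Otimes>\<^sub>M fiber n"
  let ?C = "{p \<in> space ?M. rel_spread n (snd p) \<le> 1}"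
  note measurable_rel_spread[OF n, measurable]
  have "(\<lambda>m. (\<integral>x. h x * (indicator (S m) x * 1) \<partial>leb n) / \<nu> m ^ (n - 1)) \<longlonglongrightarrow> (\<integral>p. H (fst p) * indicator ?C p \<partial>?M)"
    by (rule diagonal_limit) (use sync_indicator_limit[OF n \<nu>_pos \<nu>_tendsto] in auto)
  then show ?thesis using integral_cells[of "\<lambda>_. 1"] by simp
qed

text \<open>
  Testing the limit theorem with the indicator function of \<open>{t. H t < 0}\<close> gives a limit that is both
  nonnegative and an integral of a nonpositive function. Applied to \<open>h - c\<close> and \<open>H - c\<close>, this passes
  a lower bound on the density to the diagonal in both cases of the regularity hypothesis.
\<close>

lemma AE_diagonal_nonneg:
  assumes h: "AE x in leb n. 0 \<le> h x" shows "AE t in unit_interval. 0 \<le> H t"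
proof -
  let ?M = "unit_interval \<Otimes>\<^sub>M fiber n"
  let ?C = "{p \<in> space ?M. rel_spread n (snd p) \<le> 1}"
  let ?N = "{t \<in> space unit_interval. H t < 0}"
  note measurable_rel_spread[OF n, measurable]
  have N [measurable]: "?N \<in> sets unit_interval" by measurable
  have int: "integrable unit_interval (\<lambda>t. H t * indicator ?N t)"
    by (rule integrable_real_mult_indicator[OF N int_H])
  interpret negative: diagonal_profile n "\<lambda>t. H t * indicator ?N t"
    by standard (fact n, fact int)
  have C [measurable]: "?C \<in> sets ?M" by measurable
  have N_fst [measurable]: "(\<lambda>p. indicator ?N (fst p) :: real) \<in> borel_measurable ?M"
    by (rule measurable_compose[OF measurable_fst]) measurable
  have fan0: "fan n (\<nu> m) p 0 = fst p" for m p using n_pos by (simp add: fan_def case_prod_beta')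
  have "(\<lambda>m. (\<integral>x. h x * (indicator (S m) x * indicator ?N (x 0)) \<partial>leb n) / \<nu> m ^ (n - 1))
      \<longlonglongrightarrow> (\<integral>p. H (fst p) * (indicator ?C p * indicator ?N (fst p)) \<partial>?M)"
  proof (rule diagonal_limit)
    show "(\<lambda>x. indicator ?N (x 0) :: real) \<in> borel_measurable (leb n)"
      by (rule measurable_compose[OF leb_coordinate[OF n_pos]]) measurable
    show "AE p in ?M. (\<lambda>m. indicator (S m) (fan n (\<nu> m) p) * indicator ?N (fan n (\<nu> m) p 0))
        \<longlonglongrightarrow> (indicator ?C p * indicator ?N (fst p) :: real)"
      unfolding fan0 using sync_indicator_limit[OF n \<nu>_pos \<nu>_tendsto]
      by eventually_elim (intro tendsto_mult tendsto_const)
  qed (auto simp: indicator_def)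
  moreover have "0 \<le> (\<integral>x. h x * (indicator (S m) x * indicator ?N (x 0)) \<partial>leb n) / \<nu> m ^ (n - 1)" for m
  proof (rule divide_nonneg_nonneg)
    show "0 \<le> (\<integral>x. h x * (indicator (S m) x * indicator ?N (x 0)) \<partial>leb n)"
      by (rule integral_nonneg_AE) (use h in \<open>eventually_elim; simp\<close>)
  qed (use \<nu>_pos[of m] in simp)
  ultimately have "0 \<le> (\<integral>p. H (fst p) * (indicator ?C p * indicator ?N (fst p)) \<partial>?M)"
    by (intro LIMSEQ_le_const) auto
  also have "\<dots> = (\<integral>p. H (fst p) * indicator ?N (fst p) * indicator ?C p \<partial>?M)"
    by (simp only: mult_ac)
  also have "\<dots> = cell_volume n * (\<integral>t. H t * indicator ?N t \<partial>unit_interval)"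
    using negative.integral_cells[of "\<lambda>_. 1"] by simp
  finally have ge: "0 \<le> (\<integral>t. H t * indicator ?N t \<partial>unit_interval)"
    using cell_volume_pos[OF n] by (simp add: zero_le_mult_iff)
  have nonneg: "AE t in unit_interval. 0 \<le> - (H t * indicator ?N t)"
    by (rule AE_I2) (simp add: indicator_def)
  have "(\<integral>t. - (H t * indicator ?N t) \<partial>unit_interval) = 0"
    using ge integral_nonneg_AE[OF nonneg] by simp
  then have "AE t in unit_interval. - (H t * indicator ?N t) = 0"
    using integral_nonneg_eq_0_iff_AE[OF integrable_minus[OF int] nonneg] by simp
  then show ?thesis using AE_space by eventually_elim (auto simp: indicator_def split: if_splits)
qed

end

locale synchronising_map = coupled_map q A T n \<gamma> + diagonal_density n H h \<nu>
  for q :: nat and A :: "nat \<Rightarrow> real set" and T :: "real \<Rightarrow> real" and n :: nat and \<gamma> :: real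
    and h :: "(nat \<Rightarrow> real) \<Rightarrow> real" and H :: "real \<Rightarrow> real" and \<nu> :: "nat \<Rightarrow> real"
begin

text \<open>
  For almost every \<open>(t, y)\<close> the integrand vanishes for large \<open>m\<close>: a point that has left the
  synchronisation set after the first step is not back after any fixed number of further steps.
\<close>

lemma late_return_limit:
  "(\<lambda>m. (\<integral>x. h x * (indicator (S m) x * first_hit Th (S m) (Suc k) (Th x)) \<partial>leb n) / \<nu> m ^ (n - 1)) \<longlonglongrightarrow> 0"
proof -
  let ?M = "unit_interval \<Otimes>\<^sub>M fiber n"
  have "(\<lambda>m. (\<integral>x. h x * (indicator (S m) x * first_hit Th (S m) (Suc k) (Th x)) \<partial>leb n) / \<nu> m ^ (n - 1))
      \<longlonglongrightarrow> (\<integral>p. H (fst p) * 0 \<partial>?M)"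
  proof (rule diagonal_limit)
    show "(\<lambda>x. first_hit Th (S m) (Suc k) (Th x)) \<in> borel_measurable (leb n)" for m
      by (rule measurable_compose[OF measurable_cml measurable_first_hit[OF measurable_cml S_measurable]])
    show "\<bar>first_hit Th (S m) (Suc k) (Th x)\<bar> \<le> 1" for m x by (rule first_hit_bound)
    show "AE p in ?M. (\<lambda>m. indicator (S m) (fan n (\<nu> m) p) * first_hit Th (S m) (Suc k) (Th (fan n (\<nu> m) p))) \<longlonglongrightarrow> 0"
      using AE_unit_fiber_fst[OF AE_unit_interior] AE_unit_fiber_fst[OF AE_regular]
    proof eventually_elim
      case (elim p)
      obtain t y where ty: "p = (t, y)" by (cases p)
      have t: "0 < t" "t < 1" "t \<in> regular_points" using elim ty by auto
      let ?X = "\<lambda>m. fan n (\<nu> m) p"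
      have X: "(\<lambda>m. ?X m i) \<longlonglongrightarrow> t" if "i < n" for i
        unfolding ty by (rule fan_tendsto[OF t(1,2) \<nu>_tendsto that])
      have "\<forall>\<^sub>F m in sequentially. sync_dist n (Th (?X m)) \<le> sync_dist n ((Th ^^ Suc (Suc k)) (?X m))"
        by (rule eventually_never_resynchronises[OF _ t(3)]) (rule X)
      then have "\<forall>\<^sub>F m in sequentially. first_hit Th (S m) (Suc k) (Th (?X m)) = 0"
      proof eventually_elim
        fix m assume le: "sync_dist n (Th (?X m)) \<le> sync_dist n ((Th ^^ Suc (Suc k)) (?X m))"
        show "first_hit Th (S m) (Suc k) (Th (?X m)) = 0"
        proof (rule ccontr)
          assume nz: "first_hit Th (S m) (Suc k) (Th (?X m)) \<noteq> 0"
          then have "Th (?X m) \<notin> S m" by (auto simp: indicator_def split: if_splits)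
          moreover have "Th (?X m) \<in> unit_cube n"
            unfolding ty using t by (intro cml_unit_cube fan_in_unit_cube) auto
          moreover have "(Th ^^ Suc (Suc k)) (?X m) \<in> S m"
            using first_hit_nonzero[OF nz] by (simp add: funpow_swap1)
          ultimately show False using le unfolding sync_set_def by simp
        qed
      qed
      then have "\<forall>\<^sub>F m in sequentially. indicator (S m) (?X m) * first_hit Th (S m) (Suc k) (Th (?X m)) = 0"
        by eventually_elim (simp only: mult_zero_right)
      then show ?case by (rule tendsto_eventually)
    qed
  qed simp
  then show ?thesis by simp
qed

lemma difference_quotient_limit:
  assumes "t \<in> smooth_points"
  shows "(\<lambda>m. (T (t + \<nu> m * s) - T t) / \<nu> m) \<longlonglongrightarrow> deriv T t * s"
proof -
  have "((\<lambda>r. T (t + r * s)) has_real_derivative deriv T t * s) (at 0)"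
  proof (rule DERIV_chain2[where f = T])
    show "((\<lambda>r. t + r * s) has_real_derivative s) (at 0)" by (auto intro!: derivative_eq_intros)
    show "(T has_real_derivative deriv T t) (at (t + 0 * s))" using T_has_derivative[OF assms] by simp
  qed
  then have "((\<lambda>r. (T (t + r * s) - T t) / r) \<longlongrightarrow> deriv T t * s) (at 0)"
    by (simp add: DERIV_def)
  moreover have "filterlim \<nu> (at 0) sequentially"
    using \<nu>_tendsto \<nu>_pos by (intro filterlim_atI) (auto simp: less_imp_neq[symmetric])
  ultimately show ?thesis by (rule filterlim_compose)
qed

text \<open>
  After division by \<open>\<nu>\<close> the gaps of the image converge to \<open>d = (1 - \<gamma>) * \<bar>T' t\<bar>\<close> times the gaps of
  \<open>(0, y)\<close>. So the image is eventually synchronised if the spread is smaller than \<open>1 / d\<close> and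
  eventually not if it is larger; in the first case the point itself is synchronised too, as
  \<open>1 / d < 1\<close>.
\<close>

lemma early_return_pointwise:
  assumes t: "0 < t" "t < 1" "t \<in> smooth_points"
    and y: "rel_spread n y \<noteq> inverse_slope t / (1 - \<gamma>)"
    and \<gamma>: "\<gamma> < 1" and lt: "inverse_slope t / (1 - \<gamma>) < 1"
  shows "\<forall>\<^sub>F m in sequentially. fan n (\<nu> m) (t, y) \<in> S m \<and> Th (fan n (\<nu> m) (t, y)) \<in> S m
    \<longleftrightarrow> rel_spread n y \<le> inverse_slope t / (1 - \<gamma>)"
proof -
  let ?X = "\<lambda>m. fan n (\<nu> m) (t, y)" and ?y = "y(0 := 0)"
  define g where "g i j m = \<bar>Th (?X m) i - Th (?X m) j\<bar> / \<nu> m" for i j m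
  define d where "d = (1 - \<gamma>) * \<bar>deriv T t\<bar>"
  have dT: "0 < \<bar>deriv T t\<bar>" using branch(7) t(3) unfolding smooth_points_def by force
  then have d: "0 < d" "inverse_slope t / (1 - \<gamma>) = 1 / d"
    using \<gamma> t(3) unfolding d_def by (auto simp: inverse_slope_def)
  have fits: "\<forall>\<^sub>F m in sequentially. fits n (\<nu> m) (t, y) \<noteq> 0"
    using eventually_fits[OF t(1,2) \<nu>_tendsto, of n y] by eventually_elim simp
  have cube: "?X m \<in> unit_cube n" "Th (?X m) \<in> unit_cube n" for m
    using t by (auto intro!: cml_unit_cube fan_in_unit_cube)
  have gap_limit: "g i j \<longlonglongrightarrow> d * \<bar>?y i - ?y j\<bar>" if "i < n" "j < n" for i j
  proof -
    have "(\<lambda>m. (1 - \<gamma>) * \<bar>(T (t + \<nu> m * ?y i) - T t) / \<nu> m - (T (t + \<nu> m * ?y j) - T t) / \<nu> m\<bar>)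
        \<longlonglongrightarrow> (1 - \<gamma>) * \<bar>deriv T t * ?y i - deriv T t * ?y j\<bar>"
      by (intro tendsto_intros difference_quotient_limit t(3))
    moreover have "\<forall>\<^sub>F m in sequentially.
        (1 - \<gamma>) * \<bar>(T (t + \<nu> m * ?y i) - T t) / \<nu> m - (T (t + \<nu> m * ?y j) - T t) / \<nu> m\<bar> = g i j m"
      using fits
    proof eventually_elim
      case (elim m)
      have "g i j m = \<bar>(1 - \<gamma>) * (T (t + \<nu> m * ?y i) - T (t + \<nu> m * ?y j))\<bar> / \<nu> m"
        using fan_apply[OF elim that(1)] fan_apply[OF elim that(2)] unfolding g_def cml_gap[OF that] by simp
      also have "\<dots> = (1 - \<gamma>) * \<bar>(T (t + \<nu> m * ?y i) - T (t + \<nu> m * ?y j)) / \<nu> m\<bar>"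
        using \<gamma> \<nu>_pos[of m] by (simp add: abs_mult)
      finally show ?case by (simp add: diff_divide_distrib)
    qed
    ultimately have "g i j \<longlonglongrightarrow> (1 - \<gamma>) * \<bar>deriv T t * ?y i - deriv T t * ?y j\<bar>"
      by (rule Lim_transform_eventually)
    moreover have "(1 - \<gamma>) * \<bar>deriv T t * ?y i - deriv T t * ?y j\<bar> = d * \<bar>?y i - ?y j\<bar>"
      unfolding d_def by (simp only: right_diff_distrib[symmetric] abs_mult mult.assoc)
    ultimately show ?thesis by (simp only:)
  qed
  have in_S: "Th (?X m) \<in> S m \<longleftrightarrow> (\<forall>i\<in>{..<n}. \<forall>j\<in>{..<n}. i \<noteq> j \<longrightarrow> g i j m \<le> 1)" for m
    using cube(2)[of m] \<nu>_pos[of m] unfolding sync_set_def g_def by (auto simp: sync_dist_le_iff[OF n])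
  show ?thesis
  proof (cases "rel_spread n y \<le> 1 / d")
    case True
    then have less: "rel_spread n y < 1 / d" using y d(2) by simp
    have "\<forall>\<^sub>F m in sequentially. g i j m \<le> 1" if "i < n" "j < n" "i \<noteq> j" for i j
    proof -
      have "\<bar>?y i - ?y j\<bar> < 1 / d"
        using less sync_dist_less_iff[OF n] that unfolding rel_spread_def by blast
      then have "d * \<bar>?y i - ?y j\<bar> < 1" using d(1) by (simp add: field_simps)
      from order_tendstoD(2)[OF gap_limit[OF that(1,2)] this] show ?thesis by eventually_elim simp
    qed
    then have "\<forall>\<^sub>F m in sequentially. \<forall>i\<in>{..<n}. \<forall>j\<in>{..<n}. i \<noteq> j \<longrightarrow> g i j m \<le> 1"
    proof (intro eventually_ball_finite ballI finite_lessThan)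
      fix i j assume "i \<in> {..<n}" "j \<in> {..<n}"
      then show "\<forall>\<^sub>F m in sequentially. i \<noteq> j \<longrightarrow> g i j m \<le> 1"
        using \<open>\<And>j i. i < n \<Longrightarrow> j < n \<Longrightarrow> i \<noteq> j \<Longrightarrow> \<forall>\<^sub>F m in sequentially. g i j m \<le> 1\<close>[of i j]
        by (cases "i = j") auto
    qed
    then show ?thesis
      using fits
    proof eventually_elim
      case (elim m)
      have "rel_spread n y \<le> 1" using less lt d(2) by simp
      then have "?X m \<in> S m"
        using sync_dist_fan[OF n \<nu>_pos elim(2)] cube(1)[of m] \<nu>_pos[of m] unfolding sync_set_def by simp
      then show ?case using elim(1) True unfolding in_S d(2) by blast
    qed
  next
    case False
    then obtain i j where ij: "i < n" "j < n" "i \<noteq> j" "1 / d < \<bar>?y i - ?y j\<bar>"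
      unfolding rel_spread_le_iff[OF n] by (auto simp: not_le)
    then have "1 < d * \<bar>?y i - ?y j\<bar>" using d(1) by (simp add: field_simps)
    from order_tendstoD(1)[OF gap_limit[OF ij(1,2)] this] show ?thesis
    proof eventually_elim
      case (elim m)
      then have "Th (?X m) \<notin> S m" using ij unfolding in_S by (auto simp: not_le)
      then show ?case using False d(2) by simp
    qed
  qed
qed

lemma early_return_limit:
  "(\<lambda>m. (\<integral>x. h x * (indicator (S m) x * indicator (S m) (Th x)) \<partial>leb n) / \<nu> m ^ (n - 1))
    \<longlonglongrightarrow> cell_volume n * (\<integral>t. H t * (inverse_slope t / (1 - \<gamma>)) ^ (n - 1) \<partial>unit_interval)"
proof -
  let ?M = "unit_interval \<Otimes>\<^sub>M fiber n"
  let ?\<rho> = "\<lambda>t. inverse_slope t / (1 - \<gamma>)"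
  let ?C = "{p \<in> space ?M. rel_spread n (snd p) \<le> ?\<rho> (fst p)}"
  note measurable_rel_spread[OF n, measurable]
  have \<rho> [measurable]: "?\<rho> \<in> borel_measurable unit_interval"
    using measurable_inverse_slope by (intro borel_measurable_divide) (auto intro: measurable_restrict_space1)
  obtain l where l: "0 < l" "l < 1 - \<gamma>" "\<And>x. inverse_slope x \<le> l"
    using inverse_slope_bound[OF contraction] by metis
  then have \<gamma>1: "\<gamma> < 1" by simp
  have less: "?\<rho> t < 1" for t
    using l(2) l(3)[of t] \<gamma>1 by simp
  have pos: "0 < ?\<rho> t" if "t \<in> smooth_points" for t
  proof -
    have "0 < \<bar>deriv T t\<bar>" using branch(7) that unfolding smooth_points_def by force
    then show ?thesis using that \<gamma>1 by (simp add: inverse_slope_def)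
  qed
  have smooth: "AE t in unit_interval. t \<in> smooth_points"
    using AE_regular by eventually_elim (use regular_points_smooth[where j = 0] in simp)
  have C [measurable]: "?C \<in> sets ?M"
    using measurable_compose[OF measurable_fst \<rho>] by measurable
  have neq: "AE p in ?M. rel_spread n (snd p) \<noteq> ?\<rho> (fst p)"
  proof (rule unit_fiber.AE_pair_measure)
    show "{p \<in> space ?M. rel_spread n (snd p) \<noteq> ?\<rho> (fst p)} \<in> sets ?M"
      using measurable_compose[OF measurable_fst \<rho>] by measurable
    show "AE t in unit_interval. AE y in fiber n. rel_spread n (snd (t, y)) \<noteq> ?\<rho> (fst (t, y))"
      using smooth by eventually_elim (simp only: fst_conv snd_conv, rule AE_rel_spread_neq[OF n pos])
  qed
  have "(\<lambda>m. (\<integral>x. h x * (indicator (S m) x * indicator (S m) (Th x)) \<partial>leb n) / \<nu> m ^ (n - 1))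
      \<longlonglongrightarrow> (\<integral>p. H (fst p) * indicator ?C p \<partial>?M)"
  proof (rule diagonal_limit)
    show "(\<lambda>x. indicator (S m) (Th x) :: real) \<in> borel_measurable (leb n)" for m
      by (rule measurable_compose[OF measurable_cml]) simp
    show "\<bar>indicator (S m) (Th x) :: real\<bar> \<le> 1" for m x by (simp add: indicator_def)
    show "AE p in ?M. (\<lambda>m. indicator (S m) (fan n (\<nu> m) p) * indicator (S m) (Th (fan n (\<nu> m) p)))
        \<longlonglongrightarrow> (indicator ?C p :: real)"
      using AE_unit_fiber_fst[OF AE_unit_interior] AE_unit_fiber_fst[OF smooth] neq AE_space
    proof eventually_elim
      case (elim p)
      obtain t y where ty: "p = (t, y)" by (cases p)
      have "\<forall>\<^sub>F m in sequentially. fan n (\<nu> m) (t, y) \<in> S m \<and> Th (fan n (\<nu> m) (t, y)) \<in> S m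
          \<longleftrightarrow> rel_spread n y \<le> ?\<rho> t"
        using elim less \<gamma>1 unfolding ty by (intro early_return_pointwise) (auto simp: space_pair_measure)
      then have "\<forall>\<^sub>F m in sequentially.
          indicator (S m) (fan n (\<nu> m) p) * indicator (S m) (Th (fan n (\<nu> m) p)) = (indicator ?C p :: real)"
        by eventually_elim (use elim(4) in \<open>auto simp: ty indicator_def\<close>)
      then show ?case by (rule tendsto_eventually)
    qed
  qed simp
  moreover have "AE t in unit_interval. 0 < ?\<rho> t" using smooth by eventually_elim (rule pos)
  ultimately show ?thesis using integral_cells[OF \<rho> less_imp_le[OF less]] by simp
qed

end

section \<open>Continuous densities\<close>

lemma measurable_diag_point: "diag_point n \<in> unit_interval \<rightarrow>\<^sub>M leb n"
  unfolding diag_point_def leb_def by (rule measurable_restrict) simp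

lemma diag_point_in_unit_cube: "t \<in> {0..1} \<Longrightarrow> diag_point n t \<in> unit_cube n"
  unfolding diag_point_def unit_cube_def by auto

lemma emeasure_leb_box_pos:
  assumes "0 < \<delta>" and "t \<in> {0..1}"
  shows "{x \<in> unit_cube n. \<forall>i<n. \<bar>x i - t\<bar> < \<delta>} \<in> sets (leb n)"
    and "0 < emeasure (leb n) {x \<in> unit_cube n. \<forall>i<n. \<bar>x i - t\<bar> < \<delta>}"
proof -
  let ?I = "{t - \<delta><..<t + \<delta>} \<inter> {0..1}"
  have eq: "{x \<in> unit_cube n. \<forall>i<n. \<bar>x i - t\<bar> < \<delta>} = (\<Pi>\<^sub>E i\<in>{..<n}. ?I)"
  proof -
    have *: "\<bar>s - t\<bar> < \<delta> \<longleftrightarrow> s \<in> {t - \<delta><..<t + \<delta>}" for s by auto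
    show ?thesis unfolding unit_cube_def
      by (rule set_eqI) (simp only: mem_Collect_eq * PiE_iff Int_iff lessThan_iff, blast)
  qed
  have I: "?I \<in> sets unit_interval" by (auto simp: sets_restrict_space)
  show "{x \<in> unit_cube n. \<forall>i<n. \<bar>x i - t\<bar> < \<delta>} \<in> sets (leb n)"
    unfolding eq leb_def using I by (intro sets_PiM_I_finite) auto
  let ?a = "max 0 (t - \<delta> / 2)" and ?b = "min 1 (t + \<delta> / 2)"
  have "0 < ennreal (?b - ?a)" using assms by (auto simp: max_def min_def)
  also have "\<dots> = emeasure lborel {?a..?b}" using assms by (subst emeasure_lborel_Icc) (auto simp: max_def min_def)
  also have "\<dots> \<le> emeasure lborel ?I" using assms by (intro emeasure_mono) auto
  also have "\<dots> = emeasure unit_interval ?I" by (simp add: emeasure_restrict_space)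
  finally have "emeasure unit_interval ?I \<noteq> 0" by simp
  then have "(\<Prod>i\<in>{..<n}. emeasure unit_interval ?I) \<noteq> 0" by simp
  moreover have "emeasure (leb n) (\<Pi>\<^sub>E i\<in>{..<n}. ?I) = (\<Prod>i\<in>{..<n}. emeasure unit_interval ?I)"
    unfolding leb_def by (rule unit_product.emeasure_PiM) (rule finite_lessThan, rule I)
  ultimately show "0 < emeasure (leb n) {x \<in> unit_cube n. \<forall>i<n. \<bar>x i - t\<bar> < \<delta>}"
    unfolding eq by (simp only: zero_less_iff_neq_zero not_False_eq_True)
qed

lemma diagonal_approximation_continuous:
  assumes n: "2 \<le> n" and P7: "prop_P7 n h" and h: "integrable (leb n) h"
    and \<nu>_pos: "\<And>m. 0 < \<nu> m" and \<nu>: "\<nu> \<longlonglongrightarrow> 0"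
  shows "integrable unit_interval (\<lambda>t. h (diag_point n t))"
    and "(\<lambda>m. (\<integral>x. indicator (sync_set n (\<nu> m)) x * \<bar>h x - h (diag_point n (x 0))\<bar> \<partial>leb n) / \<nu> m ^ (n - 1)) \<longlonglongrightarrow> 0"
proof -
  let ?X = "powertop_real {..<n}" and ?M = "unit_interval \<Otimes>\<^sub>M fiber n"
  have [measurable]: "h \<in> borel_measurable (leb n)" using h by blast
  have cont: "continuous_map (subtopology ?X (unit_cube n)) euclideanreal h"
    using P7 unfolding prop_P7_def .
  have "compactin ?X (unit_cube n)"
    unfolding unit_cube_def by (simp add: compactin_PiE)
  then have "compact (h ` unit_cube n)"
    using image_compactin[OF _ cont] by (simp add: compactin_subtopology)
  then have "bounded (h ` unit_cube n)" by (rule compact_imp_bounded)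
  then obtain c where "\<forall>s\<in>h ` unit_cube n. norm s \<le> c" unfolding bounded_iff by blast
  then have c: "\<bar>h x\<bar> \<le> c" if "x \<in> unit_cube n" for x using that by simp
  have hd [measurable]: "(\<lambda>t. h (diag_point n t)) \<in> borel_measurable unit_interval"
    by (rule measurable_compose[OF measurable_diag_point]) measurable
  show int: "integrable unit_interval (\<lambda>t. h (diag_point n t))"
  proof (rule finite_measure.integrable_const_bound[where B = c])
    show "finite_measure unit_interval"
      using prob_space_unit_interval by (rule prob_space.finite_measure)
    show "AE t in unit_interval. norm (h (diag_point n t)) \<le> c"
      by (rule AE_I2) (use c diag_point_in_unit_cube in \<open>auto simp: space_restrict_space\<close>)
  qed (rule hd)
  \<comment> \<open>Continuity in the product topology is tested along sequences that converge coordinatewise.\<close>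
  have seq: "(\<lambda>m. h (X m)) \<longlonglongrightarrow> h (diag_point n t)"
    if X: "\<And>m. X m \<in> unit_cube n" and t: "t \<in> {0..1}" and lim: "\<And>i. i < n \<Longrightarrow> (\<lambda>m. X m i) \<longlonglongrightarrow> t" for X t
  proof -
    have "limitin ?X X (diag_point n t) sequentially"
      unfolding limitin_componentwise
    proof (intro conjI ballI)
      have "X m \<in> topspace ?X" for m using X[of m] unfolding unit_cube_def by (simp add: PiE_iff)
      then show "\<forall>\<^sub>F m in sequentially. X m \<in> topspace ?X" by (intro always_eventually allI)
      fix i assume "i \<in> {..<n}"
      then show "limitin euclideanreal (\<lambda>m. X m i) (diag_point n t i) sequentially"
        using lim[of i] by (simp add: diag_point_def)
    qed (simp add: diag_point_def)
    then have "limitin (subtopology ?X (unit_cube n)) X (diag_point n t) sequentially"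
      using X diag_point_in_unit_cube[OF t] by (simp add: limitin_subtopology)
    from continuous_map_limit[OF cont this] show ?thesis by (simp add: o_def)
  qed
  have n0: "0 < n" using n by simp
  have [measurable]: "sync_set n r \<in> sets (leb n)" for r by (rule sync_set_measurable[OF n])
  let ?g = "\<lambda>m x. indicator (sync_set n (\<nu> m)) x * \<bar>h x - h (diag_point n (x 0))\<bar>"
  have g: "?g m \<in> borel_measurable (leb n)" for m
    using measurable_compose[OF leb_coordinate[OF n0] hd] by measurable
  have fan0: "fan n (\<nu> m) p 0 = fst p" for m p using n0 by (simp add: fan_def case_prod_beta')
  have "(\<integral>x. ?g m x \<partial>leb n) / \<nu> m ^ (n - 1) = (\<integral>p. fits n (\<nu> m) p * ?g m (fan n (\<nu> m) p) \<partial>?M)" for m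
  proof -
    have "(\<integral>x. ?g m x \<partial>leb n) = (\<integral>p. \<nu> m ^ (n - 1) * fits n (\<nu> m) p * ?g m (fan n (\<nu> m) p) \<partial>?M)"
      by (rule integral_leb_fan[OF n0 \<nu>_pos g])
    also have "\<dots> = \<nu> m ^ (n - 1) * (\<integral>p. fits n (\<nu> m) p * ?g m (fan n (\<nu> m) p) \<partial>?M)"
      by (simp only: mult.assoc Bochner_Integration.integral_mult_right_zero)
    finally show ?thesis using \<nu>_pos[of m] by simp
  qed
  moreover have "(\<lambda>m. \<integral>p. fits n (\<nu> m) p * ?g m (fan n (\<nu> m) p) \<partial>?M) \<longlonglongrightarrow> (\<integral>p. 0 \<partial>?M)"
  proof (rule integral_dominated_convergence)
    interpret const_profile: diagonal_profile n "\<lambda>_. 2 * c"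
    proof
      show "integrable unit_interval (\<lambda>_. 2 * c)"
        using prob_space.finite_measure[OF prob_space_unit_interval] by (rule finite_measure.integrable_const)
    qed (rule n)
    show "integrable ?M (\<lambda>p. \<bar>2 * c\<bar> * indicator (unit_box n) (snd p))"
      by (rule const_profile.integrable_dominating)
    show "(\<lambda>p. fits n (\<nu> m) p * ?g m (fan n (\<nu> m) p)) \<in> borel_measurable ?M" for m
      by (intro borel_measurable_times measurable_fits measurable_compose[OF measurable_fan g])
    show "AE p in ?M. (\<lambda>m. fits n (\<nu> m) p * ?g m (fan n (\<nu> m) p)) \<longlonglongrightarrow> 0"
      using AE_unit_fiber_fst[OF AE_unit_interior]
    proof eventually_elim
      case (elim p)
      obtain t y where ty: "p = (t, y)" by (cases p)
      have t: "0 < t" "t < 1" using elim ty by auto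
      have "(\<lambda>m. h (fan n (\<nu> m) (t, y))) \<longlonglongrightarrow> h (diag_point n t)"
        using t by (intro seq fan_in_unit_cube fan_tendsto[OF t \<nu>]) auto
      then have "(\<lambda>m. \<bar>h (fan n (\<nu> m) p) - h (diag_point n (fan n (\<nu> m) p 0))\<bar>) \<longlonglongrightarrow> \<bar>h (diag_point n t) - h (diag_point n t)\<bar>"
        unfolding fan0 ty fst_conv by (intro tendsto_intros)
      then have lim: "(\<lambda>m. \<bar>h (fan n (\<nu> m) p) - h (diag_point n (fan n (\<nu> m) p 0))\<bar>) \<longlonglongrightarrow> 0" by simp
      show ?case
      proof (rule Lim_null_comparison[OF _ lim], rule always_eventually, rule allI)
        fix m
        have "0 \<le> fits n (\<nu> m) p" "fits n (\<nu> m) p \<le> 1"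
          unfolding ty fits_cases by auto
        then show "norm (fits n (\<nu> m) p * ?g m (fan n (\<nu> m) p)) \<le> \<bar>h (fan n (\<nu> m) p) - h (diag_point n (fan n (\<nu> m) p 0))\<bar>"
          by (simp add: indicator_def abs_mult mult_left_le_one_le)
      qed
    qed
    show "AE p in ?M. norm (fits n (\<nu> m) p * ?g m (fan n (\<nu> m) p)) \<le> \<bar>2 * c\<bar> * indicator (unit_box n) (snd p)" for m
    proof (rule AE_I2)
      fix p assume p: "p \<in> space ?M"
      obtain t y where ty: "p = (t, y)" by (cases p)
      have t: "t \<in> {0..1}" "y \<in> space (fiber n)" using p by (auto simp: ty space_pair_measure space_restrict_space)
      show "norm (fits n (\<nu> m) p * ?g m (fan n (\<nu> m) p)) \<le> \<bar>2 * c\<bar> * indicator (unit_box n) (snd p)"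
      proof (cases "fits n (\<nu> m) p \<noteq> 0 \<and> fan n (\<nu> m) p \<in> sync_set n (\<nu> m)")
        case True
        then have "y \<in> unit_box n"
          using synchronised_in_box[OF n \<nu>_pos t(2)] unfolding ty by auto
        moreover have "fits n (\<nu> m) p = 1" using True unfolding ty fits_cases by (auto split: if_splits)
        moreover have "\<bar>h (fan n (\<nu> m) p)\<bar> \<le> c" "\<bar>h (diag_point n t)\<bar> \<le> c"
          unfolding ty using t c fan_in_unit_cube diag_point_in_unit_cube by auto
        ultimately show ?thesis using True unfolding fan0 ty by simp
      qed (auto simp: indicator_def)
    qed
  qed simp
  ultimately show "(\<lambda>m. (\<integral>x. ?g m x \<partial>leb n) / \<nu> m ^ (n - 1)) \<longlonglongrightarrow> 0" by simp
qed

section \<open>Densities of bounded oscillation\<close>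

lemma measurable_euclid_dist [measurable]: "(\<lambda>y. euclid_dist n x y) \<in> borel_measurable (leb n)"
  unfolding euclid_dist_def L2_set_def by measurable

lemma cube_ball_measurable [measurable]: "cube_ball n x r \<in> sets (leb n)"
  unfolding cube_ball_def space_leb[symmetric] by measurable

lemma AE_le_esssup_on:
  assumes [measurable]: "X \<in> sets (leb n)"
  shows "AE y in leb n. y \<in> X \<longrightarrow> ereal (f y) \<le> esssup_on n f X"
proof -
  have "AE y in restrict_space (leb n) X. ereal (f y) \<le> esssup_on n f X"
    unfolding esssup_on_def by (rule esssup_AE)
  then show ?thesis by (subst (asm) AE_restrict_space_iff) auto
qed

lemma esssup_on_le_iff:
  assumes X [measurable]: "X \<in> sets (leb n)" and f [measurable]: "f \<in> borel_measurable (leb n)"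
  shows "esssup_on n f X \<le> a \<longleftrightarrow> (AE y in leb n. y \<in> X \<longrightarrow> ereal (f y) \<le> a)"
proof
  assume "esssup_on n f X \<le> a"
  then show "AE y in leb n. y \<in> X \<longrightarrow> ereal (f y) \<le> a"
    using AE_le_esssup_on[OF X, of f] by (auto elim!: eventually_mono)
next
  assume "AE y in leb n. y \<in> X \<longrightarrow> ereal (f y) \<le> a"
  then have "AE y in restrict_space (leb n) X. ereal (f y) \<le> a"
    by (subst AE_restrict_space_iff) auto
  then show "esssup_on n f X \<le> a"
    unfolding esssup_on_def using f by (intro esssup_I) (auto intro!: measurable_restrict_space1)
qed

lemma esssup_on_mono:
  assumes "X \<subseteq> Y" "X \<in> sets (leb n)" "Y \<in> sets (leb n)" "f \<in> borel_measurable (leb n)"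
  shows "esssup_on n f X \<le> esssup_on n f Y"
  unfolding esssup_on_le_iff[OF assms(2,4)]
  using AE_le_esssup_on[OF assms(3), of f] by eventually_elim (use assms(1) in blast)

text \<open>
  The essential supremum over the ball is at most \<open>a\<close> iff a section of a measurable subset of the
  product is a null set; so measurability in the centre is a case of the Fubini--Tonelli theorem.
\<close>

lemma measurable_esssup_on:
  assumes f [measurable]: "f \<in> borel_measurable (leb n)"
  shows "(\<lambda>t. esssup_on n f (cube_ball n (diag_point n t) r)) \<in> borel_measurable unit_interval"
proof (rule borel_measurableI_le)
  fix a :: ereal
  have coord [measurable]: "(\<lambda>p. snd p i) \<in> borel_measurable (unit_interval \<Otimes>\<^sub>M leb n)" if "i \<in> {..<n}" for i
    using that by (intro measurable_compose[OF measurable_snd leb_coordinate_real]) auto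
  have dist [measurable]: "(\<lambda>p. L2_set (\<lambda>i. fst p - snd p i) {..<n}) \<in> borel_measurable (unit_interval \<Otimes>\<^sub>M leb n)"
    unfolding L2_set_def by measurable
  have [measurable]: "(\<lambda>p. f (snd p)) \<in> borel_measurable (unit_interval \<Otimes>\<^sub>M leb n)"
    by (rule measurable_compose[OF measurable_snd f])
  let ?Q = "{p \<in> space (unit_interval \<Otimes>\<^sub>M leb n). L2_set (\<lambda>i. fst p - snd p i) {..<n} < r \<and> \<not> ereal (f (snd p)) \<le> a}"
  have Q: "?Q \<in> sets (unit_interval \<Otimes>\<^sub>M leb n)" by measurable
  have "esssup_on n f (cube_ball n (diag_point n t) r) \<le> a \<longleftrightarrow> emeasure (leb n) (Pair t -` ?Q) = 0"
    if t: "t \<in> space unit_interval" for t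
  proof -
    have "euclid_dist n (diag_point n t) y = L2_set (\<lambda>i. t - y i) {..<n}" for y
      unfolding euclid_dist_def by (rule L2_set_cong) (simp_all add: diag_point_def)
    then have "Pair t -` ?Q = {y \<in> space (leb n). \<not> (y \<in> cube_ball n (diag_point n t) r \<longrightarrow> ereal (f y) \<le> a)}"
      using t by (auto simp: space_pair_measure cube_ball_def space_leb)
    moreover have "Pair t -` ?Q \<in> sets (leb n)" using Q by (rule sets_Pair1)
    ultimately show ?thesis
      unfolding esssup_on_le_iff[OF cube_ball_measurable f] by (subst AE_iff_measurable) auto
  qed
  then have "{t \<in> space unit_interval. esssup_on n f (cube_ball n (diag_point n t) r) \<le> a}
      = {t \<in> space unit_interval. emeasure (leb n) (Pair t -` ?Q) = 0}" by blast
  also have "\<dots> \<in> sets unit_interval"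
    using leb.measurable_emeasure_Pair[OF Q] by measurable
  finally show "{t \<in> space unit_interval. esssup_on n f (cube_ball n (diag_point n t) r) \<le> a} \<in> sets unit_interval" .
qed

lemma euclid_dist_triangle: "euclid_dist n x z \<le> euclid_dist n x y + euclid_dist n y z"
  unfolding euclid_dist_def
  using L2_set_triangle_ineq[of "\<lambda>i. x i - y i" "\<lambda>i. y i - z i" "{..<n}"] by simp

lemma euclid_dist_le:
  assumes "\<And>i. i < n \<Longrightarrow> \<bar>x i - y i\<bar> \<le> d" shows "euclid_dist n x y \<le> real n * d"
proof -
  have "euclid_dist n x y \<le> (\<Sum>i<n. \<bar>x i - y i\<bar>)"
    unfolding euclid_dist_def by (rule L2_set_le_sum_abs)
  also have "\<dots> \<le> (\<Sum>i<n. d)" by (rule sum_mono) (use assms in simp)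
  finally show ?thesis by simp
qed

lemma diagonal_ball_mono:
  assumes "real n * \<bar>t - t'\<bar> + r \<le> r'"
  shows "cube_ball n (diag_point n t) r \<subseteq> cube_ball n (diag_point n t') r'"
proof
  fix y assume y: "y \<in> cube_ball n (diag_point n t) r"
  have "euclid_dist n (diag_point n t') (diag_point n t) \<le> real n * \<bar>t - t'\<bar>"
    by (rule euclid_dist_le) (simp add: diag_point_def abs_minus_commute)
  then have "euclid_dist n (diag_point n t') y < r'"
    using y assms euclid_dist_triangle[of n "diag_point n t'" y "diag_point n t"] unfolding cube_ball_def by simp
  then show "y \<in> cube_ball n (diag_point n t') r'" using y unfolding cube_ball_def by simp
qed

lemma e2ennreal_ereal_nonneg: "0 \<le> r \<Longrightarrow> e2ennreal (ereal r) = ennreal r"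
  using e2ennreal_enn2ereal[of "ennreal r"] by (simp add: enn2ereal_ennreal)

locale bounded_function =
  fixes n :: nat and h :: "(nat \<Rightarrow> real) \<Rightarrow> real" and c :: real
  assumes n: "2 \<le> n" and h [measurable]: "h \<in> borel_measurable (leb n)"
    and bound: "AE x in leb n. \<bar>h x\<bar> \<le> c"
begin

abbreviation "diag_ball r t \<equiv> cube_ball n (diag_point n t) r"

definition upper :: "real \<Rightarrow> real \<Rightarrow> real"
  where "upper r t = real_of_ereal (esssup_on n h (diag_ball r t))"

definition lower :: "real \<Rightarrow> real \<Rightarrow> real"
  where "lower r t = real_of_ereal (essinf_on n h (diag_ball r t))"

text \<open>
  A measurable version of \<open>diag_limit\<close>. The upper bounds decrease as the radius shrinks, hence the limit
  exists at every \<open>t\<close> in the unit interval, also where the oscillation does not vanish.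
\<close>

definition diag_value :: "real \<Rightarrow> real"
  where "diag_value t = lim (\<lambda>k. upper (1 / real (Suc k)) t)"

lemma measurable_minus_h [measurable]: "(\<lambda>y. - h y) \<in> borel_measurable (leb n)" by measurable

lemma measurable_upper [measurable]: "upper r \<in> borel_measurable unit_interval"
  unfolding upper_def[abs_def] by (rule borel_measurable_real_of_ereal[OF measurable_esssup_on[OF h]])

lemma measurable_lower [measurable]: "lower r \<in> borel_measurable unit_interval"
  unfolding lower_def[abs_def] essinf_on_def
  using measurable_esssup_on[OF measurable_minus_h, of r] unfolding esssup_on_def
  by (intro borel_measurable_real_of_ereal borel_measurable_uminus_ereal)

lemma measurable_diag_value [measurable]: "diag_value \<in> borel_measurable unit_interval"
  unfolding diag_value_def[abs_def] by (rule borel_measurable_lim_metric) (rule measurable_upper)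

lemma essinf_on_esssup: "essinf_on n h X = - esssup_on n (\<lambda>y. - h y) X"
  unfolding essinf_on_def esssup_on_def by simp

lemma diag_ball_pos:
  assumes "0 < r" "t \<in> {0..1}" shows "0 < emeasure (leb n) (diag_ball r t)"
proof -
  have "{x \<in> unit_cube n. \<forall>i<n. \<bar>x i - t\<bar> < r / (2 * real n)} \<subseteq> diag_ball r t"
  proof
    fix x assume x: "x \<in> {x \<in> unit_cube n. \<forall>i<n. \<bar>x i - t\<bar> < r / (2 * real n)}"
    have "euclid_dist n (diag_point n t) x \<le> real n * (r / (2 * real n))"
    proof (rule euclid_dist_le)
      fix i assume "i < n"
      then have "\<bar>x i - t\<bar> < r / (2 * real n)" using x by blast
      then show "\<bar>diag_point n t i - x i\<bar> \<le> r / (2 * real n)"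
        using \<open>i < n\<close> by (simp add: diag_point_def abs_minus_commute)
    qed
    also have "\<dots> < r" using assms n by simp
    finally show "x \<in> diag_ball r t" using x unfolding cube_ball_def by simp
  qed
  then have "emeasure (leb n) {x \<in> unit_cube n. \<forall>i<n. \<bar>x i - t\<bar> < r / (2 * real n)} \<le> emeasure (leb n) (diag_ball r t)"
    by (rule emeasure_mono) simp
  moreover have "0 < emeasure (leb n) {x \<in> unit_cube n. \<forall>i<n. \<bar>x i - t\<bar> < r / (2 * real n)}"
    using assms n by (intro emeasure_leb_box_pos) auto
  ultimately show ?thesis by (rule less_le_trans[rotated])
qed

text \<open>
  Balls about diagonal points have positive measure, so they contain a point at which all three almost
  sure bounds hold. This yields finiteness and the order of the two bounds.
\<close>

lemma ess_bounds:
  assumes r: "0 < r" and t: "t \<in> {0..1}"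
  shows "esssup_on n h (diag_ball r t) = ereal (upper r t)" (is ?U)
    and "essinf_on n h (diag_ball r t) = ereal (lower r t)" (is ?L)
    and "lower r t \<le> upper r t" and "\<bar>upper r t\<bar> \<le> c"
proof -
  let ?u = "esssup_on n h (diag_ball r t)" and ?l = "essinf_on n h (diag_ball r t)"
  have AEu: "AE y in leb n. y \<in> diag_ball r t \<longrightarrow> ereal (h y) \<le> ?u"
    by (rule AE_le_esssup_on) simp
  have AEl: "AE y in leb n. y \<in> diag_ball r t \<longrightarrow> ereal (- h y) \<le> esssup_on n (\<lambda>y. - h y) (diag_ball r t)"
    by (rule AE_le_esssup_on) simp
  have ex: "\<exists>y. ?l \<le> ereal (h y) \<and> ereal (h y) \<le> ?u \<and> \<bar>h y\<bar> \<le> c"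
  proof (rule ccontr)
    assume no: "\<not> ?thesis"
    have "AE y in leb n. y \<notin> diag_ball r t"
      using AEu AEl bound
    proof eventually_elim
      case (elim y)
      show ?case
      proof
        assume y: "y \<in> diag_ball r t"
        then have "?l \<le> ereal (h y)"
          using elim(2) unfolding essinf_on_esssup by (metis ereal_minus_le_minus ereal_uminus_uminus uminus_ereal.simps(1))
        then show False using elim y no by blast
      qed
    qed
    then have "diag_ball r t \<in> null_sets (leb n)" by (subst AE_iff_null_sets) auto
    then show False using diag_ball_pos[OF r t] by auto
  qed
  then obtain y where y: "?l \<le> ereal (h y)" "ereal (h y) \<le> ?u" "\<bar>h y\<bar> \<le> c" by blast
  have up: "?u \<le> ereal c"
    unfolding esssup_on_le_iff[OF cube_ball_measurable h] using bound by eventually_elim (simp add: abs_le_iff)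
  have low: "- ereal c \<le> ?l"
  proof -
    have "esssup_on n (\<lambda>y. - h y) (diag_ball r t) \<le> ereal c"
      unfolding esssup_on_le_iff[OF cube_ball_measurable measurable_minus_h]
      using bound by eventually_elim (simp add: abs_le_iff)
    then show ?thesis unfolding essinf_on_esssup by (simp only: ereal_minus_le_minus)
  qed
  show U: ?U unfolding upper_def using up y(2) by (cases ?u) auto
  show L: ?L unfolding lower_def using low y(1) by (cases ?l) auto
  show "lower r t \<le> upper r t" using y(1,2) unfolding U L by (simp del: ereal_less_eq(3) add: order_trans ereal_less_eq(3)[symmetric])
  have "- c \<le> upper r t" using y(2,3) unfolding U by (simp add: abs_le_iff)
  then show "\<bar>upper r t\<bar> \<le> c" using up unfolding U by (simp add: abs_le_iff)
qed

lemma osc_diag_ball: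
  assumes "0 < r" "t \<in> {0..1}"
  shows "osc n h (diag_ball r t) = ennreal (upper r t - lower r t)"
  unfolding osc_def ess_bounds(1,2)[OF assms] using ess_bounds(3)[OF assms]
  by (simp add: e2ennreal_ereal_nonneg)

lemma bounds_nested:
  assumes "0 < r" "t \<in> {0..1}" "t' \<in> {0..1}" and le: "real n * \<bar>t - t'\<bar> + r \<le> r'"
  shows "upper r t \<le> upper r' t'" and "lower r' t' \<le> lower r t"
proof -
  have "0 \<le> real n * \<bar>t - t'\<bar>" by simp
  then have r': "0 < r'" using assms(1) le by linarith
  note sub = diagonal_ball_mono[OF le]
  have "esssup_on n h (diag_ball r t) \<le> esssup_on n h (diag_ball r' t')"
    by (rule esssup_on_mono[OF sub]) auto
  then show "upper r t \<le> upper r' t'"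
    unfolding ess_bounds(1)[OF assms(1,2)] ess_bounds(1)[OF r' assms(3)] by simp
  have "esssup_on n (\<lambda>y. - h y) (diag_ball r t) \<le> esssup_on n (\<lambda>y. - h y) (diag_ball r' t')"
    by (rule esssup_on_mono[OF sub]) auto
  then have "essinf_on n h (diag_ball r' t') \<le> essinf_on n h (diag_ball r t)"
    unfolding essinf_on_esssup by (simp only: ereal_minus_le_minus)
  then show "lower r' t' \<le> lower r t"
    unfolding ess_bounds(2)[OF assms(1,2)] ess_bounds(2)[OF r' assms(3)] by simp
qed

lemma diag_value_between:
  assumes t: "t \<in> {0..1}" and r: "0 < r"
  shows "lower r t \<le> diag_value t" and "diag_value t \<le> upper r t"
proof -
  let ?e = "\<lambda>k. 1 / real (Suc k)"
  have e: "0 < ?e k" for k by simp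
  have mono: "upper a t \<le> upper b t" "lower b t \<le> lower a t" if "0 < a" "a \<le> b" for a b
    using bounds_nested[OF that(1) t t, of b] that(2) by auto
  have "decseq (\<lambda>k. upper (?e k) t)"
    by (intro decseq_SucI mono(1)) (auto simp: field_simps)
  moreover have "- c \<le> upper (?e k) t" for k
    using ess_bounds(4)[OF e t, of k] by (simp add: abs_le_iff)
  ultimately have "convergent (\<lambda>k. upper (?e k) t)"
    by (metis decseq_convergent convergentI)
  then have lim: "(\<lambda>k. upper (?e k) t) \<longlonglongrightarrow> diag_value t"
    unfolding diag_value_def convergent_LIMSEQ_iff .
  obtain k0 where k0: "?e k0 < r" using r nat_approx_posE by blast
  have small: "?e k \<le> r" if "k0 \<le> k" for k
  proof -
    have "?e k \<le> ?e k0" using that by (intro divide_left_mono) auto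
    then show ?thesis using k0 by simp
  qed
  have "\<forall>k\<ge>k0. upper (?e k) t \<le> upper r t" using mono(1)[OF e small] by blast
  then show "diag_value t \<le> upper r t" by (intro LIMSEQ_le_const2[OF lim]) blast
  have "\<forall>k\<ge>k0. lower r t \<le> upper (?e k) t"
    using mono(2)[OF e small] ess_bounds(3)[OF e t] order_trans by blast
  then show "lower r t \<le> diag_value t" by (intro LIMSEQ_le_const[OF lim]) blast
qed

lemma diag_value_bound: "t \<in> {0..1} \<Longrightarrow> \<bar>diag_value t\<bar> \<le> c"
proof -
  assume t: "t \<in> {0..1}"
  have "- c \<le> lower 1 t"
  proof -
    have "esssup_on n (\<lambda>y. - h y) (diag_ball 1 t) \<le> ereal c"
      unfolding esssup_on_le_iff[OF cube_ball_measurable measurable_minus_h]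
      using bound by eventually_elim (simp add: abs_le_iff)
    then have "- ereal c \<le> essinf_on n h (diag_ball 1 t)"
      unfolding essinf_on_esssup by (simp only: ereal_minus_le_minus)
    then show ?thesis unfolding ess_bounds(2)[OF zero_less_one t] by simp
  qed
  then show ?thesis
    using diag_value_between[OF t zero_less_one] ess_bounds(4)[OF zero_less_one t] by (simp add: abs_le_iff)
qed

lemma integrable_diag_value: "integrable unit_interval diag_value"
proof (rule finite_measure.integrable_const_bound[where B = c])
  show "finite_measure unit_interval"
    using prob_space_unit_interval by (rule prob_space.finite_measure)
  show "AE t in unit_interval. norm (diag_value t) \<le> c"
    by (rule AE_I2) (use diag_value_bound in \<open>simp add: space_restrict_space\<close>)
qed (rule measurable_diag_value)

lemma diag_limit_eq:
  assumes t: "t \<in> {0..1}" and vanish: "\<And>\<delta>. 0 < \<delta> \<Longrightarrow> \<exists>r>0. upper r t - lower r t < \<delta>"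
  shows "diag_limit n h t = diag_value t"
proof -
  have close: "\<forall>\<^sub>F r in at_right 0. 0 < r \<and> \<bar>upper r t - diag_value t\<bar> < \<delta> \<and> \<bar>lower r t - diag_value t\<bar> < \<delta>" if \<delta>: "0 < \<delta>" for \<delta>
  proof -
    obtain s where s: "0 < s" "upper s t - lower s t < \<delta>" using vanish[OF \<delta>] by blast
    show ?thesis
      using eventually_at_right_real[OF s(1)]
    proof eventually_elim
      case (elim r)
      then have r: "0 < r" "r \<le> s" by auto
      have "upper r t \<le> upper s t" "lower s t \<le> lower r t"
        using bounds_nested[OF r(1) t t, of s] r(2) by auto
      then show ?case
        using diag_value_between[OF t r(1)] diag_value_between[OF t s(1)] s(2) r(1) by auto
    qed
  qed
  have u: "((\<lambda>r. upper r t) \<longlongrightarrow> diag_value t) (at_right 0)"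
  proof (rule tendstoI)
    fix \<delta> :: real assume "0 < \<delta>"
    from close[OF this] show "\<forall>\<^sub>F r in at_right 0. dist (upper r t) (diag_value t) < \<delta>"
      unfolding dist_real_def by eventually_elim blast
  qed
  have l: "((\<lambda>r. lower r t) \<longlongrightarrow> diag_value t) (at_right 0)"
  proof (rule tendstoI)
    fix \<delta> :: real assume "0 < \<delta>"
    from close[OF this] show "\<forall>\<^sub>F r in at_right 0. dist (lower r t) (diag_value t) < \<delta>"
      unfolding dist_real_def by eventually_elim blast
  qed
  have pos: "\<forall>\<^sub>F r in at_right (0::real). 0 < r" by (rule eventually_at_right_less)
  have U: "((\<lambda>r. esssup_on n h (diag_ball r t)) \<longlongrightarrow> ereal (diag_value t)) (at_right 0)"
  proof (rule Lim_transform_eventually)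
    show "((\<lambda>r. ereal (upper r t)) \<longlongrightarrow> ereal (diag_value t)) (at_right 0)" using u by simp
    show "\<forall>\<^sub>F r in at_right 0. ereal (upper r t) = esssup_on n h (diag_ball r t)"
      using pos by eventually_elim (simp add: ess_bounds(1)[OF _ t])
  qed
  have L: "((\<lambda>r. essinf_on n h (diag_ball r t)) \<longlongrightarrow> ereal (diag_value t)) (at_right 0)"
  proof (rule Lim_transform_eventually)
    show "((\<lambda>r. ereal (lower r t)) \<longlongrightarrow> ereal (diag_value t)) (at_right 0)" using l by simp
    show "\<forall>\<^sub>F r in at_right 0. ereal (lower r t) = essinf_on n h (diag_ball r t)"
      using pos by eventually_elim (simp add: ess_bounds(2)[OF _ t])
  qed
  show ?thesis
    unfolding diag_limit_def
  proof (rule the_equality)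
    fix l assume "((\<lambda>r. esssup_on n h (diag_ball r t)) \<longlongrightarrow> ereal l) (at_right 0) \<and>
      ((\<lambda>r. essinf_on n h (diag_ball r t)) \<longlongrightarrow> ereal l) (at_right 0)"
    then have "ereal l = ereal (diag_value t)"
      using tendsto_unique[OF trivial_limit_at_right_real _ U] by blast
    then show "l = diag_value t" by simp
  qed (use U L in blast)
qed

text \<open>
  The essential bounds over a ball hold outside a null set that depends on the ball. To compare
  \<open>h x\<close> with bounds over a ball that moves with \<open>x\<close>, pass through balls with rational centres: there
  are countably many of them, and one with radius \<open>2 n \<nu>\<close> contains \<open>x\<close> and is contained in the ball
  of radius \<open>4 n \<nu>\<close> about the diagonal point over \<open>x 0\<close>.
\<close>

lemma AE_close_to_diag_value:
  assumes \<nu>: "0 < \<nu>"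
  shows "AE x in leb n. x \<in> sync_set n \<nu> \<longrightarrow>
    \<bar>h x - diag_value (x 0)\<bar> \<le> upper (4 * real n * \<nu>) (x 0) - lower (4 * real n * \<nu>) (x 0)"
proof -
  have n0: "0 < n" using n by simp
  let ?R = "\<rat> \<inter> {0..1::real}"
  let ?e = "2 * real n * \<nu>"
  have e: "0 < ?e" "0 < 4 * real n * \<nu>" using \<nu> n0 by auto
  have "AE x in leb n. \<forall>s\<in>?R. x \<in> diag_ball ?e s \<longrightarrow> lower ?e s \<le> h x \<and> h x \<le> upper ?e s"
  proof (rule AE_ball_countable')
    show "countable ?R" using countable_rat by (rule countable_Int1)
    fix s assume "s \<in> ?R"
    then have s: "s \<in> {0..1}" by auto
    have "AE x in leb n. x \<in> diag_ball ?e s \<longrightarrow> ereal (h x) \<le> esssup_on n h (diag_ball ?e s)"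
      by (rule AE_le_esssup_on) simp
    moreover have "AE x in leb n. x \<in> diag_ball ?e s \<longrightarrow> ereal (- h x) \<le> esssup_on n (\<lambda>y. - h y) (diag_ball ?e s)"
      by (rule AE_le_esssup_on) simp
    moreover have "esssup_on n (\<lambda>y. - h y) (diag_ball ?e s) = ereal (- lower ?e s)"
      using ess_bounds(2)[OF e(1) s] unfolding essinf_on_esssup by (metis ereal_uminus_uminus uminus_ereal.simps(1))
    ultimately show "AE x in leb n. x \<in> diag_ball ?e s \<longrightarrow> lower ?e s \<le> h x \<and> h x \<le> upper ?e s"
      unfolding ess_bounds(1)[OF e(1) s] by (auto elim!: eventually_elim2)
  qed
  then show ?thesis
  proof eventually_elim
    case (elim x)
    show ?case
    proof
      assume x: "x \<in> sync_set n \<nu>"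
      then have cube: "x \<in> unit_cube n" and dist: "sync_dist n x \<le> \<nu>" unfolding sync_set_def by auto
      let ?t = "x 0"
      have t: "?t \<in> {0..1}" by (rule unit_cube_coordinate[OF cube n0])
      obtain s where s: "s \<in> ?R" "\<bar>s - ?t\<bar> < \<nu>"
      proof -
        let ?a = "max 0 (?t - \<nu>)" and ?b = "min 1 (?t + \<nu>)"
        have "?a < ?b" using t \<nu> by auto
        then obtain s where "s \<in> \<rat>" "?a < s" "s < ?b" using Rats_dense_in_real by blast
        then show ?thesis using that[of s] by auto
      qed
      have s01: "s \<in> {0..1}" using s by simp
      have "euclid_dist n (diag_point n ?t) x \<le> real n * \<nu>"
      proof (rule euclid_dist_le)
        fix i assume i: "i < n"
        have "\<bar>x 0 - x i\<bar> \<le> \<nu>"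
          using gap_le_sync_dist[OF n n0 i, of x] dist \<nu> by (cases "i = 0") auto
        then show "\<bar>diag_point n ?t i - x i\<bar> \<le> \<nu>" using i by (simp add: diag_point_def)
      qed
      moreover have "euclid_dist n (diag_point n s) (diag_point n ?t) \<le> real n * \<bar>s - ?t\<bar>"
        by (rule euclid_dist_le) (simp add: diag_point_def)
      moreover have "real n * \<bar>s - ?t\<bar> < real n * \<nu>" using s(2) n0 by simp
      ultimately have "euclid_dist n (diag_point n s) x < ?e"
        using euclid_dist_triangle[of n "diag_point n s" x "diag_point n ?t"] by linarith
      then have "x \<in> diag_ball ?e s" using cube unfolding cube_ball_def by simp
      then have h: "lower ?e s \<le> h x" "h x \<le> upper ?e s" using elim s(1) by auto
      have "real n * \<bar>s - ?t\<bar> + ?e \<le> 4 * real n * \<nu>"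
        using \<open>real n * \<bar>s - ?t\<bar> < real n * \<nu>\<close> \<nu> n0 by (simp add: mult_pos_pos less_imp_le add_mono)
      from bounds_nested[OF e(1) s01 t this] show
        "\<bar>h x - diag_value ?t\<bar> \<le> upper (4 * real n * \<nu>) ?t - lower (4 * real n * \<nu>) ?t"
        using h diag_value_between[OF t e(2)] by auto
    qed
  qed
qed

text \<open>
  The oscillations have an integral of order \<open>r\<close> along the diagonal. For \<open>r \<longlongrightarrow> 0\<close> they therefore vanish
  almost everywhere; and in the neighbourhood of the diagonal, whose volume is of order
  \<open>\<nu> ^ (n - 1)\<close>, the replacement of \<open>h\<close> costs at most the order \<open>\<nu> ^ n\<close>.
\<close>

lemma
  assumes "0 < \<epsilon>0" and "0 \<le> K"
    and osc: "\<And>r. 0 < r \<Longrightarrow> r \<le> \<epsilon>0 \<Longrightarrow>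
      (\<integral>\<^sup>+t. ennreal (upper r t - lower r t) \<partial>unit_interval) \<le> ennreal (K * r)"
  shows AE_diag_limit: "AE t in unit_interval. diag_limit n h t = diag_value t"
    and diagonal_approximation_osc: "\<lbrakk>\<And>m. 0 < \<nu> m; \<nu> \<longlonglongrightarrow> 0\<rbrakk> \<Longrightarrow>
      (\<lambda>m. (\<integral>x. indicator (sync_set n (\<nu> m)) x * \<bar>h x - diag_value (x 0)\<bar> \<partial>leb n) / \<nu> m ^ (n - 1)) \<longlonglongrightarrow> 0"
proof -
  have n0: "0 < n" using n by simp
  let ?gap = "\<lambda>r t. upper r t - lower r t"
  show "AE t in unit_interval. diag_limit n h t = diag_value t"
  proof -
    let ?e = "\<lambda>k. \<epsilon>0 / real (Suc k)"
    \<comment> \<open>The smallest oscillation over the balls of radii \<open>?e k\<close>; its integral is 0.\<close>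
    let ?o = "\<lambda>t. INF k. ennreal (?gap (?e k) t)"
    have e: "0 < ?e k" "?e k \<le> \<epsilon>0" for k using assms(1) by (auto simp: field_simps)
    have "(\<integral>\<^sup>+t. ?o t \<partial>unit_interval) \<le> ennreal (K * ?e k)" for k
    proof -
      have "(\<integral>\<^sup>+t. ?o t \<partial>unit_interval) \<le> (\<integral>\<^sup>+t. ennreal (?gap (?e k) t) \<partial>unit_interval)"
        by (intro nn_integral_mono INF_lower) simp
      then show ?thesis using osc[OF e] by (rule order_trans)
    qed
    moreover have "(\<lambda>k. ennreal (K * ?e k)) \<longlonglongrightarrow> ennreal 0"
    proof (rule tendsto_ennrealI)
      have "(\<lambda>k. K * (\<epsilon>0 / real (Suc k))) \<longlonglongrightarrow> K * 0"
        by (intro tendsto_mult tendsto_const LIMSEQ_Suc[OF lim_const_over_n])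
      then show "(\<lambda>k. K * ?e k) \<longlonglongrightarrow> 0" by simp
    qed
    ultimately have "(\<integral>\<^sup>+t. ?o t \<partial>unit_interval) \<le> ennreal 0"
      by (intro LIMSEQ_le_const[of _ "ennreal 0"]) auto
    then have "(\<integral>\<^sup>+t. ?o t \<partial>unit_interval) = 0" by simp
    moreover have "?o \<in> borel_measurable unit_interval" by measurable
    ultimately have "AE t in unit_interval. ?o t = 0"
      by (simp only: nn_integral_0_iff_AE)
    then show ?thesis using AE_space
    proof eventually_elim
      case (elim t)
      then have t: "t \<in> {0..1}" by (simp add: space_restrict_space)
      show ?case
      proof (rule diag_limit_eq[OF t])
        fix \<delta> :: real assume "0 < \<delta>"
        then have "?o t < ennreal \<delta>" using elim(1) by simp
        then obtain k where "ennreal (?gap (?e k) t) < ennreal \<delta>" by (auto simp: INF_less_iff)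
        then have "?gap (?e k) t < \<delta>" by (meson ennreal_leI not_less)
        then show "\<exists>r>0. ?gap r t < \<delta>" using e(1) by blast
      qed
    qed
  qed
  assume \<nu>_pos: "\<And>m. 0 < \<nu> m" and \<nu>: "\<nu> \<longlonglongrightarrow> 0"
  let ?r = "\<lambda>m. 4 * real n * \<nu> m"
  have r_pos: "0 < ?r m" for m using \<nu>_pos[of m] n0 by simp
  have lim: "(\<lambda>m. K * ?r m * 2 ^ (n - 1)) \<longlonglongrightarrow> K * (4 * real n * 0) * 2 ^ (n - 1)"
    using \<nu> by (intro tendsto_intros)
  then have lim0: "(\<lambda>m. K * ?r m * 2 ^ (n - 1)) \<longlonglongrightarrow> 0"
    by (simp only: mult_zero_right mult_zero_left)
  have "\<forall>\<^sub>F m in sequentially. ?r m < \<epsilon>0"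
  proof -
    have "?r \<longlonglongrightarrow> 4 * real n * 0" using \<nu> by (intro tendsto_intros)
    then show ?thesis using assms(1) by (intro order_tendstoD) auto
  qed
  then have "\<forall>\<^sub>F m in sequentially.
      norm ((\<integral>x. indicator (sync_set n (\<nu> m)) x * \<bar>h x - diag_value (x 0)\<bar> \<partial>leb n) / \<nu> m ^ (n - 1)) \<le> K * ?r m * 2 ^ (n - 1)"
  proof eventually_elim
    case (elim m)
    let ?S = "sync_set n (\<nu> m)"
    have [measurable]: "?S \<in> sets (leb n)" by (rule sync_set_measurable[OF n])
    have gap [measurable]: "?gap (?r m) \<in> borel_measurable unit_interval" by measurable
    have gap0 [measurable]: "(\<lambda>x. ?gap (?r m) (x 0)) \<in> borel_measurable (leb n)"
      by (rule measurable_compose[OF leb_coordinate[OF n0] gap])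
    have gap1 [measurable]: "(\<lambda>p. ?gap (?r m) (fst p)) \<in> borel_measurable (unit_interval \<Otimes>\<^sub>M fiber n)"
      by (rule measurable_compose[OF measurable_fst gap])
    have fan0: "fan n (\<nu> m) p 0 = fst p" for p using n0 by (simp add: fan_def case_prod_beta')
    have "(\<integral>\<^sup>+x. ennreal (indicator ?S x * \<bar>h x - diag_value (x 0)\<bar>) \<partial>leb n)
        \<le> (\<integral>\<^sup>+x. ennreal (indicator ?S x * ?gap (?r m) (x 0)) \<partial>leb n)"
      by (rule nn_integral_mono_AE)
        (use AE_close_to_diag_value[OF \<nu>_pos[of m]] in \<open>eventually_elim; auto simp: indicator_def intro: ennreal_leI\<close>)
    also have "\<dots> = (\<integral>\<^sup>+p. ennreal (\<nu> m ^ (n - 1) * fits n (\<nu> m) p)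
        * ennreal (indicator ?S (fan n (\<nu> m) p) * ?gap (?r m) (fan n (\<nu> m) p 0)) \<partial>(unit_interval \<Otimes>\<^sub>M fiber n))"
      by (rule nn_integral_leb_fan[OF n0 \<nu>_pos]) measurable
    also have "\<dots> \<le> (\<integral>\<^sup>+p. ennreal (\<nu> m ^ (n - 1) * ?gap (?r m) (fst p)) * indicator (unit_box n) (snd p)
        \<partial>(unit_interval \<Otimes>\<^sub>M fiber n))"
    proof (rule nn_integral_mono)
      fix p assume p: "p \<in> space (unit_interval \<Otimes>\<^sub>M fiber n)"
      obtain t y where ty: "p = (t, y)" by (cases p)
      have t: "t \<in> {0..1}" "y \<in> space (fiber n)" using p by (auto simp: ty space_pair_measure space_restrict_space)
      show "ennreal (\<nu> m ^ (n - 1) * fits n (\<nu> m) p) * ennreal (indicator ?S (fan n (\<nu> m) p) * ?gap (?r m) (fan n (\<nu> m) p 0))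
          \<le> ennreal (\<nu> m ^ (n - 1) * ?gap (?r m) (fst p)) * indicator (unit_box n) (snd p)"
      proof (cases "fits n (\<nu> m) p \<noteq> 0 \<and> fan n (\<nu> m) p \<in> ?S")
        case True
        then have "y \<in> unit_box n"
          using synchronised_in_box[OF n \<nu>_pos t(2)] unfolding ty by auto
        moreover have "fits n (\<nu> m) p = 1" using True unfolding ty fits_cases by (auto split: if_splits)
        moreover have "0 \<le> ?gap (?r m) t" using ess_bounds(3)[OF r_pos t(1)] by simp
        ultimately show ?thesis
          using True \<nu>_pos[of m] unfolding fan0 ty by (simp add: ennreal_mult)
      qed (auto simp: indicator_def)
    qed
    also have "\<dots> = (\<integral>\<^sup>+t. \<integral>\<^sup>+y. ennreal (\<nu> m ^ (n - 1) * ?gap (?r m) t) * indicator (unit_box n) y \<partial>fiber n \<partial>unit_interval)"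
    proof -
      have "(\<lambda>p. ennreal (\<nu> m ^ (n - 1) * ?gap (?r m) (fst p)) * indicator (unit_box n) (snd p))
          \<in> borel_measurable (unit_interval \<Otimes>\<^sub>M fiber n)" by measurable
      from fiber.nn_integral_fst[OF this] show ?thesis unfolding fst_conv snd_conv by (rule sym)
    qed
    also have "\<dots> = (\<integral>\<^sup>+t. ennreal (\<nu> m ^ (n - 1) * 2 ^ (n - 1)) * ennreal (?gap (?r m) t) \<partial>unit_interval)"
    proof (intro nn_integral_cong)
      fix t assume "t \<in> space unit_interval"
      then have "0 \<le> ?gap (?r m) t" using ess_bounds(3)[OF r_pos] by (simp add: space_restrict_space)
      moreover have "(\<integral>\<^sup>+y. ennreal (\<nu> m ^ (n - 1) * ?gap (?r m) t) * indicator (unit_box n) y \<partial>fiber n)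
          = ennreal (\<nu> m ^ (n - 1) * ?gap (?r m) t) * ennreal (2 ^ (n - 1))"
        unfolding emeasure_unit_box[symmetric] by (rule nn_integral_cmult_indicator) simp
      ultimately show "(\<integral>\<^sup>+y. ennreal (\<nu> m ^ (n - 1) * ?gap (?r m) t) * indicator (unit_box n) y \<partial>fiber n)
          = ennreal (\<nu> m ^ (n - 1) * 2 ^ (n - 1)) * ennreal (?gap (?r m) t)"
        using \<nu>_pos[of m] by (simp add: ennreal_mult mult.assoc mult.commute[of "ennreal (2 ^ (n - 1))"])
    qed
    also have "\<dots> = ennreal (\<nu> m ^ (n - 1) * 2 ^ (n - 1)) * (\<integral>\<^sup>+t. ennreal (?gap (?r m) t) \<partial>unit_interval)"
      by (rule nn_integral_cmult) measurable
    also have "\<dots> \<le> ennreal (\<nu> m ^ (n - 1) * 2 ^ (n - 1)) * ennreal (K * ?r m)"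
      using osc[OF r_pos] elim by (intro mult_left_mono) auto
    also have "\<dots> = ennreal (\<nu> m ^ (n - 1) * (K * ?r m * 2 ^ (n - 1)))"
    proof -
      have "\<nu> m ^ (n - 1) * 2 ^ (n - 1) * (K * ?r m) = \<nu> m ^ (n - 1) * (K * ?r m * 2 ^ (n - 1))"
        by (simp only: mult_ac)
      moreover have "0 \<le> \<nu> m ^ (n - 1) * 2 ^ (n - 1)" "0 \<le> K * ?r m" using \<nu>_pos[of m] assms(2) by auto
      ultimately show ?thesis by (metis ennreal_mult)
    qed
    finally have "(\<integral>x. indicator ?S x * \<bar>h x - diag_value (x 0)\<bar> \<partial>leb n) \<le> \<nu> m ^ (n - 1) * (K * ?r m * 2 ^ (n - 1))"
      using \<nu>_pos[of m] assms(2) by (intro integral_real_bounded) auto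
    moreover have "0 \<le> (\<integral>x. indicator ?S x * \<bar>h x - diag_value (x 0)\<bar> \<partial>leb n)"
      by (rule Bochner_Integration.integral_nonneg) simp
    ultimately show ?case using \<nu>_pos[of m] by (simp add: field_simps)
  qed
  then show "(\<lambda>m. (\<integral>x. indicator (sync_set n (\<nu> m)) x * \<bar>h x - diag_value (x 0)\<bar> \<partial>leb n) / \<nu> m ^ (n - 1)) \<longlonglongrightarrow> 0"
    using lim0 by (rule Lim_null_comparison)
qed

end

section \<open>The extremal index\<close>

lemma nn_integral_lebesgue_on_unit: "(\<integral>\<^sup>+t. f t \<partial>lebesgue_on {0..1}) = (\<integral>\<^sup>+t. f t \<partial>unit_interval)"
  for f :: "real \<Rightarrow> ennreal"
  by (subst nn_integral_restrict_space, simp, subst nn_integral_restrict_space, simp)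
    (rule nn_integral_completion)

text \<open>
  The function \<open>f\<close> is known only up to a null set, so its measurability is available with respect to
  the completed measure only.
\<close>

lemma integral_lebesgue_on_unit:
  fixes f g :: "real \<Rightarrow> real"
  assumes g: "g \<in> borel_measurable unit_interval" and eq: "AE t in unit_interval. f t = g t"
  shows "(LINT t|lebesgue_on {0..1}. f t) = (\<integral>t. g t \<partial>unit_interval)"
proof -
  let ?f = "\<lambda>t. if t \<in> {0..1} then f t else 0" and ?g = "\<lambda>t. indicator {0..1} t *\<^sub>R g t"
  have g1: "?g \<in> borel_measurable lborel"
    using g by (subst (asm) borel_measurable_restrict_space_iff) auto
  then have g2: "?g \<in> borel_measurable lebesgue" by (rule measurable_completion)
  have "AE t in lborel. t \<in> {0..1} \<longrightarrow> f t = g t"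
    using eq by (subst (asm) AE_restrict_space_iff) auto
  then have "AE t in lborel. ?g t = ?f t" by eventually_elim (simp add: indicator_def)
  then have ae: "AE t in lebesgue. ?g t = ?f t" by (rule AE_completion)
  have "(LINT t|lebesgue_on {0..1}. f t) = (LINT t|lebesgue. ?f t)"
    by (rule Lebesgue_Measure.integral_restrict_UNIV[symmetric]) simp
  also have "\<dots> = (LINT t|lebesgue. ?g t)"
    by (rule integral_cong_AE[OF borel_measurable_AE[OF g2 ae] g2]) (use ae in \<open>eventually_elim; simp\<close>)
  also have "\<dots> = (LINT t|lborel. ?g t)" by (rule integral_completion[OF g1])
  also have "\<dots> = (\<integral>t. g t \<partial>unit_interval)" by (rule integral_restrict_space[symmetric]) simp
  finally show ?thesis .
qed

lemma sync_obs_greater_iff: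
  assumes "2 \<le> n" shows "ereal r < sync_obs n x \<longleftrightarrow> sync_dist n x < exp (- r)"
proof (cases "sync_dist n x = 0")
  case False
  then have pos: "0 < sync_dist n x" using sync_dist_nonneg[OF assms, of x] by simp
  have "r < - ln (sync_dist n x) \<longleftrightarrow> ln (sync_dist n x) < - r" by auto
  also have "\<dots> \<longleftrightarrow> exp (ln (sync_dist n x)) < exp (- r)" by (rule exp_less_cancel_iff[symmetric])
  finally show ?thesis using False pos by (simp add: sync_obs_def)
qed (simp add: sync_obs_def)

text \<open>
  The scaling forces the mass of the synchronisation sets to 0, whereas for a fixed radius this mass is
  positive, because the density is bounded below and the diagonal has neighbourhoods of positive
  volume.
\<close>

lemma (in invariant_density) sync_thresholds_tendsto:
  assumes n: "2 \<le> n" and thr: "sync_thresholds n h \<tau> u"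
  shows "(\<lambda>m. exp (- u m)) \<longlonglongrightarrow> 0"
proof -
  let ?\<mu> = "density_measure n h"
  define V where "V r = {x \<in> unit_cube n. sync_dist n x < r}" for r
  have prob: "prob_space ?\<mu>" using invariant unfolding ac_invariant_prob_def by blast
  have sets [simp]: "sets ?\<mu> = sets (leb n)" unfolding density_measure_def by simp
  have V_sets: "V r \<in> sets (leb n)" for r
  proof -
    have "V r = {x \<in> space (leb n). \<forall>i\<in>{..<n}. \<forall>j\<in>{..<n}. i \<noteq> j \<longrightarrow> \<bar>x i - x j\<bar> < r}"
      unfolding V_def space_leb sync_dist_less_iff[OF n] by auto
    also have "\<dots> \<in> sets (leb n)" by measurable
    finally show ?thesis .
  qed
  have V_mono: "measure ?\<mu> (V r) \<le> measure ?\<mu> (V s)" if "r \<le> s" for r s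
    using that V_sets by (intro finite_measure.finite_measure_mono prob_space.finite_measure[OF prob]) (auto simp: V_def)
  have V_pos: "0 < measure ?\<mu> (V r)" if "0 < r" for r
  proof (rule ccontr)
    assume "\<not> 0 < measure ?\<mu> (V r)"
    then have "measure ?\<mu> (V r) = 0" using measure_nonneg[of ?\<mu> "V r"] by linarith
    then have "emeasure ?\<mu> (V r) = 0"
      by (simp add: finite_measure.emeasure_eq_measure[OF prob_space.finite_measure[OF prob]])
    then have "V r \<in> null_sets ?\<mu>" using V_sets by (intro null_setsI) simp_all
    then have "AE x in leb n. x \<in> V r \<longrightarrow> ennreal (h x) = 0"
      unfolding density_measure_def by (subst (asm) null_sets_density_iff) auto
    moreover obtain c where "c > 0" "AE x in leb n. c \<le> h x" using h_lower by blast
    ultimately have "AE x in leb n. x \<notin> V r"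
      by (auto elim!: eventually_elim2 simp: ennreal_eq_0_iff)
    then have null: "V r \<in> null_sets (leb n)" using V_sets by (subst AE_iff_null_sets) auto
    \<comment> \<open>A cube about the midpoint; any other diagonal point would do as well.\<close>
    have "{x \<in> unit_cube n. \<forall>i<n. \<bar>x i - 1 / 2\<bar> < r / 2} \<subseteq> V r"
    proof
      fix x assume x: "x \<in> {x \<in> unit_cube n. \<forall>i<n. \<bar>x i - 1 / 2\<bar> < r / 2}"
      have "\<bar>x i - x j\<bar> < r" if "i < n" "j < n" for i j
      proof -
        have "\<bar>x i - 1 / 2\<bar> < r / 2" "\<bar>x j - 1 / 2\<bar> < r / 2" using x that by auto
        then show ?thesis by linarith
      qed
      then show "x \<in> V r" using x unfolding V_def sync_dist_less_iff[OF n] by auto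
    qed
    then have "emeasure (leb n) {x \<in> unit_cube n. \<forall>i<n. \<bar>x i - 1 / 2\<bar> < r / 2} \<le> emeasure (leb n) (V r)"
      using V_sets by (rule emeasure_mono)
    moreover have "0 < emeasure (leb n) {x \<in> unit_cube n. \<forall>i<n. \<bar>x i - 1 / 2\<bar> < r / 2}"
      using that by (intro emeasure_leb_box_pos) auto
    ultimately show False using null by auto
  qed
  have "(\<lambda>m. real m * measure ?\<mu> (V (exp (- u m)))) \<longlonglongrightarrow> \<tau>"
    using thr unfolding sync_thresholds_def V_def sync_obs_greater_iff[OF n] by blast
  then have "(\<lambda>m. real m * measure ?\<mu> (V (exp (- u m))) * (1 / real m)) \<longlonglongrightarrow> \<tau> * 0"
    by (intro tendsto_mult lim_1_over_n)
  then have lim: "(\<lambda>m. real m * measure ?\<mu> (V (exp (- u m))) * (1 / real m)) \<longlonglongrightarrow> 0" by simp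
  show ?thesis
  proof (rule tendstoI)
    fix e :: real assume "0 < e"
    have "\<forall>\<^sub>F m in sequentially. real m * measure ?\<mu> (V (exp (- u m))) * (1 / real m) < measure ?\<mu> (V e)"
      using order_tendstoD(2)[OF lim V_pos[OF \<open>0 < e\<close>]] .
    then show "\<forall>\<^sub>F m in sequentially. dist (exp (- u m)) 0 < e"
      using eventually_gt_at_top[of 0]
    proof eventually_elim
      case (elim m)
      then have "measure ?\<mu> (V (exp (- u m))) < measure ?\<mu> (V e)" by simp
      then have "\<not> e \<le> exp (- u m)" using V_mono[of e "exp (- u m)"] by auto
      then show ?case by simp
    qed
  qed
qed

text \<open>
  In the case of bounded oscillation, the constant \<open>K\<close> in the bound on the integrals along the diagonal
  is the supremum that the hypothesis requires to be finite.
\<close>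

lemma diagonal_regularity:
  assumes n: "2 \<le> n" and h: "integrable (leb n) h" and c: "AE x in leb n. \<bar>h x\<bar> \<le> c"
    and reg: "diag_regular n \<epsilon>0 B N h H"
  obtains H' where "integrable unit_interval H'" "AE t in unit_interval. H t = H' t"
    "\<forall>\<nu>. (\<forall>m. 0 < \<nu> m) \<longrightarrow> \<nu> \<longlonglongrightarrow> 0 \<longrightarrow>
      (\<lambda>m. (\<integral>x. indicator (sync_set n (\<nu> m)) x * \<bar>h x - H' (x 0)\<bar> \<partial>leb n) / \<nu> m ^ (n - 1)) \<longlonglongrightarrow> 0"
proof (cases "prop_P7 n h \<and> (\<forall>t\<in>{0..1}. H t = h (diag_point n t))")
  case True
  have "integrable unit_interval (\<lambda>t. h (diag_point n t))"
    by (rule diagonal_approximation_continuous(1)[OF n _ h, of "\<lambda>m. 1 / real (Suc m)"])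
      (use True LIMSEQ_Suc[OF lim_1_over_n] in auto)
  moreover have "AE t in unit_interval. H t = h (diag_point n t)"
    by (rule AE_I2) (use True in \<open>simp add: space_restrict_space\<close>)
  ultimately show ?thesis
    using that diagonal_approximation_continuous(2)[OF n conjunct1[OF True] h] by blast
next
  case False
  then have \<epsilon>0: "0 < \<epsilon>0" and P8: "prop_P8 n \<epsilon>0 h" and H: "\<And>t. t \<in> {0..1} \<Longrightarrow> H t = diag_limit n h t"
    using reg unfolding diag_regular_def by auto
  interpret bounded_function n h c
    by standard (use n h c in auto)
  define I where "I r = (\<integral>\<^sup>+t. osc n h (cube_ball n (diag_point n t) r) \<partial>lebesgue_on {0..1})" for r
  define K where "K = enn2real (SUP r\<in>{0<..\<epsilon>0}. ennreal (1 / r) * I r)"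
  have fin: "(SUP r\<in>{0<..\<epsilon>0}. ennreal (1 / r) * I r) < \<infinity>"
    using P8 unfolding prop_P8_def I_def by blast
  have osc: "(\<integral>\<^sup>+t. ennreal (upper r t - lower r t) \<partial>unit_interval) \<le> ennreal (K * r)" if r: "0 < r" "r \<le> \<epsilon>0" for r
  proof -
    have "(\<integral>\<^sup>+t. ennreal (upper r t - lower r t) \<partial>unit_interval) = I r"
      unfolding I_def nn_integral_lebesgue_on_unit
      by (intro nn_integral_cong) (simp add: osc_diag_ball[OF r(1)] space_restrict_space)
    also have "I r = ennreal r * (ennreal (1 / r) * I r)"
      using r by (simp add: mult.assoc[symmetric] ennreal_mult[symmetric])
    also have "\<dots> \<le> ennreal r * (SUP r\<in>{0<..\<epsilon>0}. ennreal (1 / r) * I r)"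
      using r by (intro mult_left_mono SUP_upper) auto
    also have "\<dots> = ennreal r * ennreal K" using fin unfolding K_def by simp
    also have "\<dots> = ennreal (K * r)"
      using r unfolding K_def by (simp add: ennreal_mult[symmetric] mult.commute)
    finally show ?thesis .
  qed
  have K: "0 \<le> K" unfolding K_def by simp
  have "AE t in unit_interval. diag_limit n h t = diag_value t"
    by (rule AE_diag_limit[OF \<epsilon>0 K]) (rule osc)
  then have ae: "AE t in unit_interval. H t = diag_value t"
    using AE_space by eventually_elim (simp add: H space_restrict_space)
  show ?thesis
  proof (rule that[OF integrable_diag_value ae], intro allI impI)
    fix \<nu> :: "nat \<Rightarrow> real" assume \<nu>: "\<forall>m. 0 < \<nu> m" "\<nu> \<longlonglongrightarrow> 0"
    show "(\<lambda>m. (\<integral>x. indicator (sync_set n (\<nu> m)) x * \<bar>h x - diag_value (x 0)\<bar> \<partial>leb n) / \<nu> m ^ (n - 1)) \<longlonglongrightarrow> 0"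
      by (rule diagonal_approximation_osc[OF \<epsilon>0 K osc \<nu>(1)[rule_format] \<nu>(2)])
  qed
qed

context coupled_map
begin

text \<open>
  Both integrals in a return ratio are of the order \<open>\<nu> ^ (n - 1)\<close>; after division by this power the
  limit theorems apply, with a denominator that stays away from 0 since the trace of the density
  is bounded below.
\<close>

lemma
  assumes ass: "cml_assumptions q A T \<gamma> n \<tau> \<epsilon>0 B N h H u"
  shows return_ratio_convergent: "convergent (return_ratio n Th h (sync_sets n u) k)"
    and return_coeff_summable: "summable (return_coeff n Th h (sync_sets n u))"
    and extremal_index_eq: "extremal_index n Th h (sync_sets n u) =
      1 - 1 / (1 - \<gamma>) ^ (n - 1) *
        ((LINT x|lebesgue_on {0..1}. H x / \<bar>deriv T x\<bar> ^ (n - 1)) / (LINT x|lebesgue_on {0..1}. H x))"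
    and extremal_index_bound: "\<lbrakk>\<And>x. inverse_slope x \<le> l\<rbrakk> \<Longrightarrow>
      \<bar>extremal_index n Th h (sync_sets n u) - 1\<bar> \<le> (l / (1 - \<gamma>)) ^ (n - 1)"
proof -
  have P2: "prop_P2 n Th B h" and P5: "prop_P5 n Th B N (sync_sets n u) h"
    and thr: "sync_thresholds n h \<tau> u" and reg: "diag_regular n \<epsilon>0 B N h H"
    and Ban: "banach_compact_in_L1 n B N"
    using ass unfolding cml_assumptions_def by auto
  have h_int: "integrable (leb n) h"
    using P2 Ban unfolding prop_P2_def banach_compact_in_L1_def by blast
  obtain b where b: "AE x in leb n. \<bar>h x\<bar> \<le> b" using P2 unfolding prop_P2_def by blast
  interpret density: invariant_density n Th h
  proof
    show "Th \<in> leb n \<rightarrow>\<^sub>M leb n" by (rule measurable_cml)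
    show "ac_invariant_prob n Th (density_measure n h)" "AE x in leb n. 0 \<le> h x"
      using P2 unfolding prop_P2_def by auto
    show "\<exists>c>0. AE x in leb n. c \<le> h x" using P5 unfolding prop_P5_def by blast
  qed (rule h_int)
  define \<nu> where "\<nu> m = exp (- u m)" for m
  have \<nu>_pos: "0 < \<nu> m" for m unfolding \<nu>_def by simp
  have \<nu>_lim: "\<nu> \<longlonglongrightarrow> 0"
    unfolding \<nu>_def by (rule density.sync_thresholds_tendsto[OF two_le_n thr])
  obtain H' where H': "integrable unit_interval H'" "AE t in unit_interval. H t = H' t"
    and limit: "\<forall>\<nu>. (\<forall>m. 0 < \<nu> m) \<longrightarrow> \<nu> \<longlonglongrightarrow> 0 \<longrightarrow>
      (\<lambda>m. (\<integral>x. indicator (sync_set n (\<nu> m)) x * \<bar>h x - H' (x 0)\<bar> \<partial>leb n) / \<nu> m ^ (n - 1)) \<longlonglongrightarrow> 0"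
    by (rule diagonal_regularity[OF two_le_n h_int b reg]) (rule that)
  have approx: "(\<lambda>m. (\<integral>x. indicator (sync_set n (\<nu> m)) x * \<bar>h x - H' (x 0)\<bar> \<partial>leb n) / \<nu> m ^ (n - 1)) \<longlonglongrightarrow> 0"
    using limit \<nu>_pos \<nu>_lim by blast
  interpret sync: synchronising_map q A T n \<gamma> h H' \<nu>
    by standard (fact two_le_n, fact H'(1), fact \<nu>_pos, fact \<nu>_lim, fact h_int, fact approx)
  obtain c where c: "0 < c" "AE x in leb n. c \<le> h x" using density.h_lower by blast
  have finite_leb: "finite_measure (leb n)" "finite_measure unit_interval"
    using prob_space.finite_measure prob_space_unit_interval prob_space_PiM[of "{..<n}" "\<lambda>_. unit_interval"]
    unfolding leb_def by auto
  \<comment> \<open>The shift by \<open>c\<close> turns nonnegativity of the trace into the lower bound \<open>c\<close>.\<close>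
  interpret shifted: diagonal_density n "\<lambda>t. H' t - c" "\<lambda>x. h x - c" \<nu>
  proof
    show "integrable unit_interval (\<lambda>t. H' t - c)" "integrable (leb n) (\<lambda>x. h x - c)"
      using H'(1) h_int finite_leb by (auto intro: finite_measure.integrable_const)
    show "(\<lambda>m. (\<integral>x. indicator (sync_set n (\<nu> m)) x * \<bar>h x - c - (H' (x 0) - c)\<bar> \<partial>leb n) / \<nu> m ^ (n - 1)) \<longlonglongrightarrow> 0"
      using approx by simp
  qed (rule two_le_n \<nu>_pos \<nu>_lim)+
  have H'_ge: "AE t in unit_interval. c \<le> H' t"
    using shifted.AE_diagonal_nonneg c(2) by simp
  have "(\<integral>t. c \<partial>unit_interval) \<le> (\<integral>t. H' t \<partial>unit_interval)"
    using H'_ge finite_leb by (intro integral_mono_AE H'(1) finite_measure.integrable_const)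
  then have H'_pos: "0 < (\<integral>t. H' t \<partial>unit_interval)"
    using c(1) prob_space.prob_space[OF prob_space_unit_interval] by (simp add: space_restrict_space)
  note K = cell_volume_pos[OF two_le_n]
  let ?J = "\<integral>t. H' t * (inverse_slope t / (1 - \<gamma>)) ^ (n - 1) \<partial>unit_interval"
  let ?D = "\<integral>t. H' t \<partial>unit_interval"
  have ratio: "return_ratio n Th h (sync_sets n u) k m =
      ((\<integral>x. h x * (indicator (sync_set n (\<nu> m)) x * first_hit Th (sync_set n (\<nu> m)) k (Th x)) \<partial>leb n) / \<nu> m ^ (n - 1)) /
      ((\<integral>x. h x * indicator (sync_set n (\<nu> m)) x \<partial>leb n) / \<nu> m ^ (n - 1))" for k m
    unfolding return_ratio_def \<nu>_def[symmetric] density.integral_return[OF sync.S_measurable]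
      density.measure_density_measure[OF sync.S_measurable]
    using \<nu>_pos[of m] by simp
  have zero: "return_ratio n Th h (sync_sets n u) 0 \<longlonglongrightarrow> ?J / ?D"
  proof -
    have "return_ratio n Th h (sync_sets n u) 0 \<longlonglongrightarrow> (cell_volume n * ?J) / (cell_volume n * ?D)"
      unfolding ratio[abs_def] first_hit.simps
      using K H'_pos by (intro tendsto_divide sync.early_return_limit sync.mass_limit) auto
    then show ?thesis using K by simp
  qed
  have later: "return_ratio n Th h (sync_sets n u) (Suc k) \<longlonglongrightarrow> 0" for k
  proof -
    have "return_ratio n Th h (sync_sets n u) (Suc k) \<longlonglongrightarrow> 0 / (cell_volume n * ?D)"
      unfolding ratio[abs_def]
      using K H'_pos by (intro tendsto_divide sync.late_return_limit sync.mass_limit) auto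
    then show ?thesis by simp
  qed
  show "convergent (return_ratio n Th h (sync_sets n u) k)"
    using zero later by (cases k) (auto intro: convergentI)
  have coeff: "return_coeff n Th h (sync_sets n u) k = (if k = 0 then ?J / ?D else 0)" for k
    unfolding return_coeff_def using limI[OF zero] limI[OF later] by (cases k) auto
  have sums: "return_coeff n Th h (sync_sets n u) sums (?J / ?D)"
    unfolding coeff[abs_def] using sums_single[of 0 "\<lambda>_. ?J / ?D"] by simp
  then show "summable (return_coeff n Th h (sync_sets n u))" by (rule sums_summable)
  have index: "extremal_index n Th h (sync_sets n u) = 1 - ?J / ?D"
    unfolding extremal_index_def using sums_unique[OF sums] by simp
  have smooth: "AE t in unit_interval. t \<in> smooth_points"
    using AE_regular by eventually_elim (use regular_points_smooth[where j = 0] in simp)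
  have [measurable]: "inverse_slope \<in> borel_measurable unit_interval" "H' \<in> borel_measurable unit_interval"
    using measurable_inverse_slope H'(1) by (auto intro: measurable_restrict_space1)
  have "(LINT t|lebesgue_on {0..1}. H t / \<bar>deriv T t\<bar> ^ (n - 1)) = (\<integral>t. H' t * inverse_slope t ^ (n - 1) \<partial>unit_interval)"
  proof (rule integral_lebesgue_on_unit)
    show "AE t in unit_interval. H t / \<bar>deriv T t\<bar> ^ (n - 1) = H' t * inverse_slope t ^ (n - 1)"
      using H'(2) smooth by eventually_elim (simp add: inverse_slope_def divide_inverse power_inverse)
  qed measurable
  moreover have "(LINT t|lebesgue_on {0..1}. H t) = ?D"
    by (rule integral_lebesgue_on_unit[OF _ H'(2)]) measurable
  moreover have "?J = 1 / (1 - \<gamma>) ^ (n - 1) * (\<integral>t. H' t * inverse_slope t ^ (n - 1) \<partial>unit_interval)"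
    by (simp add: power_divide)
  ultimately show "extremal_index n Th h (sync_sets n u) =
      1 - 1 / (1 - \<gamma>) ^ (n - 1) *
        ((LINT x|lebesgue_on {0..1}. H x / \<bar>deriv T x\<bar> ^ (n - 1)) / (LINT x|lebesgue_on {0..1}. H x))"
    unfolding index by simp
  assume l: "\<And>x. inverse_slope x \<le> l"
  have \<gamma>1: "\<gamma> < 1" using inverse_slope_bound[OF contraction] by (metis diff_gt_0_iff_gt less_trans)
  have slope_nonneg: "0 \<le> inverse_slope t" for t unfolding inverse_slope_def by simp
  then have rate: "0 \<le> (inverse_slope t / (1 - \<gamma>)) ^ (n - 1)"
      "(inverse_slope t / (1 - \<gamma>)) ^ (n - 1) \<le> (l / (1 - \<gamma>)) ^ (n - 1)" for t
    using l[of t] \<gamma>1 by (auto intro!: power_mono divide_right_mono)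
  have le: "AE t in unit_interval. 0 \<le> H' t * (inverse_slope t / (1 - \<gamma>)) ^ (n - 1) \<and>
      H' t * (inverse_slope t / (1 - \<gamma>)) ^ (n - 1) \<le> H' t * (l / (1 - \<gamma>)) ^ (n - 1)"
    using H'_ge
  proof eventually_elim
    case (elim t)
    then have "0 \<le> H' t" using c(1) by simp
    then show ?case using rate[of t] by (intro conjI mult_nonneg_nonneg mult_left_mono)
  qed
  have int_r: "integrable unit_interval (\<lambda>t. H' t * (l / (1 - \<gamma>)) ^ (n - 1))" using H'(1) by simp
  have int_l: "integrable unit_interval (\<lambda>t. H' t * (inverse_slope t / (1 - \<gamma>)) ^ (n - 1))"
  proof (rule Bochner_Integration.integrable_bound[OF int_r])
    show "AE t in unit_interval. norm (H' t * (inverse_slope t / (1 - \<gamma>)) ^ (n - 1)) \<le> norm (H' t * (l / (1 - \<gamma>)) ^ (n - 1))"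
      using le by eventually_elim simp
  qed measurable
  have "0 \<le> ?J" using le by (intro integral_nonneg_AE) (auto elim: eventually_mono)
  moreover have "?J \<le> (\<integral>t. H' t * (l / (1 - \<gamma>)) ^ (n - 1) \<partial>unit_interval)"
    using le by (intro integral_mono_AE int_l int_r) (auto elim: eventually_mono)
  ultimately show "\<bar>extremal_index n Th h (sync_sets n u) - 1\<bar> \<le> (l / (1 - \<gamma>)) ^ (n - 1)"
    unfolding index using H'_pos by (simp add: divide_le_eq mult.commute)
qed

end

theorem corollary5p7:
  fixes q :: nat and A :: "nat \<Rightarrow> real set" and T :: "real \<Rightarrow> real" and \<gamma> :: real
  assumes "piecewise_expanding q A T"
    and "\<gamma> \<in> {0..1}"
    and "contraction_rate q A T < ereal (1 - \<gamma>)"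
  shows
    "(\<forall>n\<ge>2. \<forall>\<tau> \<epsilon>0 B N h H u. cml_assumptions q A T \<gamma> n \<tau> \<epsilon>0 B N h H u \<longrightarrow>
        (\<forall>k. convergent (return_ratio n (cml n \<gamma> T) h (sync_sets n u) k)) \<and>
        summable (return_coeff n (cml n \<gamma> T) h (sync_sets n u)) \<and>
        extremal_index n (cml n \<gamma> T) h (sync_sets n u) =
          1 - 1 / (1 - \<gamma>) ^ (n - 1) *
              ((LINT x|lebesgue_on {0..1}. H x / \<bar>deriv T x\<bar> ^ (n - 1)) /
               (LINT x|lebesgue_on {0..1}. H x))) \<and>
     (\<forall>\<tau> \<epsilon>0 B N h H u.
        (\<forall>n\<ge>2. cml_assumptions q A T \<gamma> n (\<tau> n) (\<epsilon>0 n) (B n) (N n) (h n) (H n) (u n)) \<longrightarrow>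
        (\<lambda>n. extremal_index n (cml n \<gamma> T) (h n) (sync_sets n (u n))) \<longlonglongrightarrow> 1)"
proof -
  have map: "coupled_map q A T n \<gamma>" if "2 \<le> n" for n
    by unfold_locales (use assms that in auto)
  have formula: "(\<forall>k. convergent (return_ratio n (cml n \<gamma> T) h (sync_sets n u) k)) \<and>
      summable (return_coeff n (cml n \<gamma> T) h (sync_sets n u)) \<and>
      extremal_index n (cml n \<gamma> T) h (sync_sets n u) =
        1 - 1 / (1 - \<gamma>) ^ (n - 1) *
            ((LINT x|lebesgue_on {0..1}. H x / \<bar>deriv T x\<bar> ^ (n - 1)) /
             (LINT x|lebesgue_on {0..1}. H x))"
    if "2 \<le> n" "cml_assumptions q A T \<gamma> n \<tau> \<epsilon>0 B N h H u" for n \<tau> \<epsilon>0 B N h H u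
    using coupled_map.return_ratio_convergent[OF map[OF that(1)] that(2)]
      coupled_map.return_coeff_summable[OF map[OF that(1)] that(2)]
      coupled_map.extremal_index_eq[OF map[OF that(1)] that(2)] by blast
  have limit: "(\<lambda>n. extremal_index n (cml n \<gamma> T) (h n) (sync_sets n (u n))) \<longlonglongrightarrow> 1"
    if ass: "\<forall>n\<ge>2. cml_assumptions q A T \<gamma> n (\<tau> n) (\<epsilon>0 n) (B n) (N n) (h n) (H n) (u n)"
    for \<tau> \<epsilon>0 B N h H u
  proof -
    interpret expanding_map q A T by standard (rule assms(1))
    obtain l where l: "0 < l" "l < 1 - \<gamma>" "\<And>x. inverse_slope x \<le> l"
      using inverse_slope_bound[OF assms(3)] by metis
    have "(\<lambda>n. (l / (1 - \<gamma>)) ^ (n - 1)) \<longlonglongrightarrow> 0"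
      using l(1,2) by (subst filterlim_sequentially_Suc[symmetric]) (auto intro!: LIMSEQ_power_zero)
    moreover have "\<forall>\<^sub>F n in sequentially.
        norm (extremal_index n (cml n \<gamma> T) (h n) (sync_sets n (u n)) - 1) \<le> (l / (1 - \<gamma>)) ^ (n - 1)"
      using eventually_ge_at_top[of 2]
    proof eventually_elim
      case (elim n)
      then show ?case
        using coupled_map.extremal_index_bound[OF map[OF elim] ass[rule_format, OF elim] l(3)] by simp
    qed
    ultimately have "(\<lambda>n. extremal_index n (cml n \<gamma> T) (h n) (sync_sets n (u n)) - 1) \<longlonglongrightarrow> 0"
      by (rule Lim_null_comparison[rotated])
    then show ?thesis by (rule LIM_zero_cancel)
  qed
  show ?thesis
    by (rule conjI; intro allI impI) (rule formula, assumption+, rule limit, assumption)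
qed

end
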